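(* Let $\Omega$, $a$, $\beta$ be as in the context and $\mu\in\mathcal{M}_b^{\vec p}(\Omega)$. Suppose $(u,w)$ satisfies: $w\in L^1(\Omega)$, $u$ is measurable, $u\in\operatorname{dom}(\beta)$ a.e., $T_k(u)\in W_0^{1,\vec p}(\Omega)$ for all $k>0$, $w\in\beta(u)$ a.e.; there is $v\in\mathcal{M}_b(\Omega)$, $v\perp\mathcal{L}^N$, such that for every $h\in C_c(\mathbb{R})$, $h(u)\in L^\infty(\Omega,d|v|)$ and $h(u)v\in\mathcal{M}_b^{\vec p}(\Omega)$, $v^+$ is concentrated on $[u=M]\cap[u\ne+\infty]$, $v^-$ is concentrated on $[u=m]\cap[u\ne-\infty]$, and for all $h\in C_c^1(\mathbb{R})$, $\xi\in W_0^{1,\vec p}(\Omega)\cap L^\infty(\Omega)$: $\int_\Omega a(x,Du)\cdot D(h(u)\xi)dx+\int_\Omega wh(u)\xi dx+\int_\Omega h(u)\xi dv=\int_\Omega h(u)\xi d\mu$; and $\lim_{n\to\infty}\sum_{i=1}^N\int_{[n\le|u|\le n+1]}|\partial_{x_i}u|^{p_i}dx=0$. Then for every $\xi\in W_0^{1,\vec p}(\Omega)\cap L^\infty(\Omega)$ with $\xi\in\operatorname{dom}\beta$ a.e. in $\Omega$ and every $k>0$, $$\int_\Omega a(x,Du)\cdot DT_k(u-\xi)\,dx+\int_\Omega w\,T_k(u-\xi)\,dx\le\int_\Omega T_k(u-\xi)\,d\mu.$$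
   Context: $\Omega\subset\mathbb{R}^N$ bounded domain (Lipschitz boundary if $N\ge2$); $p_0,\dots,p_N\in(1,\infty)$, $p_i'=p_i/(p_i-1)$; $W_0^{1,\vec p}(\Omega)$ is the closure of $C_c^\infty(\Omega)$ in the norm $\|u\|_{L^{p_0}}+\sum_{i=1}^N\|\partial_{x_i}u\|_{L^{p_i}}$. $a:\Omega\times\mathbb{R}^N\to\mathbb{R}^N$ Carathéodory with, for a.e. $x$ and all $\xi,\eta$: (H1) $\sum_i a_i(x,\xi)\xi_i\ge\lambda\sum_i|\xi_i|^{p_i}$; (H2) $|a_i(x,\xi)|\le\gamma(d_i(x)+|\xi_i|^{p_i-1})$; (H3) $(a(x,\xi)-a(x,\eta))\cdot(\xi-\eta)\ge0$; $\lambda,\gamma>0$, $0\le d_i\in L^{p_i'}(\Omega)$. $\beta:\mathbb{R}\to2^{\mathbb{R}}$ maximal monotone, $0\in\beta(0)$, $\operatorname{int}(\operatorname{dom}\beta)=(m,M)$, $-\infty\le m\le0\le M\le+\infty$. $\operatorname{cap}_{\vec p}$: for compact $E$, $\inf\{\sum_i\int|\partial_{x_i}\varphi|^{p_i}:\varphi\in W_0^{1,\vec p},\varphi\ge\chi_E\}$, extended to open sets by sup over compact subsets and to arbitrary sets by inf over open supersets. $\mathcal{M}_b(\Omega)$: bounded Radon measures; $\mathcal{M}_b^{\vec p}(\Omega)$: those vanishing on Borel sets of zero capacity. $T_k(r)=\max(-k,\min(k,r))$; $Du$ is defined by $DT_k(u)=Du\chi_{[|u|<k]}$; functions are identified with quasi-continuous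 representatives so that integrals against measures in $\mathcal{M}_b^{\vec p}(\Omega)$ make sense. *)

theory Defs
  imports "HOL-Analysis.Analysis"
begin

fun Ck :: "nat \<Rightarrow> ('a::euclidean_space \<Rightarrow> real) \<Rightarrow> bool" where
  "Ck 0 f = continuous_on UNIV f"
| "Ck (Suc k) f = ((\<forall>x. f differentiable (at x)) \<and>
      (\<forall>i\<in>Basis. Ck k (\<lambda>x. frechet_derivative f (at x) i)))"

definition smooth_fun :: "('a::euclidean_space \<Rightarrow> real) \<Rightarrow> bool" where
  "smooth_fun f \<longleftrightarrow> (\<forall>k. Ck k f)"

definition pder :: "('a::euclidean_space \<Rightarrow> real) \<Rightarrow> 'a \<Rightarrow> 'a \<Rightarrow> real" where
  "pder f i x = frechet_derivative f (at x) i"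

definition supp_in :: "('a::euclidean_space \<Rightarrow> real) \<Rightarrow> 'a set \<Rightarrow> bool" where
  "supp_in f S \<longleftrightarrow> compact (closure {x. f x \<noteq> 0}) \<and> closure {x. f x \<noteq> 0} \<subseteq> S"

definition test_fun :: "'a::euclidean_space set \<Rightarrow> ('a \<Rightarrow> real) \<Rightarrow> bool" where
  "test_fun \<Omega> f \<longleftrightarrow> smooth_fun f \<and> supp_in f \<Omega>"

definition Cc :: "(real \<Rightarrow> real) \<Rightarrow> bool" where
  "Cc h \<longleftrightarrow> continuous_on UNIV h \<and> supp_in h UNIV"

definition Cc1 :: "(real \<Rightarrow> real) \<Rightarrow> bool" where
  "Cc1 h \<longleftrightarrow> Ck 1 h \<and> supp_in h UNIV"

definition Lp_mem :: "'a::euclidean_space set \<Rightarrow> real \<Rightarrow> ('a \<Rightarrow> real) \<Rightarrow> bool" where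
  "Lp_mem \<Omega> p f \<longleftrightarrow> f \<in> borel_measurable (lebesgue_on \<Omega>) \<and>
      integrable (lebesgue_on \<Omega>) (\<lambda>x. \<bar>f x\<bar> powr p)"

definition Lp_norm :: "'a::euclidean_space set \<Rightarrow> real \<Rightarrow> ('a \<Rightarrow> real) \<Rightarrow> real" where
  "Lp_norm \<Omega> p f = (\<integral>x. \<bar>f x\<bar> powr p \<partial>lebesgue_on \<Omega>) powr (1 / p)"

definition Linf_mem :: "'a::euclidean_space set \<Rightarrow> ('a \<Rightarrow> real) \<Rightarrow> bool" where
  "Linf_mem \<Omega> f \<longleftrightarrow> f \<in> borel_measurable (lebesgue_on \<Omega>) \<and>
      (\<exists>C. AE x in lebesgue_on \<Omega>. \<bar>f x\<bar> \<le> C)"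

text \<open>\<open>W0_grad \<Omega> p0 p u G\<close>: u belongs to the closure of C_c^infinity(Omega) in the norm
  ||u||_{p0} + sum_i ||d_i u||_{p_i}, and G is its (weak) gradient, i.e. G \<bullet> i is the
  limit of the partial derivatives in direction i of the approximating test functions.
  Exponents: p0 for u itself, p i (i \<in> Basis) for the i-th partial derivative.\<close>
definition W0_grad :: "'a::euclidean_space set \<Rightarrow> real \<Rightarrow> ('a \<Rightarrow> real) \<Rightarrow> ('a \<Rightarrow> real)
     \<Rightarrow> ('a \<Rightarrow> 'a) \<Rightarrow> bool" where
  "W0_grad \<Omega> p0 p u G \<longleftrightarrow> Lp_mem \<Omega> p0 u \<and> (\<forall>i\<in>Basis. Lp_mem \<Omega> (p i) (\<lambda>x. G x \<bullet> i)) \<and>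
     (\<exists>\<phi>. (\<forall>n. test_fun \<Omega> (\<phi> n)) \<and>
        (\<lambda>n. Lp_norm \<Omega> p0 (\<lambda>x. \<phi> n x - u x)) \<longlonglongrightarrow> 0 \<and>
        (\<forall>i\<in>Basis. (\<lambda>n. Lp_norm \<Omega> (p i) (\<lambda>x. pder (\<phi> n) i x - G x \<bullet> i)) \<longlonglongrightarrow> 0))"

definition W0 :: "'a::euclidean_space set \<Rightarrow> real \<Rightarrow> ('a \<Rightarrow> real) \<Rightarrow> ('a \<Rightarrow> real) \<Rightarrow> bool" where
  "W0 \<Omega> p0 p u \<longleftrightarrow> (\<exists>G. W0_grad \<Omega> p0 p u G)"

definition cap_compact :: "'a::euclidean_space set \<Rightarrow> real \<Rightarrow> ('a \<Rightarrow> real) \<Rightarrow> 'a set \<Rightarrow> ereal" where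
  "cap_compact \<Omega> p0 p K = Inf {ereal (\<Sum>i\<in>Basis. \<integral>x. \<bar>G x \<bullet> i\<bar> powr (p i) \<partial>lebesgue_on \<Omega>) |
       \<phi> G. W0_grad \<Omega> p0 p \<phi> G \<and> continuous_on \<Omega> \<phi> \<and> (\<forall>x\<in>\<Omega>. indicator K x \<le> \<phi> x)}"

definition cap_open :: "'a::euclidean_space set \<Rightarrow> real \<Rightarrow> ('a \<Rightarrow> real) \<Rightarrow> 'a set \<Rightarrow> ereal" where
  "cap_open \<Omega> p0 p U = Sup {cap_compact \<Omega> p0 p K | K. compact K \<and> K \<subseteq> U}"

definition cap :: "'a::euclidean_space set \<Rightarrow> real \<Rightarrow> ('a \<Rightarrow> real) \<Rightarrow> 'a set \<Rightarrow> ereal" where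
  "cap \<Omega> p0 p E = Inf {cap_open \<Omega> p0 p U | U. open U \<and> E \<subseteq> U \<and> U \<subseteq> \<Omega>}"

definition quasi_cont :: "'a::euclidean_space set \<Rightarrow> real \<Rightarrow> ('a \<Rightarrow> real) \<Rightarrow> ('a \<Rightarrow> real) \<Rightarrow> bool" where
  "quasi_cont \<Omega> p0 p f \<longleftrightarrow> (\<forall>\<epsilon>>0. \<exists>U. open U \<and> U \<subseteq> \<Omega> \<and> cap \<Omega> p0 p U < ereal \<epsilon> \<and>
       continuous_on (\<Omega> - U) f)"

text \<open>A bounded signed Radon measure nu on Omega is represented by its Jordan decomposition
  (nu+, nu-): two finite Borel measures on Omega which are mutually singular.
  Integration against nu is integration against nu+ minus integration against nu-
  (with respect to the completions).\<close>
definition Mb :: "'a::euclidean_space set \<Rightarrow> 'a measure \<Rightarrow> 'a measure \<Rightarrow> bool" where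
  "Mb \<Omega> vp vn \<longleftrightarrow> sets vp = sets (restrict_space borel \<Omega>) \<and> sets vn = sets (restrict_space borel \<Omega>) \<and>
     finite_measure vp \<and> finite_measure vn \<and>
     (\<exists>A \<in> sets (restrict_space borel \<Omega>). emeasure vp (\<Omega> - A) = 0 \<and> emeasure vn A = 0)"

definition Mb_p :: "'a::euclidean_space set \<Rightarrow> real \<Rightarrow> ('a \<Rightarrow> real) \<Rightarrow> 'a measure \<Rightarrow> 'a measure \<Rightarrow> bool" where
  "Mb_p \<Omega> p0 p vp vn \<longleftrightarrow> Mb \<Omega> vp vn \<and>
     (\<forall>E \<in> sets (restrict_space borel \<Omega>). cap \<Omega> p0 p E = 0 \<longrightarrow> emeasure vp E = 0 \<and> emeasure vn E = 0)"

definition dens_Mb_p :: "'a::euclidean_space set \<Rightarrow> real \<Rightarrow> ('a \<Rightarrow> real) \<Rightarrow> ('a \<Rightarrow> real)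
     \<Rightarrow> 'a measure \<Rightarrow> 'a measure \<Rightarrow> bool" where
  "dens_Mb_p \<Omega> p0 p f vp vn \<longleftrightarrow>
     (\<forall>E \<in> sets (restrict_space borel \<Omega>). cap \<Omega> p0 p E = 0 \<longrightarrow>
        (\<integral>\<^sup>+x\<in>E. ennreal \<bar>f x\<bar> \<partial>completion vp) = 0 \<and> (\<integral>\<^sup>+x\<in>E. ennreal \<bar>f x\<bar> \<partial>completion vn) = 0)"

definition Linf_abs :: "('a \<Rightarrow> real) \<Rightarrow> 'a measure \<Rightarrow> 'a measure \<Rightarrow> bool" where
  "Linf_abs f vp vn \<longleftrightarrow> f \<in> borel_measurable (completion vp) \<and> f \<in> borel_measurable (completion vn) \<and>
     (\<exists>C. (AE x in vp. \<bar>f x\<bar> \<le> C) \<and> (AE x in vn. \<bar>f x\<bar> \<le> C))"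

definition sint :: "'a measure \<Rightarrow> 'a measure \<Rightarrow> ('a \<Rightarrow> real) \<Rightarrow> real" where
  "sint vp vn f = (\<integral>x. f x \<partial>completion vp) - (\<integral>x. f x \<partial>completion vn)"

definition sing_leb :: "'a::euclidean_space set \<Rightarrow> 'a measure \<Rightarrow> 'a measure \<Rightarrow> bool" where
  "sing_leb \<Omega> vp vn \<longleftrightarrow> (\<exists>Z \<in> sets borel. Z \<subseteq> \<Omega> \<and> emeasure lebesgue Z = 0 \<and>
      emeasure vp (\<Omega> - Z) = 0 \<and> emeasure vn (\<Omega> - Z) = 0)"

definition concentrated_on :: "'a measure \<Rightarrow> 'a set \<Rightarrow> bool" where
  "concentrated_on v S \<longleftrightarrow> (\<exists>B \<in> sets v. B \<subseteq> S \<and> emeasure v (space v - B) = 0)"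

definition Tk :: "real \<Rightarrow> ereal \<Rightarrow> real" where
  "Tk k r = real_of_ereal (max (- ereal k) (min (ereal k) r))"

text \<open>h(r) for an extended real r; h(+-infinity) = 0 (h has compact support).\<close>
definition eapp :: "(real \<Rightarrow> real) \<Rightarrow> ereal \<Rightarrow> real" where
  "eapp h r = (if \<bar>r\<bar> = \<infinity> then 0 else h (real_of_ereal r))"

definition max_monotone :: "(real \<Rightarrow> real set) \<Rightarrow> bool" where
  "max_monotone \<beta> \<longleftrightarrow>
     (\<forall>r1 r2 s1 s2. s1 \<in> \<beta> r1 \<longrightarrow> s2 \<in> \<beta> r2 \<longrightarrow> 0 \<le> (s1 - s2) * (r1 - r2)) \<and>
     (\<forall>r s. (\<forall>r' s'. s' \<in> \<beta> r' \<longrightarrow> 0 \<le> (s - s') * (r - r')) \<longrightarrow> s \<in> \<beta> r)"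

definition dom_graph :: "(real \<Rightarrow> real set) \<Rightarrow> real set" where
  "dom_graph \<beta> = {r. \<beta> r \<noteq> {}}"

definition lipschitz_boundary :: "'a::euclidean_space set \<Rightarrow> bool" where
  "lipschitz_boundary \<Omega> \<longleftrightarrow> (\<forall>x\<in>frontier \<Omega>. \<exists>r>0. \<exists>e g L. norm e = 1 \<and>
      L-lipschitz_on {z. z \<bullet> e = 0} g \<and>
      \<Omega> \<inter> ball x r = {y \<in> ball x r. y \<bullet> e < g (y - (y \<bullet> e) *\<^sub>R e)})"

end

theory Submission
  imports Defs
begin

text \<open>The weak formulation is tested with \<open>h = cutoff n\<close> and \<open>\<psi> = T\<^sub>k(u - \<xi>)\<close>, and \<open>n\<close> tends to infinity.
  The integral against \<open>v\<close> is nonnegative, because \<open>m \<le> \<xi> \<le> M\<close> gives \<open>\<psi>\<close> the right sign on \<open>[u = M]\<close> and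
  \<open>[u = m]\<close>. The term containing \<open>h'(u)\<close> lives on the layer \<open>[n \<le> \<bar>u\<bar> \<le> n + 1]\<close> and disappears by the growth
  condition and the energy condition. Where \<open>\<bar>u\<bar>\<close> exceeds \<open>k + sup \<bar>\<xi>\<bar>\<close> the function \<open>\<psi>\<close> is constant, so that its
  gradient vanishes there and \<open>a(x, Du) \<bullet> D\<psi>\<close> is integrable.

  For the measures, \<open>m \<le> \<xi> \<le> M\<close> and \<open>\<bar>u\<bar> < \<infinity>\<close> are needed quasi-everywhere and not just almost everywhere.
  Both follow from a two-sided comparison, up to constants, of the capacity of an open set with the energy
  of functions that are a.e. at least \<open>1\<close> on it; such energies do not see Lebesgue null sets.\<close>

subsection \<open>Smooth functions\<close>

text \<open>The measure \<open>v\<close> is singular, so a property known only a.e. says nothing on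
  the sets \<open>[u = M]\<close> and \<open>[u = m]\<close> that carry it; this is why the domain
  condition on \<xi> has to be sharpened. Vanishing on sets of zero capacity is assumed for the
  weighted measures \<open>h(u) v\<close>, so on an exceptional set it is the weight that is 0.
  Capacity enters only through smallness: subadditivity up to a constant is enough, and constants
  are never optimised. Limits in \<open>W\<close> come from uniform convexity, and truncations are
  compositions with bounded smooth functions, for which the chain rule passes directly through the
  approximating test functions. What is used about the gradient \<open>G\<close> of the truncated
  difference is its integrability and its vanishing on the levels k and -k. The exponents are linked
  to each other by no relation, so comparisons between powers rest on the finite measure of
  \<Omega>.\<close>

lemma Ck_SucD: "Ck (Suc k) f \<Longrightarrow> Ck k f"
proof (induction k arbitrary: f)
  case 0
  then show ?case
    by (auto simp: continuous_on_eq_continuous_at differentiable_imp_continuous_within)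
next
  case (Suc k)
  then show ?case by (metis Ck.simps(2))
qed

lemma Ck_imp_continuous: "Ck k f \<Longrightarrow> continuous_on UNIV f"
proof (induction k)
  case (Suc k)
  then show ?case using Ck_SucD by blast
qed simp

lemma Ck_SucI:
  assumes "\<And>x. (f has_derivative f' x) (at x)" "\<And>i. i \<in> Basis \<Longrightarrow> Ck k (\<lambda>x. f' x i)"
  shows "Ck (Suc k) f"
proof -
  have "frechet_derivative f (at x) = f' x" for x
    using frechet_derivative_at[OF assms(1)] by simp
  then show ?thesis using assms by (auto simp: differentiable_def)
qed

lemma Ck_Suc_has_derivative:
  "Ck (Suc k) f \<Longrightarrow> (f has_derivative frechet_derivative f (at x)) (at x)"
  by (simp add: frechet_derivative_works[symmetric])

lemma Ck_const: "Ck k (\<lambda>x. c)"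
  by (induction k arbitrary: c) auto

lemma Ck_add: "Ck k f \<Longrightarrow> Ck k g \<Longrightarrow> Ck k (\<lambda>x. f x + g x)"
proof (induction k arbitrary: f g)
  case 0 then show ?case by (auto intro: continuous_intros)
next
  case (Suc k)
  show ?case
    by (rule Ck_SucI[OF has_derivative_add[OF Suc.prems[THEN Ck_Suc_has_derivative]]])
      (use Suc in auto)
qed

lemma Ck_mult: "Ck k f \<Longrightarrow> Ck k g \<Longrightarrow> Ck k (\<lambda>x. f x * g x)"
proof (induction k arbitrary: f g)
  case 0 then show ?case by (auto intro: continuous_intros)
next
  case (Suc k)
  show ?case
    by (rule Ck_SucI[OF has_derivative_mult[OF Suc.prems[THEN Ck_Suc_has_derivative]]])
      (use Suc Suc.prems[THEN Ck_SucD] in \<open>auto intro!: Ck_add\<close>)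
qed

text \<open>Once the derivative of \<open>F\<close> is identified with multiplication by its value
  at 1, the chain rule writes the derivative as a product of \<open>Ck k\<close> functions; the
  induction runs over both functions.\<close>

lemma Ck_compose:
  fixes F :: "real \<Rightarrow> real"
  shows "Ck k F \<Longrightarrow> Ck k g \<Longrightarrow> Ck k (\<lambda>x. F (g x))"
proof (induction k arbitrary: F g)
  case 0 then show ?case by (auto intro: continuous_on_compose2)
next
  case (Suc k)
  let ?F' = "\<lambda>t. frechet_derivative F (at t) 1"
  have "frechet_derivative F (at t) s = s * ?F' t" for s t
    using linear_scale[of "frechet_derivative F (at t)" s 1]
      linear_frechet_derivative[of F "at t"] Suc.prems(1) by simp
  then have eq: "frechet_derivative F (at t) = (\<lambda>s. s * ?F' t)" for t by blast
  have d: "((\<lambda>x. F (g x)) has_derivative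
      (\<lambda>v. frechet_derivative g (at x) v * ?F' (g x))) (at x)" for x
    by (rule has_derivative_eq_rhs[OF has_derivative_compose[OF Ck_Suc_has_derivative[OF Suc.prems(2)]
        Ck_Suc_has_derivative[OF Suc.prems(1)]]]) (rule ext, subst eq, rule refl)
  show ?case
    by (rule Ck_SucI[OF d]) (use Suc Suc.prems(2)[THEN Ck_SucD] in \<open>auto intro!: Ck_mult\<close>)
qed

lemma Ck_real_SucI:
  assumes "\<And>t. (F has_real_derivative F' t) (at t)" "Ck k F'"
  shows "Ck (Suc k) F"
  by (rule Ck_SucI[where f' = "\<lambda>t s. F' t * s"])
     (use assms in \<open>auto simp: has_field_derivative_def Ck_mult Ck_const\<close>)

lemma Ck_ident: "Ck k (\<lambda>t::real. t)"
  by (cases k) (auto intro!: Ck_real_SucI[where F' = "\<lambda>_. 1"] Ck_const derivative_intros)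

lemma smooth_const: "smooth_fun (\<lambda>x. c)"
  and smooth_ident: "smooth_fun (\<lambda>t::real. t)"
  by (auto simp: smooth_fun_def Ck_const Ck_ident)

lemma smooth_add: "smooth_fun f \<Longrightarrow> smooth_fun g \<Longrightarrow> smooth_fun (\<lambda>x. f x + g x)"
  and smooth_mult: "smooth_fun f \<Longrightarrow> smooth_fun g \<Longrightarrow> smooth_fun (\<lambda>x. f x * g x)"
  by (auto simp: smooth_fun_def Ck_add Ck_mult)

lemma smooth_compose:
  fixes F :: "real \<Rightarrow> real"
  shows "smooth_fun F \<Longrightarrow> smooth_fun g \<Longrightarrow> smooth_fun (\<lambda>x. F (g x))"
  by (auto simp: smooth_fun_def Ck_compose)

lemma smooth_cmult: "smooth_fun f \<Longrightarrow> smooth_fun (\<lambda>x. c * f x)"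
  by (intro smooth_mult smooth_const)

lemma smooth_uminus: "smooth_fun f \<Longrightarrow> smooth_fun (\<lambda>x. - f x)"
  using smooth_cmult[of f "-1"] by simp

lemma smooth_diff: "smooth_fun f \<Longrightarrow> smooth_fun g \<Longrightarrow> smooth_fun (\<lambda>x. f x - g x)"
  using smooth_add[OF _ smooth_uminus] by fastforce

lemma smooth_continuous: "smooth_fun f \<Longrightarrow> continuous_on S f"
  using Ck_imp_continuous continuous_on_subset by (metis smooth_fun_def subset_UNIV)

lemma smooth_has_derivative:
  "smooth_fun f \<Longrightarrow> (f has_derivative frechet_derivative f (at x)) (at x)"
  using Ck_Suc_has_derivative unfolding smooth_fun_def by blast

lemma smooth_pder: "smooth_fun f \<Longrightarrow> i \<in> Basis \<Longrightarrow> smooth_fun (pder f i)"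
  unfolding smooth_fun_def pder_def by (metis Ck.simps(2))

lemma has_derivative_pder: "(f has_derivative f') (at x) \<Longrightarrow> pder f i x = f' i"
  unfolding pder_def by (metis frechet_derivative_at)

lemma smooth_has_real_derivative:
  fixes F :: "real \<Rightarrow> real"
  assumes "smooth_fun F"
  shows "(F has_real_derivative deriv F t) (at t)"
proof -
  have "F differentiable at t" using smooth_has_derivative[OF assms] differentiableI by blast
  then show ?thesis
    using DERIV_deriv_iff_real_differentiable by blast
qed

lemma smooth_deriv: 
  fixes F :: "real \<Rightarrow> real"
  assumes "smooth_fun F"
  shows "smooth_fun (deriv F)"
proof -
  have "pder F 1 = deriv F"
    using has_derivative_pder[of F _ _ 1] smooth_has_real_derivative[OF assms]
    by (fastforce simp: has_field_derivative_def)
  then show ?thesis using smooth_pder[OF assms, of 1] by simp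
qed

lemma pder_compose:
  assumes "smooth_fun F" "smooth_fun g"
  shows "pder (\<lambda>x. F (g x)) i x = deriv F (g x) * pder g i x"
  unfolding pder_def[of g]
  by (intro has_derivative_pder has_derivative_compose[OF smooth_has_derivative[OF assms(2)], of F "(*) (deriv F (g x))", simplified])
     (use smooth_has_real_derivative[OF assms(1)] in \<open>simp add: has_field_derivative_def\<close>)

lemma pder_mult:
  assumes "smooth_fun f" "smooth_fun g"
  shows "pder (\<lambda>x. f x * g x) i x = f x * pder g i x + pder f i x * g x"
  unfolding pder_def[of g] pder_def[of f]
  by (rule has_derivative_pder has_derivative_mult assms[THEN smooth_has_derivative])+

lemma pder_add:
  assumes "smooth_fun f" "smooth_fun g"
  shows "pder (\<lambda>x. f x + g x) i x = pder f i x + pder g i x"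
  unfolding pder_def[of g] pder_def[of f]
  by (rule has_derivative_pder has_derivative_add assms[THEN smooth_has_derivative])+

lemma pder_diff:
  assumes "smooth_fun f" "smooth_fun g"
  shows "pder (\<lambda>x. f x - g x) i x = pder f i x - pder g i x"
  unfolding pder_def[of g] pder_def[of f]
  by (rule has_derivative_pder has_derivative_diff assms[THEN smooth_has_derivative])+

lemma pder_cmult:
  assumes "smooth_fun f"
  shows "pder (\<lambda>x. c * f x) i x = c * pder f i x"
  unfolding pder_def[of f]
  by (rule has_derivative_pder has_derivative_mult_right assms[THEN smooth_has_derivative])+

section \<open>A smooth step function\<close>

definition flat :: "nat \<Rightarrow> real \<Rightarrow> real" where
  "flat m t = (if t > 0 then inverse t ^ m * exp (- inverse t) else 0)"

lemma flat_tendsto_0: "(flat m \<longlongrightarrow> 0) (at 0)"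
proof -
  have "((\<lambda>t. inverse t ^ m / exp (inverse t)) \<longlongrightarrow> 0) (at_right (0::real))"
    by (rule filterlim_compose[OF tendsto_power_div_exp_0 filterlim_inverse_at_top_right])
  then have r: "(flat m \<longlongrightarrow> 0) (at_right 0)"
    by (rule Lim_transform_eventually)
      (auto simp: flat_def eventually_at_filter exp_minus divide_inverse)
  have l: "(flat m \<longlongrightarrow> 0) (at_left 0)"
    by (rule tendsto_eventually) (auto simp: flat_def eventually_at_filter)
  show ?thesis using l r by (rule filterlim_split_at)
qed

text \<open>Powers of \<open>inverse t\<close> are kept in \<open>flat\<close> so that the family is
  closed under differentiation; \<open>Ck_flat\<close> is then an induction on \<open>k\<close> for
  all \<open>m\<close> at once. At 0 the difference quotient of \<open>flat m\<close> is
  \<open>flat (m+1)\<close>, which tends to 0.\<close>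

lemma flat_has_derivative:
  "(flat m has_real_derivative (flat (m+2) t - m * flat (m+1) t)) (at t)"
proof -
  consider "t > 0" | "t < 0" | "t = 0" by linarith
  then show ?thesis
  proof cases
    case 1
    have "((\<lambda>t. inverse t ^ m * exp (- inverse t)) has_real_derivative
       (flat (m+2) t - m * flat (m+1) t)) (at t)"
      using 1 by (auto intro!: derivative_eq_intros simp: flat_def) 
        (cases m; simp add: field_simps power2_eq_square)
    then show ?thesis
      by (rule DERIV_cong_ev[OF refl _ refl, THEN iffD1, rotated])
        (use 1 in \<open>auto simp: flat_def intro: eventually_mono[OF eventually_nhds_in_open[of "{0<..}"]]\<close>)
  next
    case 2
    have "((\<lambda>t. 0) has_real_derivative (flat (m+2) t - m * flat (m+1) t)) (at t)"
      using 2 by (simp add: flat_def)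
    then show ?thesis
      by (rule DERIV_cong_ev[OF refl _ refl, THEN iffD1, rotated])
        (use 2 in \<open>auto simp: flat_def intro: eventually_mono[OF eventually_nhds_in_open[of "{..<0}"]]\<close>)
  next
    case 3
    have "((\<lambda>h. (flat m (0 + h) - flat m 0) / h) \<longlongrightarrow> 0) (at 0)"
      by (rule Lim_transform_eventually[OF flat_tendsto_0[of "m+1"]])
        (auto simp: flat_def eventually_at_filter divide_simps)
    then show ?thesis using 3 by (simp add: DERIV_def flat_def)
  qed
qed

lemma Ck_flat: "Ck k (flat m)"
proof (induction k arbitrary: m)
  case 0
  show ?case
    unfolding Ck.simps by (rule DERIV_continuous_on[OF has_field_derivative_at_within[OF flat_has_derivative]])
next
  case (Suc k)
  have "Ck k (\<lambda>t. flat (m+2) t + (- real m) * flat (m+1) t)"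
    by (intro Ck_add Ck_mult Ck_const Suc)
  then show ?case
    by (intro Ck_real_SucI[OF flat_has_derivative]) simp
qed

lemma smooth_flat: "smooth_fun (flat m)"
  by (simp add: smooth_fun_def Ck_flat)

lemma flat_pos_iff [simp]: "flat m t > 0 \<longleftrightarrow> t > 0"
  and flat_nonneg [simp]: "flat m t \<ge> 0"
  and flat_nonpos [simp]: "t \<le> 0 \<Longrightarrow> flat m t = 0"
  by (auto simp: flat_def)

text \<open>The normalised antiderivative of the bump \<open>flat 0 t * flat 0 (1 - t)\<close>,
  which is positive exactly between 0 and 1.\<close>

lemma smooth_step_exists:
  "\<exists>\<sigma>::real\<Rightarrow>real. smooth_fun \<sigma> \<and> (\<forall>t\<le>0. \<sigma> t = 0) \<and> (\<forall>t\<ge>1. \<sigma> t = 1) \<and> (\<forall>t. 0 \<le> \<sigma> t \<and> \<sigma> t \<le> 1)"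
proof -
  define b where "b t = flat 0 t * flat 0 (1 - t)" for t
  have sb: "smooth_fun b"
    unfolding b_def by (intro smooth_mult smooth_flat smooth_compose[OF smooth_flat] smooth_diff smooth_const smooth_ident)
  have "isCont b x" for x
    using smooth_continuous[OF sb, of UNIV] by (simp add: continuous_on_eq_continuous_at)
  then obtain F where F: "\<And>x. (F has_real_derivative b x) (at x)"
    using einterval_antiderivative[of "-\<infinity>" "\<infinity>" b]
    by (auto simp: has_real_derivative_iff_has_vector_derivative)
  have mono: "F s \<le> F t" if "s \<le> t" for s t
    using DERIV_nonneg_imp_nondecreasing[OF that, of F] F by (metis b_def flat_nonneg mult_nonneg_nonneg)
  have less: "F 0 < F 1"
  proof -
    obtain z where "0 < z" "z < 1" "F 1 - F 0 = (1 - 0) * b z"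
      using MVT2[of 0 1 F b] F by auto
    moreover have "b z > 0" using \<open>0 < z\<close> \<open>z < 1\<close> by (simp add: b_def)
    ultimately show ?thesis by simp
  qed
  have low: "F t = F 0" if "t \<le> 0" for t
  proof (cases "t = 0")
    case False
    then have "t < 0" using that by simp
    then obtain z where "t < z" "z < 0" "F 0 - F t = (0 - t) * b z"
      using MVT2[of t 0 F b] F by blast
    then show ?thesis by (simp add: b_def)
  qed simp
  have high: "F t = F 1" if "t \<ge> 1" for t
  proof (cases "t = 1")
    case False
    then have "1 < t" using that by simp
    then obtain z where "1 < z" "z < t" "F t - F 1 = (t - 1) * b z"
      using MVT2[of 1 t F b] F by blast
    then show ?thesis by (simp add: b_def)
  qed simp
  have sF: "smooth_fun F"
    unfolding smooth_fun_def
  proof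
    fix k
    have "Ck (Suc k) F" using Ck_real_SucI[OF F] sb by (simp add: smooth_fun_def)
    then show "Ck k F" by (rule Ck_SucD)
  qed
  have bd: "F 0 \<le> F t \<and> F t \<le> F 1" for t
    using mono low high by (metis linear)
  define \<sigma> where "\<sigma> t = (1 / (F 1 - F 0)) * (F t - F 0)" for t
  have "smooth_fun \<sigma>" unfolding \<sigma>_def by (intro smooth_mult smooth_const smooth_diff sF)
  moreover have "\<sigma> t = 0" if "t \<le> 0" for t using low[OF that] by (simp add: \<sigma>_def)
  moreover have "\<sigma> t = 1" if "t \<ge> 1" for t using high[OF that] less by (simp add: \<sigma>_def)
  moreover have "0 \<le> \<sigma> t" "\<sigma> t \<le> 1" for t using bd[of t] less by (auto simp: \<sigma>_def divide_simps)
  ultimately show ?thesis by blast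
qed

definition step :: "real \<Rightarrow> real" where
  "step = (SOME \<sigma>. smooth_fun \<sigma> \<and> (\<forall>t\<le>0. \<sigma> t = 0) \<and> (\<forall>t\<ge>1. \<sigma> t = 1) \<and> (\<forall>t. 0 \<le> \<sigma> t \<and> \<sigma> t \<le> 1))"

lemma smooth_step: "smooth_fun step"
  and step_low [simp]: "t \<le> 0 \<Longrightarrow> step t = 0"
  and step_high [simp]: "t \<ge> 1 \<Longrightarrow> step t = 1"
  and step_nonneg [simp]: "0 \<le> step t"
  and step_le_1 [simp]: "step t \<le> 1"
  using someI_ex[OF smooth_step_exists] unfolding step_def[symmetric] by auto

lemma smooth_deriv_zero_off:
  fixes F :: "real \<Rightarrow> real"
  assumes "smooth_fun F" "open S" "t \<in> S" "\<And>s. s \<in> S \<Longrightarrow> F s = c"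
  shows "deriv F t = 0"
proof -
  have "((\<lambda>_. c) has_real_derivative 0) (at t)" by simp
  then have "(F has_real_derivative 0) (at t)"
    by (rule has_field_derivative_transform_within_open[OF _ assms(2,3)]) (simp add: assms(4))
  then show ?thesis by (rule DERIV_imp_deriv)
qed

lemma continuous_deriv_zero_closure:
  fixes F :: "real \<Rightarrow> real"
  assumes "smooth_fun F" "\<And>t. t \<in> S \<Longrightarrow> deriv F t = 0" "t \<in> closure S"
  shows "deriv F t = 0"
proof -
  have "closed {t. deriv F t = 0}"
    using smooth_continuous[OF smooth_deriv[OF assms(1)], of UNIV]
    by (intro closed_Collect_eq) auto
  then have "closure S \<subseteq> {t. deriv F t = 0}"
    by (intro closure_minimal) (use assms(2) in auto)
  then show ?thesis using assms(3) by auto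
qed

text \<open>The endpoints 0 and 1 are reached by continuity of the derivative. They matter later:
  \<psi> may equal k on a large set, and the cutoff at level k must have derivative 0 there.\<close>

lemma deriv_step_zero: "t \<le> 0 \<or> t \<ge> 1 \<Longrightarrow> deriv step t = 0"
proof -
  have a: "deriv step t = 0" if "t \<in> {..<0}" for t
    by (rule smooth_deriv_zero_off[OF smooth_step open_lessThan that, of 0]) auto
  have b: "deriv step t = 0" if "t \<in> {1<..}" for t
    by (rule smooth_deriv_zero_off[OF smooth_step open_greaterThan that, of 1]) auto
  show "t \<le> 0 \<or> t \<ge> 1 \<Longrightarrow> ?thesis"
    using continuous_deriv_zero_closure[where S = "{..<0}" and t = t, OF smooth_step a]
      continuous_deriv_zero_closure[where S = "{1<..}" and t = t, OF smooth_step b] by auto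
qed

lemma bounded_if_zero_off_interval:
  fixes f :: "real \<Rightarrow> real"
  assumes "continuous_on UNIV f" "\<And>t. t < a \<or> t > b \<Longrightarrow> f t = 0"
  shows "\<exists>B>0. \<forall>t. \<bar>f t\<bar> \<le> B"
proof -
  have "compact (f ` {a..b})"
    using assms(1) by (intro compact_continuous_image) (auto intro: continuous_on_subset)
  then obtain B where B: "B > 0" "\<And>y. y \<in> f ` {a..b} \<Longrightarrow> norm y \<le> B"
    using compact_imp_bounded bounded_pos by metis
  have "\<bar>f t\<bar> \<le> B" for t
    using B assms(2)[of t] by (cases "t < a \<or> t > b") auto
  then show ?thesis using B(1) by blast
qed

lemma deriv_step_bounded: "\<exists>B>0. \<forall>t. \<bar>deriv step t\<bar> \<le> B"
  by (rule bounded_if_zero_off_interval[of _ 0 1])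
     (auto intro: smooth_continuous[OF smooth_deriv[OF smooth_step]] deriv_step_zero)

subsection \<open>Spaces of p-th power integrable functions\<close>

definition Lmem :: "'a measure \<Rightarrow> real \<Rightarrow> ('a \<Rightarrow> real) \<Rightarrow> bool" where
  "Lmem M p f \<longleftrightarrow> f \<in> borel_measurable M \<and> integrable M (\<lambda>x. \<bar>f x\<bar> powr p)"

abbreviation pint :: "'a measure \<Rightarrow> real \<Rightarrow> ('a \<Rightarrow> real) \<Rightarrow> real" where
  "pint M p f \<equiv> \<integral>x. \<bar>f x\<bar> powr p \<partial>M"

text \<open>Stated with p-th powers instead of norms: powers add up over the directions with their
  different exponents, and the triangle inequality with the extra factor \<open>2 powr p\<close>
  suffices for every limit below.\<close>

definition Lconv :: "'a measure \<Rightarrow> real \<Rightarrow> (nat \<Rightarrow> 'a \<Rightarrow> real) \<Rightarrow> ('a \<Rightarrow> real) \<Rightarrow> bool" where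
  "Lconv M p f g \<longleftrightarrow> (\<lambda>n. pint M p (\<lambda>x. f n x - g x)) \<longlonglongrightarrow> 0"

lemma Lp_mem_iff_Lmem: "Lp_mem \<Omega> p f \<longleftrightarrow> Lmem (lebesgue_on \<Omega>) p f"
  by (simp add: Lp_mem_def Lmem_def)

lemma powr_abs_add_le:
  fixes a b :: real
  assumes "0 \<le> p"
  shows "\<bar>a + b\<bar> powr p \<le> 2 powr p * (\<bar>a\<bar> powr p + \<bar>b\<bar> powr p)"
proof -
  have "\<bar>a + b\<bar> powr p \<le> (2 * max \<bar>a\<bar> \<bar>b\<bar>) powr p"
    by (rule powr_mono2) (use assms in auto)
  also have "\<dots> = 2 powr p * max \<bar>a\<bar> \<bar>b\<bar> powr p" by (simp add: powr_mult)
  also have "\<dots> \<le> 2 powr p * (\<bar>a\<bar> powr p + \<bar>b\<bar> powr p)"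
    by (auto simp: max_def)
  finally show ?thesis .
qed

lemma pint_nonneg [simp]: "pint M p f \<ge> 0"
  by (simp add: integral_nonneg_AE)

lemma Lmem_measurable [measurable_dest]: "Lmem M p f \<Longrightarrow> f \<in> borel_measurable M"
  by (simp add: Lmem_def)

lemma Lmem_dominated:
  assumes "g \<in> borel_measurable M" "integrable M f" "AE x in M. \<bar>g x\<bar> powr p \<le> f x"
  shows "Lmem M p g"
  unfolding Lmem_def
proof (intro conjI assms(1))
  have [measurable]: "g \<in> borel_measurable M" by fact
  show "integrable M (\<lambda>x. \<bar>g x\<bar> powr p)"
    by (rule Bochner_Integration.integrable_bound[OF assms(2)])
      (use assms(3) in \<open>auto\<close>)
qed

lemma Lmem_add: "Lmem M p f \<Longrightarrow> Lmem M p g \<Longrightarrow> 0 \<le> p \<Longrightarrow> Lmem M p (\<lambda>x. f x + g x)"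
  by (rule Lmem_dominated[where f = "\<lambda>x. 2 powr p * (\<bar>f x\<bar> powr p + \<bar>g x\<bar> powr p)"])
     (auto simp: Lmem_def intro: powr_abs_add_le)

lemma Lmem_mult_bounded:
  assumes "Lmem M p f" "b \<in> borel_measurable M" "AE x in M. \<bar>b x\<bar> \<le> B" "0 \<le> p"
  shows "Lmem M p (\<lambda>x. b x * f x)"
  by (rule Lmem_dominated[where f = "\<lambda>x. B powr p * \<bar>f x\<bar> powr p"])
     (use assms in \<open>auto simp: Lmem_def abs_mult powr_mult intro!: mult_right_mono powr_mono2 elim!: AE_mp\<close>)

lemma Lmem_cmult: "Lmem M p f \<Longrightarrow> 0 \<le> p \<Longrightarrow> Lmem M p (\<lambda>x. c * f x)"
  by (rule Lmem_mult_bounded[where B = "\<bar>c\<bar>"]) auto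

lemma Lmem_diff: "Lmem M p f \<Longrightarrow> Lmem M p g \<Longrightarrow> 0 \<le> p \<Longrightarrow> Lmem M p (\<lambda>x. f x - g x)"
  using Lmem_add[OF _ Lmem_cmult, of M p f g "-1"] by simp

lemma Lmem_bounded:
  assumes "finite_measure M" "f \<in> borel_measurable M" "AE x in M. \<bar>f x\<bar> \<le> B" "0 \<le> p"
  shows "Lmem M p f"
  by (rule Lmem_dominated[where f = "\<lambda>x. B powr p"])
     (use assms in \<open>auto simp: finite_measure.integrable_const intro!: powr_mono2 elim!: AE_mp\<close>)

lemma Lmem_integrable:
  assumes "finite_measure M" "Lmem M p f" "1 \<le> p"
  shows "integrable M f"
proof (rule Bochner_Integration.integrable_bound[where f = "\<lambda>x. 1 + \<bar>f x\<bar> powr p"])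
  show "integrable M (\<lambda>x. 1 + \<bar>f x\<bar> powr p)"
    using assms by (simp add: Lmem_def finite_measure.integrable_const)
  have "\<bar>t\<bar> \<le> 1 + \<bar>t\<bar> powr p" for t :: real
  proof (cases "\<bar>t\<bar> \<le> 1")
    case False
    then have "\<bar>t\<bar> powr 1 \<le> \<bar>t\<bar> powr p" using assms(3) by (intro powr_mono) auto
    then show ?thesis using False by simp
  next
    case True
    then show ?thesis using powr_ge_zero[of "\<bar>t\<bar>" p] by linarith
  qed
  then show "AE x in M. norm (f x) \<le> norm (1 + \<bar>f x\<bar> powr p)"
    by (smt (verit) AE_I2 powr_ge_zero real_norm_def)
qed (use assms in \<open>simp add: Lmem_def\<close>)

lemma pint_add_le:
  assumes "Lmem M p f" "Lmem M p g" "0 \<le> p"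
  shows "pint M p (\<lambda>x. f x + g x) \<le> 2 powr p * (pint M p f + pint M p g)"
proof -
  have "pint M p (\<lambda>x. f x + g x) \<le> (\<integral>x. 2 powr p * (\<bar>f x\<bar> powr p + \<bar>g x\<bar> powr p) \<partial>M)"
    using assms Lmem_add[OF assms] by (intro integral_mono) (auto simp: Lmem_def intro: powr_abs_add_le)
  also have "\<dots> = 2 powr p * (pint M p f + pint M p g)"
    using assms by (simp add: Lmem_def)
  finally show ?thesis .
qed

lemma pint_mult_bounded_le:
  assumes "Lmem M p f" "b \<in> borel_measurable M" "AE x in M. \<bar>b x\<bar> \<le> B" "0 \<le> p"
  shows "pint M p (\<lambda>x. b x * f x) \<le> B powr p * pint M p f"
proof -
  have "pint M p (\<lambda>x. b x * f x) \<le> (\<integral>x. B powr p * \<bar>f x\<bar> powr p \<partial>M)"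
    using assms Lmem_mult_bounded[OF assms]
    by (intro integral_mono_AE)
      (auto simp: Lmem_def abs_mult powr_mult intro!: mult_right_mono powr_mono2 elim!: AE_mp)
  then show ?thesis by simp
qed

lemma pint_cmult: "pint M p (\<lambda>x. c * f x) = \<bar>c\<bar> powr p * pint M p f"
  by (simp add: abs_mult powr_mult)

lemma pint_uminus: "pint M p (\<lambda>x. f x - g x) = pint M p (\<lambda>x. g x - f x)"
  by (simp add: abs_minus_commute)

lemma pint_diff_triangle:
  assumes "Lmem M p f" "Lmem M p g" "Lmem M p h" "0 \<le> p"
  shows "pint M p (\<lambda>x. f x - h x) \<le> 2 powr p * (pint M p (\<lambda>x. f x - g x) + pint M p (\<lambda>x. g x - h x))"
  using pint_add_le[OF Lmem_diff[OF assms(1,2,4)] Lmem_diff[OF assms(2,3,4)] assms(4)] by simp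

lemma Lconv_squeeze:
  assumes "\<And>n. pint M p (\<lambda>x. f n x - g x) \<le> e n" "e \<longlonglongrightarrow> 0"
  shows "Lconv M p f g"
  unfolding Lconv_def by (rule tendsto_sandwich[OF _ _ tendsto_const assms(2)]) (use assms in auto)

lemma Lconv_const: "0 < p \<Longrightarrow> Lconv M p (\<lambda>_. f) f"
  by (simp add: Lconv_def)

lemma Lconv_add:
  assumes "Lconv M p f g" "Lconv M p f' g'" "\<And>n. Lmem M p (f n)" "\<And>n. Lmem M p (f' n)"
    "Lmem M p g" "Lmem M p g'" "0 \<le> p"
  shows "Lconv M p (\<lambda>n x. f n x + f' n x) (\<lambda>x. g x + g' x)"
proof (rule Lconv_squeeze)
  show "(\<lambda>n. 2 powr p * (pint M p (\<lambda>x. f n x - g x) + pint M p (\<lambda>x. f' n x - g' x))) \<longlonglongrightarrow> 0"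
    using tendsto_mult_right_zero[OF tendsto_add_zero] assms(1,2) unfolding Lconv_def by blast
  show "pint M p (\<lambda>x. f n x + f' n x - (g x + g' x))
      \<le> 2 powr p * (pint M p (\<lambda>x. f n x - g x) + pint M p (\<lambda>x. f' n x - g' x))" for n
    using pint_add_le[OF Lmem_diff[OF assms(3,5,7)] Lmem_diff[OF assms(4,6,7)] assms(7)]
    by (simp add: algebra_simps)
qed

lemma Lconv_cmult: "Lconv M p f g \<Longrightarrow> Lconv M p (\<lambda>n x. c * f n x) (\<lambda>x. c * g x)"
  unfolding Lconv_def right_diff_distrib[symmetric] pint_cmult by (rule tendsto_mult_right_zero)

lemma Lconv_subseq: "Lconv M p f g \<Longrightarrow> strict_mono r \<Longrightarrow> Lconv M p (\<lambda>n. f (r n)) g"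
  unfolding Lconv_def
  by (drule LIMSEQ_subseq_LIMSEQ) (simp_all add: comp_def)

lemma Lconv_AE_subseq:
  assumes "\<And>n. Lmem M p (f n)" "Lmem M p g" "0 < p" "Lconv M p f g"
  shows "\<exists>r. strict_mono r \<and> (AE x in M. (\<lambda>n. f (r n) x) \<longlonglongrightarrow> g x)"
proof -
  let ?u = "\<lambda>n x. \<bar>f n x - g x\<bar> powr p"
  have "integrable M (?u n)" for n
    using Lmem_diff[OF assms(1,2)] assms(3) by (simp add: Lmem_def)
  then obtain r where r: "strict_mono r" "AE x in M. (\<lambda>n. ?u (r n) x) \<longlonglongrightarrow> 0"
    using tendsto_L1_AE_subseq[of M ?u] assms(4) by (auto simp: Lconv_def)
  have "(\<lambda>n. f (r n) x) \<longlonglongrightarrow> g x" if "(\<lambda>n. ?u (r n) x) \<longlonglongrightarrow> 0" for x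
  proof -
    have "(\<lambda>n. (?u (r n) x) powr (1/p)) \<longlonglongrightarrow> 0 powr (1/p)"
      by (rule tendsto_powr'[OF that tendsto_const]) (use assms(3) in auto)
    then have "(\<lambda>n. \<bar>f (r n) x - g x\<bar>) \<longlonglongrightarrow> 0"
      using assms(3) by (simp add: powr_powr)
    then show ?thesis using LIM_zero_cancel tendsto_rabs_zero_iff by blast
  qed
  then show ?thesis using r by (auto elim!: AE_mp)
qed

lemma Lconv_dominated:
  assumes "\<And>n. f n \<in> borel_measurable M" "g \<in> borel_measurable M" "integrable M w"
    "\<And>n. AE x in M. \<bar>f n x - g x\<bar> powr p \<le> w x" "AE x in M. (\<lambda>n. f n x) \<longlonglongrightarrow> g x" "0 < p"
  shows "Lconv M p f g"
proof -
  have [measurable]: "f n \<in> borel_measurable M" "g \<in> borel_measurable M" for n using assms by auto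
  have "(\<lambda>n. pint M p (\<lambda>x. f n x - g x)) \<longlonglongrightarrow> (\<integral>x. 0 \<partial>M)"
  proof (rule integral_dominated_convergence[where w = w])
    have "(\<lambda>n. \<bar>f n x - g x\<bar> powr p) \<longlonglongrightarrow> 0" if "(\<lambda>n. f n x) \<longlonglongrightarrow> g x" for x
    proof -
      have "(\<lambda>n. \<bar>f n x - g x\<bar> powr p) \<longlonglongrightarrow> 0 powr p"
        by (rule tendsto_powr'[OF _ tendsto_const])
          (use assms(6) LIM_zero[OF that] in \<open>auto intro: tendsto_rabs_zero\<close>)
      then show ?thesis by simp
    qed
    then show "AE x in M. (\<lambda>n. \<bar>f n x - g x\<bar> powr p) \<longlonglongrightarrow> 0"
      using assms(5) by (auto elim!: AE_mp)
  qed (use assms in auto)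
  then show ?thesis by (simp add: Lconv_def)
qed

lemma Lconv_bounded:
  assumes "finite_measure M" "\<And>n. f n \<in> borel_measurable M" "g \<in> borel_measurable M"
    "\<And>n. AE x in M. \<bar>f n x\<bar> \<le> B" "AE x in M. \<bar>g x\<bar> \<le> B" "AE x in M. (\<lambda>n. f n x) \<longlonglongrightarrow> g x" "0 < p"
  shows "Lconv M p f g"
proof (rule Lconv_dominated[where w = "\<lambda>_. (2 * B) powr p"])
  fix n
  show "AE x in M. \<bar>f n x - g x\<bar> powr p \<le> (2 * B) powr p"
    using assms(4)[of n] assms(5)
    by eventually_elim (use assms(7) in \<open>auto intro!: powr_mono2\<close>)
qed (use assms in \<open>auto simp: finite_measure.integrable_const\<close>)

text \<open>The difference splits into \<open>b n * (f n - g)\<close>, small by the uniform bound,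
  and \<open>(b n - b') * g\<close>, small by dominated convergence. Convergence a.e. of the bounded
  factor is therefore enough.\<close>

lemma Lconv_mult_bounded:
  assumes "\<And>n. b n \<in> borel_measurable M" "b' \<in> borel_measurable M"
    "\<And>n. AE x in M. \<bar>b n x\<bar> \<le> B" "AE x in M. (\<lambda>n. b n x) \<longlonglongrightarrow> b' x"
    "\<And>n. Lmem M p (f n)" "Lmem M p g" "0 < p" "Lconv M p f g"
  shows "Lconv M p (\<lambda>n x. b n x * f n x) (\<lambda>x. b' x * g x)"
proof -
  have [measurable]: "b n \<in> borel_measurable M" "b' \<in> borel_measurable M" "g \<in> borel_measurable M" for n
    using assms by (auto simp: Lmem_def)
  have "AE x in M. \<forall>n. \<bar>b n x\<bar> \<le> B" using assms(3) by (simp add: AE_all_countable)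
  then have b': "AE x in M. \<bar>b' x\<bar> \<le> B"
    using assms(4) by eventually_elim (metis LIMSEQ_le_const2 tendsto_rabs)
  have 2: "Lconv M p (\<lambda>n x. b n x * g x) (\<lambda>x. b' x * g x)"
  proof (rule Lconv_dominated[where w = "\<lambda>x. (2 * B) powr p * \<bar>g x\<bar> powr p"])
    fix n
    show "AE x in M. \<bar>b n x * g x - b' x * g x\<bar> powr p \<le> (2 * B) powr p * \<bar>g x\<bar> powr p"
      using assms(3)[of n] b'
    proof eventually_elim
      case (elim x)
      have "\<bar>b n x * g x - b' x * g x\<bar> = \<bar>b n x - b' x\<bar> * \<bar>g x\<bar>"
        by (simp add: left_diff_distrib[symmetric] abs_mult)
      moreover have "\<bar>b n x - b' x\<bar> powr p \<le> (2 * B) powr p"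
        using elim assms(7) by (intro powr_mono2) auto
      ultimately show ?case by (simp add: powr_mult mult_right_mono)
    qed
    show "AE x in M. (\<lambda>n. b n x * g x) \<longlonglongrightarrow> b' x * g x"
      using assms(4) by eventually_elim (intro tendsto_intros)
  qed (use assms(6,7) in \<open>auto simp: Lmem_def\<close>)
  show ?thesis
  proof (rule Lconv_squeeze)
    fix n
    have "pint M p (\<lambda>x. b n x * f n x - b' x * g x)
      \<le> 2 powr p * (pint M p (\<lambda>x. b n x * f n x - b n x * g x) + pint M p (\<lambda>x. b n x * g x - b' x * g x))"
      by (rule pint_diff_triangle)
        (use assms(7) in \<open>auto intro!: Lmem_mult_bounded[OF assms(5) assms(1) assms(3)]
          Lmem_mult_bounded[OF assms(6) assms(1) assms(3)] Lmem_mult_bounded[OF assms(6) assms(2) b']\<close>)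
    also have "pint M p (\<lambda>x. b n x * f n x - b n x * g x) \<le> B powr p * pint M p (\<lambda>x. f n x - g x)"
      unfolding right_diff_distrib[symmetric]
      by (rule pint_mult_bounded_le[OF Lmem_diff[OF assms(5,6)] assms(1,3)]) (use assms(7) in auto)
    finally show "pint M p (\<lambda>x. b n x * f n x - b' x * g x) \<le> 2 powr p *
      (B powr p * pint M p (\<lambda>x. f n x - g x) + pint M p (\<lambda>x. b n x * g x - b' x * g x))"
      by (simp add: mult_left_mono)
  next
    show "(\<lambda>n. 2 powr p * (B powr p * pint M p (\<lambda>x. f n x - g x)
        + pint M p (\<lambda>x. b n x * g x - b' x * g x))) \<longlonglongrightarrow> 0"
      using assms(8) 2 unfolding Lconv_def
      by (intro tendsto_mult_right_zero tendsto_add_zero)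
  qed
qed

lemma Lconv_pint_le:
  assumes "Lconv M p f g" "\<And>n. Lmem M p (f n)" "Lmem M p g" "0 \<le> p" "e > 0"
  shows "\<forall>\<^sub>F n in sequentially. pint M p (f n) \<le> 2 powr p * pint M p g + e"
proof -
  have "(\<lambda>n. 2 powr p * (pint M p (\<lambda>x. f n x - g x) + pint M p g)) \<longlonglongrightarrow> 2 powr p * (0 + pint M p g)"
    using assms(1) unfolding Lconv_def by (intro tendsto_intros)
  then have "\<forall>\<^sub>F n in sequentially. 2 powr p * (pint M p (\<lambda>x. f n x - g x) + pint M p g) < 2 powr p * pint M p g + e"
    by (rule order_tendstoD) (use assms(5) in auto)
  then show ?thesis
  proof eventually_elim
    case (elim n)
    then show ?case
      using pint_add_le[OF Lmem_diff[OF assms(2)[of n] assms(3,4)] assms(3,4)] by simp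
  qed
qed

text \<open>Takes the place of Hoelder's inequality on a finite measure space: beyond the threshold
  \<open>d\<close>, the factor \<open>t powr (1 - p)\<close> is at most
  \<open>d powr (1 - p)\<close>. The free choice of \<open>d\<close> makes the first term
  small.\<close>

lemma le_add_powr:
  assumes "0 < d" "0 \<le> t" "1 \<le> (p::real)"
  shows "t \<le> d + d powr (1 - p) * t powr p"
proof (cases "t \<le> d")
  case True
  then show ?thesis by (smt (verit) mult_nonneg_nonneg powr_ge_zero)
next
  case False
  then have "t = t powr (1 - p) * t powr p" using assms by (simp flip: powr_add)
  also have "\<dots> \<le> d powr (1 - p) * t powr p"
    using False assms by (intro mult_right_mono powr_mono2') auto
  finally show ?thesis using assms by linarith
qed

text \<open>Riesz-Fischer: a fast subsequence has differences summable in L1, hence converges a.e.,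
  and Fatou's lemma shows that its limit is the limit of the whole sequence.\<close>

lemma Lp_complete:
  assumes fin: "finite_measure M" and p: "1 \<le> p" and f: "\<And>n. Lmem M p (f n)"
    and cauchy: "\<And>e. e > 0 \<Longrightarrow> \<exists>N. \<forall>m\<ge>N. \<forall>n\<ge>N. pint M p (\<lambda>x. f m x - f n x) < e"
  shows "\<exists>g. Lmem M p g \<and> Lconv M p f g"
proof -
  interpret finite_measure M by fact
  have [measurable]: "f n \<in> borel_measurable M" for n using f by (simp add: Lmem_def)
  \<comment> \<open>The threshold is matched to \<open>le_add_powr\<close> with d = (1/2)^k: since
    \<open>d powr (1 - p) * d powr p = d\<close>, the L1 norm of a difference is at most (1/2)^k
    times (total measure + 1).\<close>
  have "\<exists>N. \<forall>m\<ge>N. \<forall>n\<ge>N. pint M p (\<lambda>x. f m x - f n x) < ((1/2)^k) powr p" for k :: nat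
    by (rule cauchy) simp
  then obtain N where N: "\<And>k m n. m \<ge> N k \<Longrightarrow> n \<ge> N k \<Longrightarrow> pint M p (\<lambda>x. f m x - f n x) < ((1/2)^k) powr p"
    by metis
  \<comment> \<open>Summing the \<open>N j\<close> makes \<open>r\<close> nondecreasing while
    \<open>r k\<close> stays above both \<open>N k\<close> and \<open>k\<close>.\<close>
  define r where "r k = (\<Sum>j\<le>k. N j) + k" for k
  have rN: "r k \<ge> N k" "r k \<ge> k" for k
    using member_le_sum[of k "{..k}" N] by (auto simp: r_def)
  have rS: "r (Suc k) \<ge> r k" for k by (simp add: r_def)
  let ?D = "\<lambda>k x. f (r (Suc k)) x - f (r k) x"
  have D: "Lmem M p (?D k)" for k using f p by (intro Lmem_diff) auto
  have bound: "(\<integral>\<^sup>+x. ennreal \<bar>?D k x\<bar> \<partial>M) \<le> ennreal ((measure M (space M) + 1) * (1/2)^k)" for k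
  proof -
    let ?d = "(1/2::real)^k"
    have int: "integrable M (\<lambda>x. ?d + ?d powr (1 - p) * \<bar>?D k x\<bar> powr p)"
      using D[of k] by (simp add: Lmem_def)
    have "(\<integral>\<^sup>+x. ennreal \<bar>?D k x\<bar> \<partial>M) \<le> (\<integral>\<^sup>+x. ennreal (?d + ?d powr (1 - p) * \<bar>?D k x\<bar> powr p) \<partial>M)"
      using p by (intro nn_integral_mono ennreal_leI le_add_powr) auto
    also have "\<dots> = ennreal (\<integral>x. ?d + ?d powr (1 - p) * \<bar>?D k x\<bar> powr p \<partial>M)"
      by (intro nn_integral_eq_integral int) auto
    also have "(\<integral>x. ?d + ?d powr (1 - p) * \<bar>?D k x\<bar> powr p \<partial>M)
        = ?d * measure M (space M) + ?d powr (1 - p) * pint M p (?D k)"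
      using D[of k] by (simp add: Lmem_def)
    also have "\<dots> \<le> ?d * measure M (space M) + ?d powr (1 - p) * ?d powr p"
      using N[of k "r (Suc k)" "r k"] rN(1)[of k] rS[of k]
      by (intro add_left_mono mult_left_mono) auto
    also have "?d powr (1 - p) * ?d powr p = ?d" by (simp flip: powr_add)
    finally show ?thesis by (simp add: algebra_simps ennreal_leI)
  qed
  have "(\<integral>\<^sup>+x. (\<Sum>k. ennreal \<bar>?D k x\<bar>) \<partial>M) = (\<Sum>k. \<integral>\<^sup>+x. ennreal \<bar>?D k x\<bar> \<partial>M)"
    by (rule nn_integral_suminf) measurable
  also have "\<dots> \<le> (\<Sum>k. ennreal ((measure M (space M) + 1) * (1/2)^k))"
    by (intro suminf_le bound) auto
  also have "\<dots> = ennreal (\<Sum>k. (measure M (space M) + 1) * (1/2)^k)"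
    by (intro suminf_ennreal2 summable_mult summable_geometric) auto
  also have "\<dots> < \<infinity>" by simp
  finally have "AE x in M. (\<Sum>k. ennreal \<bar>?D k x\<bar>) \<noteq> \<infinity>"
    by (intro nn_integral_noteq_infinite) auto
  then have conv: "AE x in M. convergent (\<lambda>k. f (r k) x)"
  proof eventually_elim
    case (elim x)
    then have "summable (\<lambda>k. \<bar>?D k x\<bar>)" by (intro summable_suminf_not_top) auto
    then have "summable (\<lambda>k. ?D k x)" by (rule summable_rabs_cancel)
    then have "convergent (\<lambda>n. \<Sum>k<n. ?D k x)" by (simp add: summable_iff_convergent)
    then have "convergent (\<lambda>n. f (r n) x - f (r 0) x)"
      by (simp add: sum_lessThan_telescope[of "\<lambda>k. f (r k) x"])
    then show ?case using convergent_diff_const_right_iff by blast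
  qed
  define g where "g x = lim (\<lambda>k. f (r k) x)" for x
  have [measurable]: "g \<in> borel_measurable M" unfolding g_def by measurable
  have lim: "AE x in M. (\<lambda>k. f (r k) x) \<longlonglongrightarrow> g x"
    using conv by eventually_elim (simp add: g_def convergent_LIMSEQ_iff)
  have fatou: "Lmem M p (\<lambda>x. f n x - g x) \<and> pint M p (\<lambda>x. f n x - g x) \<le> e"
    if e: "e > 0" and K: "\<And>k. k \<ge> K \<Longrightarrow> pint M p (\<lambda>x. f n x - f (r k) x) \<le> e" for n e K
  proof -
    have "(\<integral>\<^sup>+x. ennreal (\<bar>f n x - g x\<bar> powr p) \<partial>M)
        = (\<integral>\<^sup>+x. liminf (\<lambda>k. ennreal (\<bar>f n x - f (r k) x\<bar> powr p)) \<partial>M)"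
    proof (rule nn_integral_cong_AE)
      show "AE x in M. ennreal (\<bar>f n x - g x\<bar> powr p) = liminf (\<lambda>k. ennreal (\<bar>f n x - f (r k) x\<bar> powr p))"
        using lim
      proof eventually_elim
        case (elim x)
        have "(\<lambda>k. \<bar>f n x - f (r k) x\<bar> powr p) \<longlonglongrightarrow> \<bar>f n x - g x\<bar> powr p"
          by (intro tendsto_powr' tendsto_intros elim) (use p in auto)
        then have "(\<lambda>k. ennreal (\<bar>f n x - f (r k) x\<bar> powr p)) \<longlonglongrightarrow> ennreal (\<bar>f n x - g x\<bar> powr p)"
          by (rule tendsto_ennrealI)
        then show ?case using lim_imp_Liminf trivial_limit_sequentially by metis
      qed
    qed
    also have "\<dots> \<le> liminf (\<lambda>k. \<integral>\<^sup>+x. ennreal (\<bar>f n x - f (r k) x\<bar> powr p) \<partial>M)"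
      by (rule nn_integral_liminf) measurable
    also have "\<dots> \<le> liminf (\<lambda>k::nat. ennreal e)"
    proof (rule Liminf_mono, rule eventually_sequentiallyI[of K])
      fix k assume "k \<ge> K"
      have "Lmem M p (\<lambda>x. f n x - f (r k) x)" using f p by (intro Lmem_diff) auto
      then have "(\<integral>\<^sup>+x. ennreal (\<bar>f n x - f (r k) x\<bar> powr p) \<partial>M) = ennreal (pint M p (\<lambda>x. f n x - f (r k) x))"
        by (intro nn_integral_eq_integral) (auto simp: Lmem_def)
      then show "(\<integral>\<^sup>+x. ennreal (\<bar>f n x - f (r k) x\<bar> powr p) \<partial>M) \<le> ennreal e"
        using K[OF \<open>k \<ge> K\<close>] by (simp add: ennreal_leI)
    qed
    also have "\<dots> = ennreal e" by (simp add: Liminf_const)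
    finally have le: "(\<integral>\<^sup>+x. ennreal (\<bar>f n x - g x\<bar> powr p) \<partial>M) \<le> ennreal e" .
    then have int: "integrable M (\<lambda>x. \<bar>f n x - g x\<bar> powr p)"
      by (intro integrableI_nonneg) (auto simp: less_top[symmetric] top_unique)
    have "ennreal (pint M p (\<lambda>x. f n x - g x)) \<le> ennreal e"
      using le nn_integral_eq_integral[OF int] by simp
    then show ?thesis using int e by (simp add: Lmem_def)
  qed
  have ev: "\<exists>N. \<forall>n\<ge>N. Lmem M p (\<lambda>x. f n x - g x) \<and> pint M p (\<lambda>x. f n x - g x) \<le> e" if e: "e > 0" for e
  proof -
    obtain N where N: "\<forall>m\<ge>N. \<forall>n\<ge>N. pint M p (\<lambda>x. f m x - f n x) < e" using cauchy[OF e] by blast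
    have "Lmem M p (\<lambda>x. f n x - g x) \<and> pint M p (\<lambda>x. f n x - g x) \<le> e" if "n \<ge> N" for n
      by (rule fatou[OF e, of N]) (use N that rN(2) in \<open>meson le_trans less_imp_le\<close>)
    then show ?thesis by blast
  qed
  obtain n where "Lmem M p (\<lambda>x. f n x - g x)" using ev[of 1] by auto
  then have "Lmem M p g" using Lmem_diff[OF f[of n], of "\<lambda>x. f n x - g x"] p by simp
  moreover have "Lconv M p f g"
    unfolding Lconv_def LIMSEQ_def
  proof (intro allI impI)
    fix e :: real assume "e > 0"
    then obtain N where "\<forall>n\<ge>N. pint M p (\<lambda>x. f n x - g x) \<le> e/2" using ev[of "e/2"] by auto
    then show "\<exists>no. \<forall>n\<ge>no. dist (pint M p (\<lambda>x. f n x - g x)) 0 < e"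
      using \<open>e > 0\<close> by (intro exI[of _ N]) (auto simp: abs_of_nonneg)
  qed
  ultimately show ?thesis by blast
qed

section \<open>Convexity of p-th powers\<close>

lemma powr_Bernoulli_strict:
  assumes "p > 1" "x > (1::real)"
  shows "x powr p > 1 + p * (x - 1)"
proof -
  have "\<exists>z. 1 < z \<and> z < x \<and> x powr p - 1 powr p = (x - 1) * (p * z powr (p - 1))"
    by (rule MVT2[OF assms(2)]) (auto intro!: derivative_eq_intros)
  then obtain z where z: "1 < z" "x powr p - 1 = (x - 1) * (p * z powr (p - 1))" by auto
  have "z powr (p - 1) > 1" using z(1) assms(1) by (intro gr_one_powr) auto
  then have "(x - 1) * p * z powr (p - 1) > (x - 1) * p * 1"
    using assms by (intro mult_strict_left_mono) auto
  then show ?thesis using z(2) by (simp add: algebra_simps)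
qed

lemma powr_Bernoulli:
  assumes "p > 1" "x \<ge> (0::real)"
  shows "x powr p \<ge> 1 + p * (x - 1)"
proof -
  consider "x > 1" | "x = 1" | "x = 0" | "0 < x" "x < 1" using assms by linarith
  then show ?thesis
  proof cases
    case 1 then show ?thesis using powr_Bernoulli_strict[OF assms(1) 1] by simp
  next
    case 4
    have "\<exists>z. x < z \<and> z < 1 \<and> 1 powr p - x powr p = (1 - x) * (p * z powr (p - 1))"
      by (rule MVT2[OF 4(2)]) (use 4 in \<open>auto intro!: derivative_eq_intros\<close>)
    then obtain z where z: "x < z" "z < 1" "1 - x powr p = (1 - x) * (p * z powr (p - 1))" by auto
    have "z powr (p - 1) \<le> 1" using z 4 assms(1) by (intro powr_le1) auto
    then have "((1 - x) * p) * z powr (p - 1) \<le> ((1 - x) * p) * 1"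
      using assms 4 by (intro mult_left_mono) auto
    then show ?thesis using z(3) by (simp add: algebra_simps)
  qed (use assms in auto)
qed

text \<open>After division by the midpoint \<open>c\<close>, the numbers \<open>x\<close> and
  \<open>y\<close> have mean at least 1, and the tangent line of the power at 1 bounds both powers
  from below, strictly at \<open>x > 1\<close>.\<close>

lemma powr_midpoint_strict:
  assumes "p > 1" "-1 \<le> b" "b < (1::real)"
  shows "\<bar>(1 + b) / 2\<bar> powr p < (1 + \<bar>b\<bar> powr p) / 2"
proof -
  define c where "c = (1 + b) / 2"
  have c: "0 \<le> c" "c < 1" "b = 2 * c - 1" using assms by (auto simp: c_def field_simps)
  show ?thesis
  proof (cases "c = 0")
    case True
    then have "b = -1" using c(3) by simp
    then show ?thesis by simp
  next
    case False
    then have c0: "c > 0" using c(1) by simp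
    define x y where "x = 1 / c" and "y = \<bar>b\<bar> / c"
    have x: "x > 1" using c0 c by (simp add: x_def)
    have "y \<ge> b / c" unfolding y_def using c0 by (intro divide_right_mono) auto
    also have "b / c = 2 - x" using c0 c(3) by (simp add: x_def diff_divide_distrib)
    finally have y: "y \<ge> 2 - x" "y \<ge> 0" using c0 by (auto simp: y_def)
    have "y powr p \<ge> 1 + p * (y - 1)" by (rule powr_Bernoulli[OF assms(1) y(2)])
    moreover have "p * (y - 1) \<ge> p * (1 - x)" using y assms by (intro mult_left_mono) auto
    moreover have "x powr p > 1 + p * (x - 1)" by (rule powr_Bernoulli_strict[OF assms(1) x])
    ultimately have "x powr p + y powr p > 2" by (simp add: algebra_simps)
    then have "c powr p * (x powr p + y powr p) > c powr p * 2"
      using c0 by (intro mult_strict_left_mono) auto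
    moreover have "c powr p * x powr p = 1" "c powr p * y powr p = \<bar>b\<bar> powr p"
      using c0 by (auto simp: x_def y_def powr_divide)
    ultimately show ?thesis using c0 by (simp add: distrib_left c_def[symmetric])
  qed
qed

text \<open>A form of uniform convexity of the \<open>p\<close>-th power that is valid for all \<open>p > 1\<close> at once;
  by homogeneity and compactness it reduces to strict convexity.\<close>

lemma powr_uniformly_convex:
  assumes p: "p > 1" and e: "e > 0"
  shows "\<exists>C\<ge>0. \<forall>a b::real. \<bar>a - b\<bar> powr p \<le> e * (\<bar>a\<bar> powr p + \<bar>b\<bar> powr p)
           + C * ((\<bar>a\<bar> powr p + \<bar>b\<bar> powr p) / 2 - \<bar>(a + b) / 2\<bar> powr p)"
proof -
  define D where "D b = (1 + \<bar>b\<bar> powr p) / 2 - \<bar>(1 + b) / 2\<bar> powr p" for b :: real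
  \<comment> \<open>\<open>S\<close> collects the \<open>b\<close> for which the term with
    \<open>e\<close> is not sufficient by itself. It is compact and avoids 1, the only point of
    [-1,1] where \<open>D\<close> vanishes, so \<open>D\<close> has a positive lower bound
    \<open>d\<close> on it; \<open>2 powr p\<close> bounds the left-hand side.\<close>
  define S where "S = {-1..1} \<inter> {b::real. e * (1 + \<bar>b\<bar> powr p) \<le> \<bar>1 - b\<bar> powr p}"
  have contp: "continuous_on UNIV (\<lambda>b. \<bar>g b\<bar> powr p)" if "continuous_on UNIV g" for g :: "real \<Rightarrow> real"
    using that p by (intro continuous_on_powr' continuous_intros) auto
  have "closed {b::real. e * (1 + \<bar>b\<bar> powr p) \<le> \<bar>1 - b\<bar> powr p}"
    by (intro closed_Collect_le continuous_intros contp)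
  then have S: "compact S" unfolding S_def by (intro compact_Int_closed) auto
  have "continuous_on UNIV (\<lambda>b::real. \<bar>b\<bar> powr p)" "continuous_on UNIV (\<lambda>b::real. \<bar>(1 + b) / 2\<bar> powr p)"
    by (intro contp continuous_intros; simp)+
  then have "continuous_on UNIV D"
    unfolding D_def by (intro continuous_on_diff continuous_on_divide continuous_on_add continuous_on_const) auto
  then have contD: "continuous_on S D" by (rule continuous_on_subset) simp
  have Dnn: "D b \<ge> 0" if "-1 \<le> b" "b \<le> 1" for b
    using powr_midpoint_strict[OF p, of b] that by (cases "b = 1") (auto simp: D_def)
  have Dpos: "D b > 0" if "b \<in> S" for b
  proof -
    have "b \<noteq> 1"
      using that e by (auto simp: S_def)
    then show ?thesis using powr_midpoint_strict[OF p, of b] that by (auto simp: D_def S_def)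
  qed
  have "\<exists>d>0. \<forall>b\<in>S. d \<le> D b"
  proof (cases "S = {}")
    case False
    then obtain b0 where "b0 \<in> S" "\<forall>b\<in>S. D b0 \<le> D b"
      using continuous_attains_inf[OF S _ contD] by blast
    then show ?thesis using Dpos by blast
  qed (auto intro: exI[of _ 1])
  then obtain d where d: "d > 0" "\<And>b. b \<in> S \<Longrightarrow> d \<le> D b" by blast
  define C where "C = 2 powr p / d"
  have C: "C \<ge> 0" using d by (simp add: C_def)
  have unit: "\<bar>1 - b\<bar> powr p \<le> e * (1 + \<bar>b\<bar> powr p) + C * D b" if "-1 \<le> b" "b \<le> 1" for b
  proof (cases "b \<in> S")
    case True
    have "\<bar>1 - b\<bar> powr p \<le> 2 powr p" using that p by (intro powr_mono2) auto
    also have "\<dots> = C * d" using d by (simp add: C_def)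
    also have "\<dots> \<le> C * D b" using d(2)[OF True] C by (intro mult_left_mono) auto
    finally show ?thesis
      using e by (smt (verit) mult_nonneg_nonneg powr_ge_zero)
  next
    case False
    then show ?thesis using that Dnn[OF that] C by (auto simp: S_def add_increasing2)
  qed
  have main: "\<bar>a - b\<bar> powr p \<le> e * (\<bar>a\<bar> powr p + \<bar>b\<bar> powr p)
      + C * ((\<bar>a\<bar> powr p + \<bar>b\<bar> powr p) / 2 - \<bar>(a + b) / 2\<bar> powr p)" if ab: "\<bar>b\<bar> \<le> \<bar>a\<bar>" for a b :: real
  proof (cases "a = 0")
    case False
    define t where "t = b / a"
    have b: "b = a * t" using False by (simp add: t_def)
    have "\<bar>t\<bar> \<le> 1" using ab False by (simp add: t_def)
    then have t: "-1 \<le> t" "t \<le> 1" by auto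
    have "\<bar>a - b\<bar> = \<bar>a\<bar> * \<bar>1 - t\<bar>"
      unfolding b by (simp add: abs_mult[symmetric] algebra_simps)
    then have 1: "\<bar>a - b\<bar> powr p = \<bar>a\<bar> powr p * \<bar>1 - t\<bar> powr p" by (simp add: powr_mult)
    have 2: "\<bar>b\<bar> powr p = \<bar>a\<bar> powr p * \<bar>t\<bar> powr p" unfolding b by (simp add: abs_mult powr_mult)
    have "\<bar>(a + b) / 2\<bar> = \<bar>a\<bar> * \<bar>(1 + t) / 2\<bar>"
      unfolding b abs_mult[symmetric] by (simp add: algebra_simps)
    then have 3: "\<bar>(a + b) / 2\<bar> powr p = \<bar>a\<bar> powr p * \<bar>(1 + t) / 2\<bar> powr p"
      using powr_mult[of "\<bar>a\<bar>" "\<bar>(1 + t) / 2\<bar>" p] by simp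
    have "\<bar>a\<bar> powr p * \<bar>1 - t\<bar> powr p \<le> \<bar>a\<bar> powr p * (e * (1 + \<bar>t\<bar> powr p) + C * D t)"
      using unit[OF t] by (intro mult_left_mono) auto
    also have "\<dots> = e * (\<bar>a\<bar> powr p + \<bar>b\<bar> powr p)
      + C * ((\<bar>a\<bar> powr p + \<bar>b\<bar> powr p) / 2 - \<bar>(a + b) / 2\<bar> powr p)"
      unfolding 2 3 D_def by (simp add: field_simps)
    finally show ?thesis unfolding 1 .
  qed (use ab in simp)
  have "\<bar>a - b\<bar> powr p \<le> e * (\<bar>a\<bar> powr p + \<bar>b\<bar> powr p)
      + C * ((\<bar>a\<bar> powr p + \<bar>b\<bar> powr p) / 2 - \<bar>(a + b) / 2\<bar> powr p)" for a b :: real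
    using main[of a b] main[of b a] by (cases "\<bar>b\<bar> \<le> \<bar>a\<bar>") (auto simp: abs_minus_commute add.commute)
  then show ?thesis using C by blast
qed

subsection \<open>The anisotropic Sobolev space\<close>

text \<open>The outer functions that may be composed with elements of the space: the bounds on
  \<open>F\<close> and its derivative give every product below a bounded factor, whatever the
  exponents are.\<close>

definition bsmooth :: "(real \<Rightarrow> real) \<Rightarrow> bool" where
  "bsmooth F \<longleftrightarrow> smooth_fun F \<and> (\<exists>B. \<forall>t. \<bar>F t\<bar> \<le> B \<and> \<bar>deriv F t\<bar> \<le> B)"

lemma bsmooth_smooth: "bsmooth F \<Longrightarrow> smooth_fun F"
  by (simp add: bsmooth_def)

lemma bsmoothE:
  assumes "bsmooth F"
  obtains B where "B > 0" "\<And>t. \<bar>F t\<bar> \<le> B" "\<And>t. \<bar>deriv F t\<bar> \<le> B"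
proof -
  obtain B where "\<forall>t. \<bar>F t\<bar> \<le> B \<and> \<bar>deriv F t\<bar> \<le> B" using assms by (auto simp: bsmooth_def)
  then show ?thesis by (intro that[of "max B 1"]) (auto simp: le_max_iff_disj)
qed

lemma bsmooth_const: "bsmooth (\<lambda>t. c)"
  by (auto simp: bsmooth_def smooth_const intro: exI[of _ "\<bar>c\<bar>"])

lemma smooth_affine: "smooth_fun (\<lambda>t::real. a * t + b)"
  by (intro smooth_add smooth_cmult smooth_const smooth_ident)

lemma deriv_add_smooth:
  fixes F G :: "real \<Rightarrow> real"
  assumes "smooth_fun F" "smooth_fun G"
  shows "deriv (\<lambda>t. F t + G t) t = deriv F t + deriv G t"
  by (intro DERIV_imp_deriv DERIV_add assms[THEN smooth_has_real_derivative])

lemma deriv_mult_smooth: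
  fixes F G :: "real \<Rightarrow> real"
  assumes "smooth_fun F" "smooth_fun G"
  shows "deriv (\<lambda>t. F t * G t) t = deriv F t * G t + F t * deriv G t"
  using DERIV_mult[OF assms[THEN smooth_has_real_derivative], of t]
  by (intro DERIV_imp_deriv) (simp add: algebra_simps)

lemma deriv_affine_smooth:
  fixes F :: "real \<Rightarrow> real"
  assumes "smooth_fun F"
  shows "deriv (\<lambda>t. F (a * t + b)) t = a * deriv F (a * t + b)"
proof -
  have "((\<lambda>t. a * t + b) has_real_derivative a) (at t)" by (auto intro!: derivative_eq_intros)
  from DERIV_chain2[OF smooth_has_real_derivative[OF assms] this]
  show ?thesis by (intro DERIV_imp_deriv) (simp add: mult.commute)
qed

lemma bsmooth_add: assumes "bsmooth F" "bsmooth G" shows "bsmooth (\<lambda>t. F t + G t)"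
proof -
  obtain B C where "\<And>t. \<bar>F t\<bar> \<le> B" "\<And>t. \<bar>deriv F t\<bar> \<le> B" "\<And>t. \<bar>G t\<bar> \<le> C" "\<And>t. \<bar>deriv G t\<bar> \<le> C"
    using assms by (metis bsmoothE)
  then have "\<bar>F t + G t\<bar> \<le> B + C" "\<bar>deriv F t + deriv G t\<bar> \<le> B + C" for t
    by (meson abs_triangle_ineq add_mono order_trans)+
  then show ?thesis
    using assms[THEN bsmooth_smooth] by (auto simp: bsmooth_def deriv_add_smooth intro!: smooth_add)
qed

lemma bsmooth_mult: assumes "bsmooth F" "bsmooth G" shows "bsmooth (\<lambda>t. F t * G t)"
proof -
  obtain B C where B: "B > 0" "\<And>t. \<bar>F t\<bar> \<le> B" "\<And>t. \<bar>deriv F t\<bar> \<le> B"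
    and C: "C > 0" "\<And>t. \<bar>G t\<bar> \<le> C" "\<And>t. \<bar>deriv G t\<bar> \<le> C"
    using assms by (metis bsmoothE)
  have m: "\<bar>x * y\<bar> \<le> B * C" if "\<bar>x\<bar> \<le> B" "\<bar>y\<bar> \<le> C" for x y
    unfolding abs_mult using that B C by (intro mult_mono) auto
  have "\<bar>F t * G t\<bar> \<le> 2 * (B * C)" "\<bar>deriv F t * G t + F t * deriv G t\<bar> \<le> 2 * (B * C)" for t
    using m[of "F t" "G t"] m[of "deriv F t" "G t"] m[of "F t" "deriv G t"] B C abs_triangle_ineq[of "deriv F t * G t" "F t * deriv G t"]
    by (smt (verit) mult_pos_pos)+
  then show ?thesis
    using assms[THEN bsmooth_smooth] by (auto simp: bsmooth_def deriv_mult_smooth intro!: smooth_mult)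
qed

lemma bsmooth_affine: assumes "bsmooth F" shows "bsmooth (\<lambda>t. F (a * t + b))"
proof -
  obtain B where B: "B > 0" "\<And>t. \<bar>F t\<bar> \<le> B" "\<And>t. \<bar>deriv F t\<bar> \<le> B"
    using assms by (metis bsmoothE)
  have "\<bar>a * deriv F (a * t + b)\<bar> \<le> \<bar>a\<bar> * B" for t
    unfolding abs_mult by (intro mult_left_mono B) auto
  then have "\<bar>F (a * t + b)\<bar> \<le> max B (\<bar>a\<bar> * B) \<and> \<bar>a * deriv F (a * t + b)\<bar> \<le> max B (\<bar>a\<bar> * B)" for t
    using B(2)[of "a * t + b"] by (simp add: le_max_iff_disj)
  then show ?thesis
    unfolding bsmooth_def deriv_affine_smooth[OF bsmooth_smooth[OF assms]]
    using smooth_compose[OF bsmooth_smooth[OF assms] smooth_affine] by blast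
qed

lemma bsmooth_step: "bsmooth step"
proof -
  obtain B where "\<And>t. \<bar>deriv step t\<bar> \<le> B" using deriv_step_bounded by blast
  then have "\<bar>step t\<bar> \<le> max 1 B \<and> \<bar>deriv step t\<bar> \<le> max 1 B" for t
    using step_nonneg[of t] step_le_1[of t] by (auto simp: le_max_iff_disj abs_of_nonneg)
  then show ?thesis using smooth_step by (auto simp: bsmooth_def)
qed

lemma bsmooth_uminus: "bsmooth F \<Longrightarrow> bsmooth (\<lambda>t. - F t)"
  using bsmooth_mult[OF bsmooth_const[of "-1"]] by simp

lemma bsmooth_diff: "bsmooth F \<Longrightarrow> bsmooth G \<Longrightarrow> bsmooth (\<lambda>t. F t - G t)"
  using bsmooth_add[OF _ bsmooth_uminus] by fastforce

lemma deriv_zero_outside: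
  fixes F :: "real \<Rightarrow> real"
  assumes "smooth_fun F" "\<And>t. t < a \<or> t > b \<Longrightarrow> F t = c" "t < a \<or> t > b"
  shows "deriv F t = 0"
  using assms(3)
proof
  assume "t < a"
  then show ?thesis using smooth_deriv_zero_off[OF assms(1), of "{..<a}"] assms(2) by auto
next
  assume "t > b"
  then show ?thesis using smooth_deriv_zero_off[OF assms(1), of "{b<..}"] assms(2) by auto
qed

lemma bsmooth_compact_support:
  fixes F :: "real \<Rightarrow> real"
  assumes "smooth_fun F" "\<And>t. t < a \<or> t > b \<Longrightarrow> F t = 0"
  shows "bsmooth F"
proof -
  obtain B where B: "\<And>t. \<bar>F t\<bar> \<le> B"
    using bounded_if_zero_off_interval[OF smooth_continuous[OF assms(1)] assms(2)] by blast
  have "deriv F t = 0" if "t < a \<or> t > b" for t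
    by (rule deriv_zero_outside[OF assms(1) _ that, of 0]) (use assms(2) in auto)
  then obtain C where C: "\<And>t. \<bar>deriv F t\<bar> \<le> C"
    using bounded_if_zero_off_interval[OF smooth_continuous[OF smooth_deriv[OF assms(1)]], of a b] by blast
  have "\<bar>F t\<bar> \<le> max B C \<and> \<bar>deriv F t\<bar> \<le> max B C" for t
    using B[of t] C[of t] by (simp add: le_max_iff_disj)
  then show ?thesis using assms(1) by (auto simp: bsmooth_def)
qed

text \<open>The transition fills exactly the layer n \<le> |t| \<le> n + 1 of the energy condition,
  so that the derivative of \<open>cutoff n\<close> at \<open>u\<close> is seen only there.\<close>

definition cutoff :: "real \<Rightarrow> real \<Rightarrow> real" where
  "cutoff n t = (1 - step (t - n)) * (1 - step (- t - n))"

lemma bsmooth_cutoff: "bsmooth (cutoff n)"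
  using bsmooth_mult[OF bsmooth_diff[OF bsmooth_const bsmooth_affine[OF bsmooth_step]]
      bsmooth_diff[OF bsmooth_const bsmooth_affine[OF bsmooth_step]], of 1 1 "-n" 1 "-1" "-n"]
  by (simp add: cutoff_def[abs_def])

lemma cutoff_eq_1: "\<bar>t\<bar> \<le> n \<Longrightarrow> cutoff n t = 1"
  and cutoff_eq_0: "\<bar>t\<bar> \<ge> n + 1 \<Longrightarrow> cutoff n t = 0"
  and cutoff_nonneg: "0 \<le> cutoff n t"
  and cutoff_le_1: "cutoff n t \<le> 1"
  by (auto simp: cutoff_def abs_if mult_le_one split: if_splits)

lemma deriv_cutoff:
  "deriv (cutoff n) t = - deriv step (t - n) * (1 - step (- t - n)) + (1 - step (t - n)) * deriv step (- t - n)"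
proof -
  have "((\<lambda>t. t - n) has_real_derivative 1) (at t)" "((\<lambda>t. - t - n) has_real_derivative -1) (at t)"
    by (auto intro!: derivative_eq_intros)
  from this[THEN DERIV_chain2[OF smooth_has_real_derivative[OF smooth_step]]]
  have "((\<lambda>t. step (t - n)) has_real_derivative deriv step (t - n)) (at t)"
    "((\<lambda>t. step (- t - n)) has_real_derivative - deriv step (- t - n)) (at t)"
    by simp_all
  from DERIV_mult[OF DERIV_diff[OF DERIV_const this(1)] DERIV_diff[OF DERIV_const this(2)], of 1 1]
  show ?thesis
    unfolding cutoff_def[abs_def]
    by (intro DERIV_imp_deriv) (simp add: mult.commute add.commute)
qed

lemma deriv_cutoff_eq_0: "\<bar>t\<bar> \<le> n \<or> \<bar>t\<bar> \<ge> n + 1 \<Longrightarrow> 0 \<le> n \<Longrightarrow> deriv (cutoff n) t = 0"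
proof -
  assume a: "\<bar>t\<bar> \<le> n \<or> \<bar>t\<bar> \<ge> n + 1" "0 \<le> n"
  have "deriv step (t - n) = 0" "deriv step (- t - n) = 0"
    using a by (auto intro!: deriv_step_zero simp: abs_if split: if_splits)
  then show ?thesis by (simp add: deriv_cutoff)
qed

text \<open>The transition is a translate of one fixed profile, which makes the bound independent of
  \<open>n\<close>. This uniformity lets the layer integrals control the derivative terms.\<close>

lemma deriv_cutoff_bounded: "\<exists>B>0. \<forall>n t. \<bar>deriv (cutoff n) t\<bar> \<le> B"
proof -
  obtain B where B: "B > 0" "\<And>t. \<bar>deriv step t\<bar> \<le> B" using deriv_step_bounded by blast
  have m: "\<bar>x * y\<bar> \<le> B" if "\<bar>x\<bar> \<le> B" "0 \<le> y" "y \<le> 1" for x y :: real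
    using mult_mono[of "\<bar>x\<bar>" B "\<bar>y\<bar>" 1] that B by (simp add: abs_mult)
  have "\<bar>deriv (cutoff n) t\<bar> \<le> 2 * B" for n t
  proof -
    have "\<bar>- deriv step (t - n) * (1 - step (- t - n))\<bar> \<le> B"
      by (rule m) (use B in auto)
    moreover have "\<bar>deriv step (- t - n) * (1 - step (t - n))\<bar> \<le> B"
      by (rule m) (use B in auto)
    ultimately show ?thesis unfolding deriv_cutoff by (simp add: mult.commute)
  qed
  then show ?thesis using B(1) by (intro exI[of _ "2 * B"]) auto
qed

section \<open>Compactly supported test functions\<close>

lemma supp_inI:
  assumes "compact C" "C \<subseteq> S" "\<And>x. x \<notin> C \<Longrightarrow> f x = 0"
  shows "supp_in f S"
proof -
  have "closure {x. f x \<noteq> 0} \<subseteq> C"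
    using assms compact_imp_closed by (intro closure_minimal) auto
  moreover from this have "C \<inter> closure {x. f x \<noteq> 0} = closure {x. f x \<noteq> 0}" by blast
  moreover have "compact (C \<inter> closure {x. f x \<noteq> 0})"
    by (intro compact_Int_closed assms(1) closed_closure)
  ultimately show ?thesis
    using assms(2) unfolding supp_in_def by auto
qed

lemma supp_inE:
  assumes "supp_in f S"
  obtains C where "compact C" "C \<subseteq> S" "\<And>x. x \<notin> C \<Longrightarrow> f x = 0"
  by (rule that[of "closure {x. f x \<noteq> 0}"])
     (use assms closure_subset[of "{x. f x \<noteq> 0}"] in \<open>auto simp: supp_in_def\<close>)

lemma test_fun_smooth: "test_fun \<Omega> f \<Longrightarrow> smooth_fun f"
  by (simp add: test_fun_def)

lemma test_fun_compose2:
  assumes "test_fun \<Omega> f" "test_fun \<Omega> g" "smooth_fun h" "\<And>x. f x = 0 \<Longrightarrow> g x = 0 \<Longrightarrow> h x = 0"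
  shows "test_fun \<Omega> h"
proof -
  obtain C where C: "compact C" "C \<subseteq> \<Omega>" "\<And>x. x \<notin> C \<Longrightarrow> f x = 0"
    using assms(1) by (meson supp_inE test_fun_def)
  obtain D where D: "compact D" "D \<subseteq> \<Omega>" "\<And>x. x \<notin> D \<Longrightarrow> g x = 0"
    using assms(2) by (meson supp_inE test_fun_def)
  have "supp_in h \<Omega>"
    by (rule supp_inI[of "C \<union> D"]) (use C D assms(4) in auto)
  then show ?thesis using assms(3) by (simp add: test_fun_def)
qed

lemma test_fun_add: "test_fun \<Omega> f \<Longrightarrow> test_fun \<Omega> g \<Longrightarrow> test_fun \<Omega> (\<lambda>x. f x + g x)"
  by (rule test_fun_compose2[of _ f g]) (auto intro: smooth_add test_fun_smooth)

lemma test_fun_mult: "test_fun \<Omega> f \<Longrightarrow> smooth_fun g \<Longrightarrow> test_fun \<Omega> (\<lambda>x. f x * g x)"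
  by (rule test_fun_compose2[of _ f f]) (auto intro: smooth_mult test_fun_smooth)

lemma test_fun_cmult: "test_fun \<Omega> f \<Longrightarrow> test_fun \<Omega> (\<lambda>x. c * f x)"
  by (rule test_fun_compose2[of _ f f]) (auto intro: smooth_cmult test_fun_smooth)

lemma test_fun_zero: "test_fun \<Omega> (\<lambda>x. 0)"
  by (auto simp: test_fun_def smooth_const intro!: supp_inI[of "{}"])

lemma test_fun_sum: "(\<And>i. i \<in> I \<Longrightarrow> test_fun \<Omega> (f i)) \<Longrightarrow> test_fun \<Omega> (\<lambda>x. \<Sum>i\<in>I. f i x)"
  by (induction I rule: infinite_finite_induct) (auto intro: test_fun_add test_fun_zero)

lemma test_fun_compose: "test_fun \<Omega> f \<Longrightarrow> smooth_fun F \<Longrightarrow> F 0 = 0 \<Longrightarrow> test_fun \<Omega> (\<lambda>x. F (f x))"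
  by (rule test_fun_compose2[of _ f f]) (auto intro: smooth_compose test_fun_smooth)

lemma test_fun_pder:
  assumes "test_fun \<Omega> f" "i \<in> Basis"
  shows "test_fun \<Omega> (pder f i)"
proof -
  obtain C where C: "compact C" "C \<subseteq> \<Omega>" "\<And>x. x \<notin> C \<Longrightarrow> f x = 0"
    using assms(1) by (meson supp_inE test_fun_def)
  have "pder f i x = 0" if "x \<notin> C" for x
  proof -
    have "(f has_derivative (\<lambda>_. 0)) (at x)"
      by (rule has_derivative_transform_within_open[of "\<lambda>_. 0" _ _ _ "- C"])
        (use that C compact_imp_closed in auto)
    then show ?thesis by (simp add: has_derivative_pder)
  qed
  then show ?thesis
    using C smooth_pder[OF test_fun_smooth[OF assms(1)] assms(2)]
    by (auto simp: test_fun_def intro: supp_inI)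
qed

lemma test_fun_bounded:
  assumes "test_fun \<Omega> f"
  shows "\<exists>B. \<forall>x. \<bar>f x\<bar> \<le> B"
proof -
  obtain C where C: "compact C" "C \<subseteq> \<Omega>" "\<And>x. x \<notin> C \<Longrightarrow> f x = 0"
    using assms by (meson supp_inE test_fun_def)
  have "compact (f ` C)"
    by (intro compact_continuous_image C smooth_continuous test_fun_smooth[OF assms])
  then obtain B where B: "B > 0" "\<And>y. y \<in> f ` C \<Longrightarrow> norm y \<le> B"
    using compact_imp_bounded bounded_pos by metis
  have "\<bar>f x\<bar> \<le> B" for x
    using B C(3)[of x] by (cases "x \<in> C") auto
  then show ?thesis by blast
qed

lemma test_fun_ball:
  assumes "cball c r \<subseteq> V" "r > 0"
  shows "test_fun V (\<lambda>x. flat 0 (r\<^sup>2 - (x - c) \<bullet> (x - c)))"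
  unfolding test_fun_def
proof
  have lin: "Ck k (\<lambda>x. 2 * ((x - c) \<bullet> i))" for k and i :: 'a
  proof (cases k)
    case (Suc n)
    have "((\<lambda>x. 2 * ((x - c) \<bullet> i)) has_derivative (\<lambda>v. 2 * (v \<bullet> i))) (at x)" for x
      by (auto intro!: derivative_eq_intros)
    then show ?thesis unfolding Suc by (rule Ck_SucI) (rule Ck_const)
  qed (auto intro!: continuous_intros)
  have "Ck (Suc k) (\<lambda>x. (x - c) \<bullet> (x - c))" for k
  proof (rule Ck_SucI)
    show "((\<lambda>x. (x - c) \<bullet> (x - c)) has_derivative (\<lambda>v. 2 * ((x - c) \<bullet> v))) (at x)" for x
      by (auto intro!: derivative_eq_intros simp: inner_commute)
  qed (rule lin)
  then have "smooth_fun (\<lambda>x. (x - c) \<bullet> (x - c))"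
    unfolding smooth_fun_def using Ck_SucD by blast
  then show "smooth_fun (\<lambda>x. flat 0 (r\<^sup>2 - (x - c) \<bullet> (x - c)))"
    by (intro smooth_compose[OF smooth_flat] smooth_diff smooth_const)
  show "supp_in (\<lambda>x. flat 0 (r\<^sup>2 - (x - c) \<bullet> (x - c))) V"
  proof (rule supp_inI[OF compact_cball assms(1)])
    fix x assume "x \<notin> cball c r"
    then have "r\<^sup>2 \<le> (norm (x - c))\<^sup>2"
      using assms(2) by (intro power_mono) (auto simp: dist_norm norm_minus_commute)
    then show "flat 0 (r\<^sup>2 - (x - c) \<bullet> (x - c)) = 0"
      by (simp add: power2_norm_eq_inner)
  qed
qed

text \<open>Finitely many radial bumps cover \<open>K\<close>; their sum is at least some
  \<open>d > 0\<close> there, and \<open>step\<close> applied to the sum divided by \<open>d\<close>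
  flattens it to 1 on \<open>K\<close> and keeps it within [0,1].\<close>

lemma test_fun_bump:
  assumes "compact K" "open V" "K \<subseteq> V"
  shows "\<exists>\<eta>. test_fun V \<eta> \<and> (\<forall>x. 0 \<le> \<eta> x \<and> \<eta> x \<le> 1) \<and> (\<forall>x\<in>K. \<eta> x = 1)"
proof -
  have "\<exists>r>0. cball x r \<subseteq> V" if "x \<in> K" for x
    using assms that open_contains_cball by blast
  then obtain r where r: "\<And>x. x \<in> K \<Longrightarrow> r x > 0" "\<And>x. x \<in> K \<Longrightarrow> cball x (r x) \<subseteq> V" by metis
  obtain X where X: "X \<subseteq> K" "finite X" "K \<subseteq> (\<Union>x\<in>X. ball x (r x))"
    using compactE_image[OF assms(1), of K "\<lambda>x. ball x (r x)"] r(1) by force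
  define b where "b c x = flat 0 ((r c)\<^sup>2 - (x - c) \<bullet> (x - c))" for c x
  define f where "f x = (\<Sum>c\<in>X. b c x)" for x
  have tb: "test_fun V (b c)" if "c \<in> X" for c
    unfolding b_def using subsetD[OF X(1) that] by (intro test_fun_ball r)
  have tf: "test_fun V f"
    unfolding f_def by (intro test_fun_sum tb)
  have f0: "f x \<ge> 0" for x by (simp add: f_def b_def sum_nonneg)
  have fpos: "f x > 0" if "x \<in> K" for x
  proof -
    obtain c where c: "c \<in> X" "x \<in> ball c (r c)" using subsetD[OF X(3) \<open>x \<in> K\<close>] by blast
    have "(norm (x - c))\<^sup>2 < (r c)\<^sup>2"
      using c(2) by (intro power_strict_mono) (auto simp: dist_norm norm_minus_commute)
    then have "b c x > 0" by (simp add: b_def power2_norm_eq_inner)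
    then show ?thesis unfolding f_def
      by (intro sum_pos2[OF X(2) c(1)]) (auto simp: b_def)
  qed
  obtain d where d: "d > 0" "\<And>x. x \<in> K \<Longrightarrow> d \<le> f x"
  proof (cases "K = {}")
    case False
    then obtain y where "y \<in> K" "\<forall>x\<in>K. f y \<le> f x"
      using continuous_attains_inf[OF assms(1) False smooth_continuous[OF test_fun_smooth[OF tf]]] by blast
    then show ?thesis using fpos that by blast
  qed (use that[of 1] in auto)
  have "test_fun V (\<lambda>x. step ((1 / d) * f x))"
    by (intro test_fun_compose[OF test_fun_cmult[OF tf] smooth_step]) simp
  moreover have "step ((1 / d) * f x) = 1" if "x \<in> K" for x
    using d that by (intro step_high) simp
  ultimately show ?thesis by (intro exI[of _ "\<lambda>x. step ((1 / d) * f x)"]) auto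
qed

lemma continuous_measurable_lebesgue_on:
  fixes f :: "'a::euclidean_space \<Rightarrow> 'b::euclidean_space"
  shows "continuous_on UNIV f \<Longrightarrow> f \<in> borel_measurable (lebesgue_on S)"
  by (intro measurable_restrict_space1 measurable_completion) (simp add: borel_measurable_continuous_onI)

lemma smooth_measurable: "smooth_fun f \<Longrightarrow> f \<in> borel_measurable (lebesgue_on S)"
  by (intro continuous_measurable_lebesgue_on smooth_continuous)

section \<open>The closure of the test functions and its chain rule\<close>

locale anisotropic =
  fixes \<Omega> :: "'n::euclidean_space set" and p0 :: real and p :: "'n \<Rightarrow> real"
  assumes open_\<Omega>: "open \<Omega>" and bounded_\<Omega>: "bounded \<Omega>"
    and p0: "p0 > 1" and p: "\<And>i. i \<in> Basis \<Longrightarrow> p i > 1"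
begin

abbreviation M :: "'n measure" where "M \<equiv> lebesgue_on \<Omega>"

abbreviation W :: "('n \<Rightarrow> real) \<Rightarrow> ('n \<Rightarrow> 'n) \<Rightarrow> bool" where "W \<equiv> W0_grad \<Omega> p0 p"

definition approx :: "(nat \<Rightarrow> 'n \<Rightarrow> real) \<Rightarrow> ('n \<Rightarrow> real) \<Rightarrow> ('n \<Rightarrow> 'n) \<Rightarrow> bool" where
  "approx \<phi> u G \<longleftrightarrow> (\<forall>n. test_fun \<Omega> (\<phi> n)) \<and> Lconv M p0 \<phi> u \<and>
     (\<forall>i\<in>Basis. Lconv M (p i) (\<lambda>n. pder (\<phi> n) i) (\<lambda>x. G x \<bullet> i))"

lemma finite_M: "finite_measure M"
  using open_\<Omega> bounded_\<Omega> by (intro finite_measure_lebesgue_on lmeasurable_open)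

lemma p_pos: "i \<in> Basis \<Longrightarrow> p i > 0" and p0_pos: "p0 > 0"
  using p p0 by (auto dest: less_trans[OF zero_less_one])

lemma Lp_norm_tendsto_iff:
  assumes "0 < q"
  shows "(\<lambda>n. Lp_norm \<Omega> q (f n)) \<longlonglongrightarrow> 0 \<longleftrightarrow> (\<lambda>n. pint M q (f n)) \<longlonglongrightarrow> 0"
proof
  assume "(\<lambda>n. Lp_norm \<Omega> q (f n)) \<longlonglongrightarrow> 0"
  then have "(\<lambda>n. Lp_norm \<Omega> q (f n) powr q) \<longlonglongrightarrow> 0 powr q"
    by (rule tendsto_powr'[OF _ tendsto_const]) (use assms in \<open>auto simp: Lp_norm_def\<close>)
  then show "(\<lambda>n. pint M q (f n)) \<longlonglongrightarrow> 0"
    using assms by (simp add: Lp_norm_def powr_powr)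
next
  assume "(\<lambda>n. pint M q (f n)) \<longlonglongrightarrow> 0"
  then have "(\<lambda>n. pint M q (f n) powr (1 / q)) \<longlonglongrightarrow> 0 powr (1 / q)"
    by (rule tendsto_powr'[OF _ tendsto_const]) (use assms in auto)
  then show "(\<lambda>n. Lp_norm \<Omega> q (f n)) \<longlonglongrightarrow> 0"
    using assms by (simp add: Lp_norm_def)
qed

lemma W_iff: "W u G \<longleftrightarrow> Lmem M p0 u \<and> (\<forall>i\<in>Basis. Lmem M (p i) (\<lambda>x. G x \<bullet> i)) \<and> (\<exists>\<phi>. approx \<phi> u G)"
  unfolding W0_grad_def approx_def Lconv_def Lp_mem_iff_Lmem
  using Lp_norm_tendsto_iff p_pos p0_pos by auto

lemma WD: "W u G \<Longrightarrow> Lmem M p0 u" "W u G \<Longrightarrow> i \<in> Basis \<Longrightarrow> Lmem M (p i) (\<lambda>x. G x \<bullet> i)"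
  by (auto simp: W_iff)

lemma Lmem_test_fun: "test_fun \<Omega> f \<Longrightarrow> 0 \<le> q \<Longrightarrow> Lmem M q f"
  using test_fun_bounded[of \<Omega> f]
  by (auto intro!: Lmem_bounded[OF finite_M] smooth_measurable test_fun_smooth)

lemma approx_test_fun: "approx \<phi> u G \<Longrightarrow> test_fun \<Omega> (\<phi> n)"
  by (simp add: approx_def)

lemma approx_subseq: "approx \<phi> u G \<Longrightarrow> strict_mono r \<Longrightarrow> approx (\<lambda>n. \<phi> (r n)) u G"
  unfolding approx_def by (auto intro: Lconv_subseq Lconv_subseq[where f = "\<lambda>n. pder (\<phi> n) _"])

lemma W_approx_AE:
  assumes "W u G"
  obtains \<phi> where "approx \<phi> u G" "AE x in M. (\<lambda>n. \<phi> n x) \<longlonglongrightarrow> u x"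
proof -
  obtain \<phi> where \<phi>: "approx \<phi> u G" using assms by (auto simp: W_iff)
  have "\<exists>r. strict_mono r \<and> (AE x in M. (\<lambda>n. \<phi> (r n) x) \<longlonglongrightarrow> u x)"
    by (rule Lconv_AE_subseq[OF _ WD(1)[OF assms] p0_pos])
      (use \<phi> Lmem_test_fun p0_pos in \<open>auto simp: approx_def\<close>)
  then show ?thesis using approx_subseq[OF \<phi>] that by blast
qed

lemma W_test_fun:
  assumes "test_fun \<Omega> f"
  shows "W f (\<lambda>x. \<Sum>i\<in>Basis. pder f i x *\<^sub>R i)"
proof -
  have "approx (\<lambda>_. f) f (\<lambda>x. \<Sum>i\<in>Basis. pder f i x *\<^sub>R i)"
    using assms p_pos p0_pos by (auto simp: approx_def intro!: Lconv_const)
  then show ?thesis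
    using assms p_pos p0_pos by (auto simp: W_iff intro!: Lmem_test_fun test_fun_pder less_imp_le)
qed

lemma W_add:
  assumes "W f F" "W g G"
  shows "W (\<lambda>x. f x + g x) (\<lambda>x. F x + G x)"
proof -
  obtain \<phi> \<psi> where \<phi>: "approx \<phi> f F" and \<psi>: "approx \<psi> g G" using assms by (auto simp: W_iff)
  note t = approx_test_fun[OF \<phi>] approx_test_fun[OF \<psi>]
  have "approx (\<lambda>n x. \<phi> n x + \<psi> n x) (\<lambda>x. f x + g x) (\<lambda>x. F x + G x)"
    unfolding approx_def
  proof (intro conjI ballI allI)
    show "test_fun \<Omega> (\<lambda>x. \<phi> n x + \<psi> n x)" for n by (intro test_fun_add t)
    show "Lconv M p0 (\<lambda>n x. \<phi> n x + \<psi> n x) (\<lambda>x. f x + g x)"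
      using \<phi> \<psi> p0_pos by (intro Lconv_add Lmem_test_fun t WD(1)[OF assms(1)] WD(1)[OF assms(2)]) (auto simp: approx_def)
    fix i :: 'n assume i: "i \<in> Basis"
    have "Lconv M (p i) (\<lambda>n x. pder (\<phi> n) i x + pder (\<psi> n) i x) (\<lambda>x. F x \<bullet> i + G x \<bullet> i)"
      using \<phi> \<psi> p_pos[OF i] i
      by (intro Lconv_add Lmem_test_fun test_fun_pder t WD(2)[OF assms(1)] WD(2)[OF assms(2)]) (auto simp: approx_def)
    then show "Lconv M (p i) (\<lambda>n. pder (\<lambda>x. \<phi> n x + \<psi> n x) i) (\<lambda>x. (F x + G x) \<bullet> i)"
      by (simp add: pder_add[OF t[THEN test_fun_smooth], abs_def] inner_add_left)
  qed
  then show ?thesis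
    using assms p_pos p0_pos unfolding W_iff inner_add_left
    by (auto intro!: Lmem_add less_imp_le)
qed

lemma W_cmult:
  assumes "W f F"
  shows "W (\<lambda>x. c * f x) (\<lambda>x. c *\<^sub>R F x)"
proof -
  obtain \<phi> where \<phi>: "approx \<phi> f F" using assms by (auto simp: W_iff)
  note t = approx_test_fun[OF \<phi>]
  have "approx (\<lambda>n x. c * \<phi> n x) (\<lambda>x. c * f x) (\<lambda>x. c *\<^sub>R F x)"
    using \<phi> unfolding approx_def
    by (auto intro!: test_fun_cmult Lconv_cmult simp: pder_cmult[OF t[THEN test_fun_smooth], abs_def])
  then show ?thesis
    using assms p_pos p0_pos unfolding W_iff inner_scaleR_left
    by (auto intro!: Lmem_cmult less_imp_le)
qed

text \<open>Product and chain rule in one: along approximants that converge a.e., the factors with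
  \<open>A\<close>, \<open>B\<close> and their derivatives are bounded and converge a.e., while the
  gradients converge in the sense of \<open>Lconv\<close>. The condition at 0 keeps supports
  compact; a constant \<open>B\<close> gives the chain rule.\<close>

lemma W_prod:
  assumes f: "W f F" and g: "W g G" and A: "bsmooth A" and B: "bsmooth B" and 0: "A 0 * B 0 = 0"
  shows "W (\<lambda>x. A (f x) * B (g x))
    (\<lambda>x. (A (f x) * deriv B (g x)) *\<^sub>R G x + (deriv A (f x) * B (g x)) *\<^sub>R F x)"
proof -
  note sA = bsmooth_smooth[OF A] and sB = bsmooth_smooth[OF B]
  obtain \<phi> where \<phi>: "approx \<phi> f F" "AE x in M. (\<lambda>n. \<phi> n x) \<longlonglongrightarrow> f x" by (rule W_approx_AE[OF f])
  obtain \<psi> where \<psi>: "approx \<psi> g G" "AE x in M. (\<lambda>n. \<psi> n x) \<longlonglongrightarrow> g x" by (rule W_approx_AE[OF g])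
  note t = approx_test_fun[OF \<phi>(1)] approx_test_fun[OF \<psi>(1)]
  note s = t[THEN test_fun_smooth]
  obtain CA where CA: "CA > 0" "\<And>t. \<bar>A t\<bar> \<le> CA" "\<And>t. \<bar>deriv A t\<bar> \<le> CA" by (rule bsmoothE[OF A]) blast
  obtain CB where CB: "CB > 0" "\<And>t. \<bar>B t\<bar> \<le> CB" "\<And>t. \<bar>deriv B t\<bar> \<le> CB" by (rule bsmoothE[OF B]) blast
  have [measurable]: "f \<in> borel_measurable M" "g \<in> borel_measurable M" using WD(1) f g by (auto simp: Lmem_def)
  have [measurable]: "A \<in> borel_measurable borel" "B \<in> borel_measurable borel"
    "deriv A \<in> borel_measurable borel" "deriv B \<in> borel_measurable borel"
    by (intro borel_measurable_continuous_onI smooth_continuous smooth_deriv sA sB)+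
  have [measurable]: "\<phi> n \<in> borel_measurable M" "\<psi> n \<in> borel_measurable M" for n
    by (intro smooth_measurable s)+
  have prod: "\<bar>x * y\<bar> \<le> CA * CB" if "\<bar>x\<bar> \<le> CA" "\<bar>y\<bar> \<le> CB" for x y
    unfolding abs_mult using that CA CB by (intro mult_mono) auto
  have lim: "AE x in M. (\<lambda>n. X (\<phi> n x) * Y (\<psi> n x)) \<longlonglongrightarrow> X (f x) * Y (g x)"
    if "smooth_fun X" "smooth_fun Y" for X Y :: "real \<Rightarrow> real"
    using \<phi>(2) \<psi>(2)
  proof eventually_elim
    case (elim x)
    have "isCont X (f x)" "isCont Y (g x)"
      using that smooth_continuous[of _ UNIV] by (auto simp: continuous_on_eq_continuous_at)
    from tendsto_mult[OF this[THEN isCont_tendsto_compose]] elim show ?case by blast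
  qed
  have pd: "pder (\<lambda>x. A (\<phi> n x) * B (\<psi> n x)) i x = (A (\<phi> n x) * deriv B (\<psi> n x)) * pder (\<psi> n) i x
       + (deriv A (\<phi> n x) * B (\<psi> n x)) * pder (\<phi> n) i x" for n i x
    using s smooth_compose[OF sA s(1)] smooth_compose[OF sB s(2)]
    by (simp add: pder_mult pder_compose sA sB)
  have "approx (\<lambda>n x. A (\<phi> n x) * B (\<psi> n x)) (\<lambda>x. A (f x) * B (g x))
    (\<lambda>x. (A (f x) * deriv B (g x)) *\<^sub>R G x + (deriv A (f x) * B (g x)) *\<^sub>R F x)"
    unfolding approx_def
  proof (intro conjI ballI allI)
    show "test_fun \<Omega> (\<lambda>x. A (\<phi> n x) * B (\<psi> n x))" for n
      by (rule test_fun_compose2[OF t(1)[of n] t(2)[of n]]) (use 0 in \<open>auto intro!: smooth_mult smooth_compose[OF sA] smooth_compose[OF sB] s\<close>)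
    show "Lconv M p0 (\<lambda>n x. A (\<phi> n x) * B (\<psi> n x)) (\<lambda>x. A (f x) * B (g x))"
      by (rule Lconv_bounded[OF finite_M, where B = "CA * CB"])
        (use lim[OF sA sB] prod CA CB p0_pos in auto)
    fix i :: 'n assume i: "i \<in> Basis"
    have "Lconv M (p i) (\<lambda>n x. (A (\<phi> n x) * deriv B (\<psi> n x)) * pder (\<psi> n) i x)
        (\<lambda>x. (A (f x) * deriv B (g x)) * (G x \<bullet> i))"
      by (rule Lconv_mult_bounded[where B = "CA * CB"])
        (use lim[OF sA smooth_deriv[OF sB]] prod CA CB p_pos[OF i] WD(2)[OF g i] \<psi>(1) i t
          in \<open>auto simp: approx_def intro!: Lmem_test_fun test_fun_pder\<close>)
    moreover have "Lconv M (p i) (\<lambda>n x. (deriv A (\<phi> n x) * B (\<psi> n x)) * pder (\<phi> n) i x)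
        (\<lambda>x. (deriv A (f x) * B (g x)) * (F x \<bullet> i))"
      by (rule Lconv_mult_bounded[where B = "CA * CB"])
        (use lim[OF smooth_deriv[OF sA] sB] prod CA CB p_pos[OF i] WD(2)[OF f i] \<phi>(1) i t
          in \<open>auto simp: approx_def intro!: Lmem_test_fun test_fun_pder\<close>)
    ultimately show "Lconv M (p i) (\<lambda>n. pder (\<lambda>x. A (\<phi> n x) * B (\<psi> n x)) i)
      (\<lambda>x. ((A (f x) * deriv B (g x)) *\<^sub>R G x + (deriv A (f x) * B (g x)) *\<^sub>R F x) \<bullet> i)"
      unfolding pd[abs_def] inner_add_left inner_scaleR_left
      by (rule Lconv_add)
        (use prod CA CB p_pos[OF i] WD(2)[OF g i] WD(2)[OF f i] t[THEN test_fun_pder, OF i, THEN Lmem_test_fun]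
          in \<open>auto intro!: Lmem_mult_bounded[where B = "CA * CB"]\<close>)
  qed
  moreover have "Lmem M p0 (\<lambda>x. A (f x) * B (g x))"
    by (rule Lmem_bounded[OF finite_M, where B = "CA * CB"]) (use prod CA CB p0_pos in auto)
  moreover have "Lmem M (p i) (\<lambda>x. ((A (f x) * deriv B (g x)) *\<^sub>R G x + (deriv A (f x) * B (g x)) *\<^sub>R F x) \<bullet> i)"
    if i: "i \<in> Basis" for i
    unfolding inner_add_left inner_scaleR_left
    by (intro Lmem_add Lmem_mult_bounded[where B = "CA * CB"])
      (use prod CA CB p_pos[OF i] WD(2)[OF g i] WD(2)[OF f i] in auto)
  ultimately show ?thesis unfolding W_iff by blast
qed

lemma W_compose:
  assumes "W f F" "bsmooth A" "A 0 = 0"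
  shows "W (\<lambda>x. A (f x)) (\<lambda>x. deriv A (f x) *\<^sub>R F x)"
  using W_prod[OF assms(1) assms(1) assms(2) bsmooth_const[of 1]] assms(3) by simp

text \<open>A diagonal argument: each \<open>f n\<close> is replaced by a test function with error
  below \<open>1 / Suc n\<close>, simultaneously for the function and for the finitely many partial
  derivatives.\<close>

lemma W_closed:
  assumes W: "\<And>n. W (f n) (F n)" and u: "Lmem M p0 u" "Lconv M p0 f u"
    and G: "\<And>i. i \<in> Basis \<Longrightarrow> Lmem M (p i) (\<lambda>x. G x \<bullet> i)"
      "\<And>i. i \<in> Basis \<Longrightarrow> Lconv M (p i) (\<lambda>n x. F n x \<bullet> i) (\<lambda>x. G x \<bullet> i)"
  shows "W u G"
proof -
  have "\<exists>\<psi>. test_fun \<Omega> \<psi> \<and> pint M p0 (\<lambda>x. \<psi> x - f n x) < 1 / Suc n \<and>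
      (\<forall>i\<in>Basis. pint M (p i) (\<lambda>x. pder \<psi> i x - F n x \<bullet> i) < 1 / Suc n)" for n
  proof -
    obtain \<phi> where \<phi>: "approx \<phi> (f n) (F n)" using W by (auto simp: W_iff)
    have ev: "\<forall>\<^sub>F k in sequentially. pint M p0 (\<lambda>x. \<phi> k x - f n x) < 1 / Suc n"
      using \<phi> unfolding approx_def Lconv_def by (intro order_tendstoD(2)[where y = 0]) auto
    have "\<forall>\<^sub>F k in sequentially. \<forall>i\<in>Basis. pint M (p i) (\<lambda>x. pder (\<phi> k) i x - F n x \<bullet> i) < 1 / Suc n"
      using \<phi> unfolding approx_def Lconv_def
      by (intro eventually_ball_finite ballI order_tendstoD(2)[where y = 0]) auto
    from eventually_conj[OF ev this] obtain k where "pint M p0 (\<lambda>x. \<phi> k x - f n x) < 1 / Suc n \<and>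
      (\<forall>i\<in>Basis. pint M (p i) (\<lambda>x. pder (\<phi> k) i x - F n x \<bullet> i) < 1 / Suc n)"
      by (rule eventually_happens'[OF sequentially_bot, THEN exE])
    then show ?thesis using approx_test_fun[OF \<phi>] by blast
  qed
  then have "\<forall>n. \<exists>\<psi>. test_fun \<Omega> \<psi> \<and> pint M p0 (\<lambda>x. \<psi> x - f n x) < 1 / Suc n \<and>
      (\<forall>i\<in>Basis. pint M (p i) (\<lambda>x. pder \<psi> i x - F n x \<bullet> i) < 1 / Suc n)" by blast
  from choice[OF this] obtain \<psi> where \<psi>: "\<And>n. test_fun \<Omega> (\<psi> n)" "\<And>n. pint M p0 (\<lambda>x. \<psi> n x - f n x) < 1 / Suc n"
    "\<And>n i. i \<in> Basis \<Longrightarrow> pint M (p i) (\<lambda>x. pder (\<psi> n) i x - F n x \<bullet> i) < 1 / Suc n" by blast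
  have tri: "Lconv M q X h" if "Lconv M q Y h" "\<And>n. Lmem M q (X n)" "\<And>n. Lmem M q (Y n)" "Lmem M q h"
    "\<And>n. pint M q (\<lambda>x. X n x - Y n x) < 1 / Suc n" "0 < q" for q X Y and h :: "'n \<Rightarrow> real"
  proof (rule Lconv_squeeze)
    show "(\<lambda>n. 2 powr q * (1 / Suc n + pint M q (\<lambda>x. Y n x - h x))) \<longlonglongrightarrow> 0"
      by (intro tendsto_mult_right_zero tendsto_add_zero that(1)[unfolded Lconv_def]
          lim_1_over_n[THEN LIMSEQ_Suc])
    show "pint M q (\<lambda>x. X n x - h x) \<le> 2 powr q * (1 / Suc n + pint M q (\<lambda>x. Y n x - h x))" for n
      using pint_diff_triangle[OF that(2)[of n] that(3)[of n] that(4)] that(5)[of n] that(6)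
      by (smt (verit) mult_left_mono powr_ge_zero)
  qed
  have "approx \<psi> u G"
    unfolding approx_def
  proof (intro conjI ballI allI \<psi>(1))
    show "Lconv M p0 \<psi> u"
      by (rule tri[OF u(2) _ WD(1)[OF W] u(1) \<psi>(2) p0_pos]) (use p0_pos in \<open>auto intro!: Lmem_test_fun \<psi>\<close>)
    fix i :: 'n assume i: "i \<in> Basis"
    show "Lconv M (p i) (\<lambda>n. pder (\<psi> n) i) (\<lambda>x. G x \<bullet> i)"
      by (rule tri[OF G(2)[OF i] _ WD(2)[OF W i] G(1)[OF i] \<psi>(3)[OF i] p_pos[OF i]])
        (use p_pos[OF i] i in \<open>auto intro!: Lmem_test_fun test_fun_pder \<psi>\<close>)
  qed
  then show ?thesis using u G by (auto simp: W_iff)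
qed

end

subsection \<open>Vanishing of gradients on level sets\<close>

lemma Lconv_L1:
  assumes "finite_measure M" "1 \<le> q" "\<And>n. Lmem M q (f n)" "Lmem M q g" "Lconv M q f g"
  shows "(\<lambda>n. \<integral>x. \<bar>f n x - g x\<bar> \<partial>M) \<longlonglongrightarrow> 0"
proof (rule LIMSEQ_I)
  interpret finite_measure M by fact
  fix r :: real assume "r > 0"
  \<comment> \<open>Adding 1 keeps \<open>K\<close> positive even for a null space; \<open>d\<close>
    spends r/2 on the constant term of \<open>le_add_powr\<close> and leaves r/2 for the power
    term.\<close>
  define K where "K = measure M (space M) + 1"
  define d where "d = r / (2 * K)"
  have K: "K > 0" by (smt (verit) measure_nonneg K_def)
  then have d: "d > 0" using \<open>r > 0\<close> by (simp add: d_def)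
  have "d * measure M (space M) < d * K"
    using d unfolding K_def by (intro mult_strict_left_mono) auto
  then have dm: "d * measure M (space M) < r / 2"
    using K by (simp add: d_def)
  have dq: "d powr (1 - q) > 0" using d by simp
  have "\<forall>\<^sub>F n in sequentially. pint M q (\<lambda>x. f n x - g x) < r / (2 * d powr (1 - q))"
    using assms(5) unfolding Lconv_def by (rule order_tendstoD) (use \<open>r > 0\<close> dq in auto)
  then obtain N where N: "\<And>n. n \<ge> N \<Longrightarrow> pint M q (\<lambda>x. f n x - g x) < r / (2 * d powr (1 - q))"
    by (auto simp: eventually_sequentially)
  have "(\<integral>x. \<bar>f n x - g x\<bar> \<partial>M) < r" if "n \<ge> N" for n
  proof -
    have D: "Lmem M q (\<lambda>x. f n x - g x)" using assms by (intro Lmem_diff) auto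
    have "(\<integral>x. \<bar>f n x - g x\<bar> \<partial>M) \<le> (\<integral>x. d + d powr (1 - q) * \<bar>f n x - g x\<bar> powr q \<partial>M)"
      using D Lmem_integrable[OF assms(1) D assms(2)] d assms(2)
      by (intro integral_mono le_add_powr) (auto simp: Lmem_def)
    also have "\<dots> = d * measure M (space M) + d powr (1 - q) * pint M q (\<lambda>x. f n x - g x)"
      using D by (simp add: Lmem_def)
    also have "d powr (1 - q) * pint M q (\<lambda>x. f n x - g x) < r / 2"
      using N[OF that] dq by (simp add: field_simps)
    finally show ?thesis using dm by linarith
  qed
  then show "\<exists>no. \<forall>n\<ge>no. norm ((\<integral>x. \<bar>f n x - g x\<bar> \<partial>M) - 0) < r"
    by (intro exI[of _ N]) (auto simp: abs_of_nonneg)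
qed

lemma Lconv_integral_mult:
  assumes "finite_measure M" "1 \<le> q" "\<And>n. Lmem M q (f n)" "Lmem M q g" "Lconv M q f g"
    and b: "b \<in> borel_measurable M" "\<And>x. \<bar>b x\<bar> \<le> B"
  shows "(\<lambda>n. \<integral>x. f n x * b x \<partial>M) \<longlonglongrightarrow> (\<integral>x. g x * b x \<partial>M)"
proof -
  have int: "integrable M (\<lambda>x. h x * b x)" if "Lmem M q h" for h
  proof (rule Bochner_Integration.integrable_bound[where f = "\<lambda>x. B * h x"])
    show "integrable M (\<lambda>x. B * h x)" using Lmem_integrable[OF assms(1) that assms(2)] by simp
    show "AE x in M. norm (h x * b x) \<le> norm (B * h x)"
      using b(2) by (auto simp: abs_mult mult.commute intro!: mult_right_mono order_trans[OF b(2)])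
  qed (use that b in \<open>auto simp: Lmem_def\<close>)
  have "(\<lambda>n. (\<integral>x. f n x * b x \<partial>M) - (\<integral>x. g x * b x \<partial>M)) \<longlonglongrightarrow> 0"
  proof (rule tendsto_0_le[where K = B and f = "\<lambda>n. \<integral>x. \<bar>f n x - g x\<bar> \<partial>M"])
    show "(\<lambda>n. \<integral>x. \<bar>f n x - g x\<bar> \<partial>M) \<longlonglongrightarrow> 0" by (rule Lconv_L1[OF assms(1-5)])
    show "\<forall>\<^sub>F n in sequentially. norm ((\<integral>x. f n x * b x \<partial>M) - (\<integral>x. g x * b x \<partial>M))
      \<le> norm (\<integral>x. \<bar>f n x - g x\<bar> \<partial>M) * B"
    proof (intro always_eventually allI)
      fix n
      have D: "Lmem M q (\<lambda>x. f n x - g x)" using assms by (intro Lmem_diff) auto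
      have "norm ((\<integral>x. f n x * b x \<partial>M) - (\<integral>x. g x * b x \<partial>M)) = norm (\<integral>x. (f n x - g x) * b x \<partial>M)"
        using int[OF assms(3)] int[OF assms(4)] by (simp add: left_diff_distrib)
      also have "\<dots> \<le> (\<integral>x. norm ((f n x - g x) * b x) \<partial>M)" by (rule integral_norm_bound)
      also have "\<dots> \<le> (\<integral>x. \<bar>f n x - g x\<bar> * B \<partial>M)"
        by (intro integral_mono integrable_norm int[OF D] integrable_mult_left integrable_abs
            Lmem_integrable[OF assms(1) D assms(2)]) (auto simp: abs_mult intro!: mult_left_mono b(2))
      finally show "norm ((\<integral>x. f n x * b x \<partial>M) - (\<integral>x. g x * b x \<partial>M)) \<le> norm (\<integral>x. \<bar>f n x - g x\<bar> \<partial>M) * B"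
        by (simp add: abs_of_nonneg)
    qed
  qed
  then show ?thesis by (rule LIM_zero_cancel)
qed

lemma open_compact_exhaustion:
  fixes A :: "'a::euclidean_space set"
  assumes "open A"
  shows "\<exists>C. (\<forall>n. compact (C n)) \<and> (\<forall>n. C n \<subseteq> A) \<and> incseq C \<and> \<Union>(range C) = A"
proof (rule open_Union_compact_subsets[OF assms], goal_cases)
  case (1 C)
  have "C n \<subseteq> C (Suc n)" for n by (rule order_trans[OF 1(3) interior_subset])
  then have "incseq C" by (rule incseq_SucI)
  with 1(1,2,4) show ?case by (intro exI[of _ C] conjI allI)
qed

lemma test_fun_integrable_lborel:
  assumes "test_fun \<Omega> f"
  shows "integrable lborel f"
proof -
  obtain C where C: "compact C" "C \<subseteq> \<Omega>" "\<And>x. x \<notin> C \<Longrightarrow> f x = 0"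
    using assms by (meson supp_inE test_fun_def)
  have "integrable lborel (\<lambda>x. indicator C x *\<^sub>R f x)"
    by (intro borel_integrable_compact C smooth_continuous test_fun_smooth[OF assms])
  moreover have "(\<lambda>x. indicator C x *\<^sub>R f x) = f"
  proof
    show "indicator C x *\<^sub>R f x = f x" for x using C(3) by (cases "x \<in> C") auto
  qed
  ultimately show ?thesis by simp
qed

text \<open>Translation invariance makes the integral of every difference quotient 0, and the
  quotients converge to the partial derivative. They are dominated because the mean value theorem
  bounds them by \<open>B\<close> and steps of length at most 1 keep their supports in the enlarged
  compact set \<open>D\<close>.\<close>

lemma integral_pder_test_fun:
  assumes f: "test_fun \<Omega> f" and i: "i \<in> Basis"
  shows "(\<integral>x. pder f i x \<partial>lborel) = 0"
proof -
  obtain C where C: "compact C" "C \<subseteq> \<Omega>" "\<And>x. x \<notin> C \<Longrightarrow> f x = 0"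
    using f by (meson supp_inE test_fun_def)
  obtain B where B: "\<And>x. \<bar>pder f i x\<bar> \<le> B" using test_fun_bounded[OF test_fun_pder[OF f i]] by blast
  define D where "D = {x + y |x y. x \<in> C \<and> y \<in> cball 0 1}"
  have D: "compact D" unfolding D_def by (intro compact_sums C compact_cball)
  have CD: "x \<in> D" if "x + t *\<^sub>R i \<in> C" "\<bar>t\<bar> \<le> 1" for x t
    unfolding D_def using that i
    by (intro CollectI exI[of _ "x + t *\<^sub>R i"] exI[of _ "- (t *\<^sub>R i)"]) auto
  have line: "((\<lambda>t. f (x + t *\<^sub>R i)) has_real_derivative pder f i (x + t *\<^sub>R i)) (at t)" for x t
  proof -
    have "((\<lambda>t. x + t *\<^sub>R i) has_derivative (\<lambda>s. s *\<^sub>R i)) (at t)"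
      by (auto intro!: derivative_eq_intros)
    from has_derivative_compose[OF this smooth_has_derivative[OF test_fun_smooth[OF f]]]
    have d: "((\<lambda>t. f (x + t *\<^sub>R i)) has_derivative
        (\<lambda>s. frechet_derivative f (at (x + t *\<^sub>R i)) (s *\<^sub>R i))) (at t)" .
    have "linear (frechet_derivative f (at (x + t *\<^sub>R i)))"
      using smooth_has_derivative[OF test_fun_smooth[OF f]] has_derivative_linear by blast
    then have "frechet_derivative f (at (x + t *\<^sub>R i)) (s *\<^sub>R i) = pder f i (x + t *\<^sub>R i) * s" for s
      by (simp add: linear_scale pder_def mult.commute)
    then show ?thesis using d by (simp add: has_field_derivative_def)
  qed
  define h where "h n = 1 / real (Suc n)" for n
  have h: "0 < h n" "h n \<le> 1" for n by (auto simp: h_def)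
  define q where "q n x = (f (x + h n *\<^sub>R i) - f x) / h n" for n x
  have [measurable]: "f \<in> borel_measurable borel" "pder f i \<in> borel_measurable borel"
    by (intro borel_measurable_continuous_onI smooth_continuous test_fun_smooth[OF f]
        test_fun_smooth[OF test_fun_pder[OF f i]])+
  have int: "integrable lborel f" by (rule test_fun_integrable_lborel[OF f])
  have q0: "(\<integral>x. q n x \<partial>lborel) = 0" for n
  proof -
    have "integrable lborel (\<lambda>x. f (h n *\<^sub>R i + x)) \<and> (\<integral>x. f (h n *\<^sub>R i + x) \<partial>lborel) = (\<integral>x. f x \<partial>lborel)"
    proof -
      have e: "lborel = distr lborel borel ((+) (h n *\<^sub>R i))" by (rule lborel_distr_plus[symmetric])
      have "integrable (distr lborel borel ((+) (h n *\<^sub>R i))) f" using int e by simp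
      then have "integrable lborel (\<lambda>x. f (h n *\<^sub>R i + x))" by (subst (asm) integrable_distr_eq) auto
      moreover have "(\<integral>x. f x \<partial>distr lborel borel ((+) (h n *\<^sub>R i))) = (\<integral>x. f (h n *\<^sub>R i + x) \<partial>lborel)"
        by (subst integral_distr) auto
      ultimately show ?thesis using e by simp
    qed
    then show ?thesis using int by (simp add: q_def add.commute)
  qed
  have "(\<lambda>n. \<integral>x. q n x \<partial>lborel) \<longlonglongrightarrow> (\<integral>x. pder f i x \<partial>lborel)"
  proof (rule integral_dominated_convergence[where w = "\<lambda>x. indicator D x * B"])
    show "integrable lborel (\<lambda>x. indicator D x * B)"
      using borel_integrable_compact[OF D continuous_on_const, of B] by simp
    show "AE x in lborel. (\<lambda>n. q n x) \<longlonglongrightarrow> pder f i x"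
    proof (intro AE_I2)
      fix x
      have "((\<lambda>s. (f (x + (0 + s) *\<^sub>R i) - f (x + 0 *\<^sub>R i)) / s) \<longlongrightarrow> pder f i (x + 0 *\<^sub>R i)) (at 0)"
        using line[of x 0] unfolding DERIV_def .
      moreover have "filterlim h (at 0) sequentially"
        unfolding filterlim_at using h(1) LIMSEQ_Suc[OF lim_1_over_n]
        by (auto simp: h_def[abs_def] less_imp_neq[symmetric])
      ultimately have "((\<lambda>n. (f (x + (0 + h n) *\<^sub>R i) - f (x + 0 *\<^sub>R i)) / h n) \<longlongrightarrow> pder f i (x + 0 *\<^sub>R i)) sequentially"
        by (rule filterlim_compose)
      then show "(\<lambda>n. q n x) \<longlonglongrightarrow> pder f i x" by (simp add: q_def)
    qed
    fix n
    show "AE x in lborel. norm (q n x) \<le> indicator D x * B"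
    proof (intro AE_I2)
      fix x
      show "norm (q n x) \<le> indicator D x * B"
      proof (cases "x \<in> D")
        case True
        have "\<exists>z. 0 < z \<and> z < h n \<and> f (x + h n *\<^sub>R i) - f (x + 0 *\<^sub>R i) = (h n - 0) * pder f i (x + z *\<^sub>R i)"
          by (rule MVT2[OF h(1) line])
        then obtain z where "f (x + h n *\<^sub>R i) - f x = h n * pder f i (x + z *\<^sub>R i)" by auto
        then have "q n x = pder f i (x + z *\<^sub>R i)" using h(1)[of n] by (simp add: q_def)
        then show ?thesis using True B by simp
      next
        case False
        then have "f (x + h n *\<^sub>R i) = 0" "f (x + 0 *\<^sub>R i) = 0"
          using CD[of x "h n"] CD[of x 0] C(3) h[of n] by (auto simp: abs_of_pos)
        then show ?thesis using False by (simp add: q_def)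
      qed
    qed
  qed (auto simp: q_def)
  then show ?thesis using q0 LIMSEQ_unique[OF _ tendsto_const] by simp
qed

context anisotropic begin

lemma integral_M_test_fun:
  assumes "test_fun \<Omega> f"
  shows "(\<integral>x. f x \<partial>M) = (\<integral>x. f x \<partial>lborel)"
proof -
  obtain C where C: "compact C" "C \<subseteq> \<Omega>" "\<And>x. x \<notin> C \<Longrightarrow> f x = 0"
    using assms by (meson supp_inE test_fun_def)
  have "(\<integral>x. f x \<partial>M) = (\<integral>x. (if x \<in> \<Omega> then f x else 0) \<partial>lebesgue)"
    using open_\<Omega> by (intro Lebesgue_Measure.integral_restrict_UNIV[symmetric]) auto
  also have "(\<lambda>x. if x \<in> \<Omega> then f x else 0) = f" using C(2,3) by (intro ext) auto
  also have "(\<integral>x. f x \<partial>lebesgue) = (\<integral>x. f x \<partial>lborel)"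
    by (intro integral_completion borel_measurable_integrable)
      (use test_fun_integrable_lborel[OF assms] in auto)
  finally show ?thesis .
qed

lemma test_fun_integration_by_parts:
  assumes f: "test_fun \<Omega> f" and g: "test_fun \<Omega> g" and i: "i \<in> Basis"
  shows "(\<integral>x. pder f i x * g x \<partial>M) = - (\<integral>x. f x * pder g i x \<partial>M)"
proof -
  note s = test_fun_smooth[OF f] test_fun_smooth[OF g]
  have t: "test_fun \<Omega> (\<lambda>x. f x * g x)" by (intro test_fun_mult f s)
  have i1: "integrable M h" if "test_fun \<Omega> h" for h
    using Lmem_integrable[OF finite_M Lmem_test_fun[OF that], of 1] by simp
  have "0 = (\<integral>x. pder (\<lambda>x. f x * g x) i x \<partial>M)"
    using integral_pder_test_fun[OF t i] integral_M_test_fun[OF test_fun_pder[OF t i]] by simp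
  also have "\<dots> = (\<integral>x. f x * pder g i x + pder f i x * g x \<partial>M)"
    by (simp add: pder_mult s)
  also have "\<dots> = (\<integral>x. f x * pder g i x \<partial>M) + (\<integral>x. pder f i x * g x \<partial>M)"
    by (intro Bochner_Integration.integral_add i1 test_fun_mult f test_fun_pder i smooth_pder s)
  finally show ?thesis by simp
qed

lemma W_integration_by_parts:
  assumes "W f F" "test_fun \<Omega> \<eta>" and i: "i \<in> Basis"
  shows "(\<integral>x. (F x \<bullet> i) * \<eta> x \<partial>M) = - (\<integral>x. f x * pder \<eta> i x \<partial>M)"
proof -
  obtain \<phi> where \<phi>: "approx \<phi> f F" using assms(1) by (auto simp: W_iff)
  note t = approx_test_fun[OF \<phi>]
  have bd: "\<exists>B. \<forall>x. \<bar>\<eta> x\<bar> \<le> B" "\<exists>B. \<forall>x. \<bar>pder \<eta> i x\<bar> \<le> B"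
    by (intro test_fun_bounded[of \<Omega>] assms test_fun_pder)+
  have 1: "(\<lambda>n. \<integral>x. pder (\<phi> n) i x * \<eta> x \<partial>M) \<longlonglongrightarrow> (\<integral>x. (F x \<bullet> i) * \<eta> x \<partial>M)"
    using bd(1)
    by (elim exE, intro Lconv_integral_mult[OF finite_M, where q = "p i"])
      (use \<phi> p[OF i] i WD(2)[OF assms(1) i] t assms(2)
        in \<open>auto simp: approx_def intro!: Lmem_test_fun test_fun_pder smooth_measurable test_fun_smooth[of \<Omega>]\<close>)
  have 2: "(\<lambda>n. \<integral>x. \<phi> n x * pder \<eta> i x \<partial>M) \<longlonglongrightarrow> (\<integral>x. f x * pder \<eta> i x \<partial>M)"
    using bd(2)
    by (elim exE, intro Lconv_integral_mult[OF finite_M, where q = p0])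
      (use \<phi> p0 i WD(1)[OF assms(1)] t assms(2)
        in \<open>auto simp: approx_def intro!: Lmem_test_fun test_fun_pder smooth_measurable test_fun_smooth[of \<Omega>]\<close>)
  have "(\<lambda>n. \<integral>x. pder (\<phi> n) i x * \<eta> x \<partial>M) \<longlonglongrightarrow> - (\<integral>x. f x * pder \<eta> i x \<partial>M)"
    unfolding test_fun_integration_by_parts[OF t assms(2) i] by (intro tendsto_minus 2)
  with 1 show ?thesis by (rule LIMSEQ_unique)
qed

lemma sets_M: "A \<in> sets lebesgue \<Longrightarrow> A \<subseteq> \<Omega> \<Longrightarrow> A \<in> sets M"
  using open_\<Omega> by (simp add: sets_restrict_space_iff)

lemma open_sets_M: "open A \<Longrightarrow> A \<subseteq> \<Omega> \<Longrightarrow> A \<in> sets M"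
  by (intro sets_M) auto

text \<open>The integral of \<open>g\<close> vanishes over open sets, by bumps on a compact
  exhaustion, and then over \<open>[g > 0]\<close>, because up to a null set this is a countable
  intersection of open sets.\<close>

lemma fundamental_lemma_nonpos:
  assumes g: "integrable M g" and test: "\<And>\<eta>. test_fun \<Omega> \<eta> \<Longrightarrow> (\<integral>x. g x * \<eta> x \<partial>M) = 0"
  shows "AE x in M. g x \<le> 0"
proof -
  have [measurable]: "g \<in> borel_measurable M" using g by simp
  have opn: "(\<integral>x. g x * indicator A x \<partial>M) = 0" if A: "open A" "A \<subseteq> \<Omega>" for A
  proof -
    have [measurable]: "A \<in> sets M" by (rule open_sets_M[OF A])
    obtain C :: "nat \<Rightarrow> 'n set" where C: "\<And>n. compact (C n)" "\<And>n. C n \<subseteq> A" "incseq C" "\<Union>(range C) = A"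
      using open_compact_exhaustion[OF A(1)] by blast
    have "\<forall>n. \<exists>\<eta>. test_fun A \<eta> \<and> (\<forall>x. 0 \<le> \<eta> x \<and> \<eta> x \<le> 1) \<and> (\<forall>x\<in>C n. \<eta> x = 1)"
      using test_fun_bump[OF C(1) A(1) C(2)] by blast
    from choice[OF this] obtain \<eta> where \<eta>: "\<And>n. test_fun A (\<eta> n)" "\<And>n x. 0 \<le> \<eta> n x" "\<And>n x. \<eta> n x \<le> 1"
      "\<And>n x. x \<in> C n \<Longrightarrow> \<eta> n x = 1" by blast
    have t\<Omega>: "test_fun \<Omega> (\<eta> n)" for n
      using \<eta>(1)[of n] A(2) by (auto simp: test_fun_def supp_in_def)
    have z: "\<eta> n x = 0" if "x \<notin> A" for n x
      using \<eta>(1)[of n] that by (meson subsetD supp_inE test_fun_def)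
    have "(\<lambda>n. \<integral>x. g x * \<eta> n x \<partial>M) \<longlonglongrightarrow> (\<integral>x. g x * indicator A x \<partial>M)"
    proof (rule integral_dominated_convergence[where w = "\<lambda>x. \<bar>g x\<bar>"])
      show "AE x in M. (\<lambda>n. g x * \<eta> n x) \<longlonglongrightarrow> g x * indicator A x"
      proof (intro AE_I2 tendsto_mult tendsto_const)
        fix x
        show "(\<lambda>n. \<eta> n x) \<longlonglongrightarrow> indicator A x"
        proof (cases "x \<in> A")
          case True
          then obtain N where "x \<in> C N" using C(4) by auto
          then have "\<forall>n\<ge>N. x \<in> C n" using incseqD[OF C(3)] by blast
          then have "\<forall>\<^sub>F n in sequentially. \<eta> n x = 1"
            using \<eta>(4) by (auto simp: eventually_sequentially)
          then show ?thesis using True by (simp add: tendsto_eventually)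
        qed (use z in simp)
      qed
      show "AE x in M. norm (g x * \<eta> n x) \<le> \<bar>g x\<bar>" for n
        using \<eta>(2,3)[of n] by (auto simp: abs_mult abs_of_nonneg intro!: mult_left_le)
    qed (use g smooth_measurable[OF test_fun_smooth[OF \<eta>(1)]] in auto)
    then show ?thesis using test[OF t\<Omega>] LIMSEQ_unique[OF _ tendsto_const] by simp
  qed
  define S where "S = {x \<in> \<Omega>. g x > 0}"
  have SM[measurable]: "S \<in> sets M"
    unfolding S_def using measurable_sets[of g M borel "{0<..}"] 
    by (auto simp: vimage_def Int_def conj_commute)
  then have "S \<in> sets lebesgue" using open_\<Omega> by (auto simp: sets_restrict_space_iff)
  then obtain C T where C: "gdelta C" "T \<in> null_sets lebesgue" "S \<union> T = C" "disjnt S T"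
    by (rule lebesgue_set_almost_gdelta)
  obtain F where F: "\<And>n::nat. open (F n)" "C = \<Inter>(F ` UNIV)"
    using C(1) by (auto simp: gdelta.simps)
  \<comment> \<open>Finite intersections turn the open sets into a decreasing sequence inside
    \<Omega>, to which dominated convergence applies.\<close>
  define O' where "O' n = \<Omega> \<inter> (\<Inter>k\<le>n. F k)" for n
  have O': "open (O' n)" "O' n \<subseteq> \<Omega>" for n
    unfolding O'_def using F(1) open_\<Omega> by (auto intro!: open_Int open_INT)
  have [measurable]: "O' n \<in> sets M" for n by (rule open_sets_M[OF O'])
  have ae: "AE x in M. x \<notin> T"
  proof -
    have "AE x in lebesgue. x \<notin> T" using C(2) by (rule AE_not_in)
    then show ?thesis using open_\<Omega> by (subst AE_restrict_space_iff) auto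
  qed
  have "(\<lambda>n. \<integral>x. g x * indicator (O' n) x \<partial>M) \<longlonglongrightarrow> (\<integral>x. g x * indicator S x \<partial>M)"
  proof (rule integral_dominated_convergence[where w = "\<lambda>x. \<bar>g x\<bar>"])
    show "AE x in M. (\<lambda>n. g x * indicator (O' n) x) \<longlonglongrightarrow> g x * indicator S x"
      using ae AE_space
    proof eventually_elim
      case (elim x)
      have x: "x \<in> \<Omega>" using elim by simp
      have "(\<lambda>n. indicator (O' n) x) \<longlonglongrightarrow> (indicator S x :: real)"
      proof (cases "x \<in> S")
        case True
        then have "x \<in> O' n" for n using C(3) F(2) x by (auto simp: O'_def)
        then show ?thesis using True by simp
      next
        case False
        then have "x \<notin> C" using elim C(3) by auto
        then obtain k where "x \<notin> F k" using F(2) by auto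
        then have "\<forall>\<^sub>F n in sequentially. indicator (O' n) x = (0::real)"
          by (intro eventually_sequentiallyI[of k]) (auto simp: O'_def indicator_def)
        then show ?thesis using False by (simp add: tendsto_eventually)
      qed
      then show ?case by (intro tendsto_intros)
    qed
    show "AE x in M. norm (g x * indicator (O' n) x) \<le> \<bar>g x\<bar>" for n
      by (auto simp: indicator_def)
  qed (use g in auto)
  then have "(\<integral>x. g x * indicator S x \<partial>M) = 0"
    using opn[OF O'] LIMSEQ_unique[OF _ tendsto_const] by simp
  moreover have "AE x in M. 0 \<le> g x * indicator S x" by (auto simp: S_def indicator_def)
  moreover have "integrable M (\<lambda>x. g x * indicator S x)"
    by (rule integrable_real_mult_indicator[OF SM g])
  ultimately have "AE x in M. g x * indicator S x = 0"
    using integral_nonneg_eq_0_iff_AE by blast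
  then show ?thesis
    using AE_space by eventually_elim (auto simp: S_def indicator_def split: if_splits)
qed

lemma fundamental_lemma:
  assumes "integrable M g" "\<And>\<eta>. test_fun \<Omega> \<eta> \<Longrightarrow> (\<integral>x. g x * \<eta> x \<partial>M) = 0"
  shows "AE x in M. g x = 0"
proof -
  have "AE x in M. g x \<le> 0" by (rule fundamental_lemma_nonpos[OF assms])
  moreover have "AE x in M. - g x \<le> 0"
    by (rule fundamental_lemma_nonpos) (use assms in auto)
  ultimately show ?thesis by eventually_elim simp
qed

text \<open>The gradient vanishes on level sets: \<open>\<epsilon> P ((f - c) / \<epsilon>)\<close> tends uniformly to \<open>0\<close>, whereas
  its gradient \<open>P' ((f - c) / \<epsilon>) F\<close> tends to \<open>F\<close> on \<open>[f = c]\<close> and to \<open>0\<close> elsewhere.\<close>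

lemma W_gradient_zero_on_level:
  assumes W: "W f F" and c: "c \<noteq> 0"
  shows "AE x in M. f x = c \<longrightarrow> F x = 0"
proof -
  \<comment> \<open>A compactly supported smooth function with slope 1 at 0: rescaled around
    \<open>c\<close>, its derivative at \<open>f\<close> becomes in the limit the indicator of
    \<open>[f = c]\<close>.\<close>
  define P where "P t = t * (1 - step (t * t))" for t :: real
  have sP: "smooth_fun P"
    unfolding P_def by (intro smooth_mult smooth_ident smooth_diff smooth_const smooth_compose[OF smooth_step])
  have P0: "P t = 0" if "\<bar>t\<bar> \<ge> 1" for t
  proof -
    have "1 * 1 \<le> \<bar>t\<bar> * \<bar>t\<bar>" using that by (intro mult_mono) auto
    then show ?thesis by (simp add: P_def)
  qed
  have bP: "bsmooth P" by (rule bsmooth_compact_support[OF sP, of "-1" 1]) (auto intro!: P0)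
  have dP0: "deriv P 0 = 1"
  proof -
    have "((\<lambda>t::real. t * t) has_real_derivative 0) (at 0)" by (auto intro!: derivative_eq_intros)
    from DERIV_chain2[OF smooth_has_real_derivative[OF smooth_step] this]
    have "((\<lambda>t. step (t * t)) has_real_derivative 0) (at 0)" by simp
    from DERIV_mult[OF DERIV_ident DERIV_diff[OF DERIV_const this], of 1]
    have "(P has_real_derivative 1) (at 0)" by (simp add: P_def[abs_def])
    then show ?thesis by (rule DERIV_imp_deriv)
  qed
  have dP1: "deriv P t = 0" if "\<bar>t\<bar> > 1" for t
    by (rule deriv_zero_outside[OF sP, of "-1" 1 0]) (use that P0 in auto)
  obtain B where B: "B > 0" "\<And>t. \<bar>P t\<bar> \<le> B" "\<And>t. \<bar>deriv P t\<bar> \<le> B" by (rule bsmoothE[OF bP]) blast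
  \<comment> \<open>The bound \<open>e n \<le> \<bar>c\<bar>\<close> pushes 0 out of the region
    where the rescaled \<open>P\<close> is nonzero, so that \<open>A n 0 = 0\<close> and compact
    supports survive. This is where \<open>c \<noteq> 0\<close> enters.\<close>
  define e where "e n = \<bar>c\<bar> / real (Suc n)" for n
  have e: "e n > 0" "e n \<le> \<bar>c\<bar>" for n using c by (auto simp: e_def divide_simps)
  have e0: "e \<longlonglongrightarrow> 0" unfolding e_def[abs_def]
    using tendsto_mult_right_zero[OF LIMSEQ_Suc[OF lim_1_over_n], of "\<bar>c\<bar>"] by simp
  define A where "A n t = e n * P ((1 / e n) * t + (- c / e n))" for n t
  have bA: "bsmooth (A n)" for n
    unfolding A_def by (intro bsmooth_mult bsmooth_const bsmooth_affine bP)
  have A0: "A n 0 = 0" for n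
    unfolding A_def using e[of n] by (intro mult_eq_0_iff[THEN iffD2] disjI2 P0) (auto simp: divide_simps)
  have dA: "deriv (A n) t = deriv P ((1 / e n) * t + (- c / e n))" for n t
    unfolding A_def deriv_mult_smooth[OF smooth_const smooth_compose[OF sP smooth_affine]]
      deriv_affine_smooth[OF sP] using e(1)[of n] by simp
  have [measurable]: "f \<in> borel_measurable M" using WD(1)[OF W] by (simp add: Lmem_def)
  have cP[measurable]: "deriv P \<in> borel_measurable borel" "P \<in> borel_measurable borel"
    by (intro borel_measurable_continuous_onI smooth_continuous smooth_deriv sP)+
  have "AE x in M. (F x \<bullet> i) * indicator {x. f x = c} x = 0" if i: "i \<in> Basis" for i
  proof (rule fundamental_lemma)
    have Fi: "integrable M (\<lambda>x. F x \<bullet> i)"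
      using Lmem_integrable[OF finite_M WD(2)[OF W i]] p[OF i] by simp
    then have [measurable]: "(\<lambda>x. F x \<bullet> i) \<in> borel_measurable M" by simp
    show "integrable M (\<lambda>x. F x \<bullet> i * indicator {x. f x = c} x)"
      by (rule Bochner_Integration.integrable_bound[OF Fi]) (auto simp: indicator_def)
    fix \<eta> assume \<eta>: "test_fun \<Omega> \<eta>"
    obtain C where C: "\<And>x. \<bar>\<eta> x\<bar> \<le> C" using test_fun_bounded[OF \<eta>] by blast
    obtain D where D: "\<And>x. \<bar>pder \<eta> i x\<bar> \<le> D" using test_fun_bounded[OF test_fun_pder[OF \<eta> i]] by blast
    have [measurable]: "\<eta> \<in> borel_measurable M" "pder \<eta> i \<in> borel_measurable M"
      by (intro smooth_measurable test_fun_smooth[of \<Omega>] \<eta> test_fun_pder i)+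
    have 1: "(\<lambda>n. \<integral>x. (deriv (A n) (f x) *\<^sub>R F x) \<bullet> i * \<eta> x \<partial>M)
       \<longlonglongrightarrow> (\<integral>x. F x \<bullet> i * indicator {x. f x = c} x * \<eta> x \<partial>M)"
    proof (rule integral_dominated_convergence[where w = "\<lambda>x. B * \<bar>F x \<bullet> i\<bar> * C"])
      show "AE x in M. (\<lambda>n. (deriv (A n) (f x) *\<^sub>R F x) \<bullet> i * \<eta> x)
         \<longlonglongrightarrow> F x \<bullet> i * indicator {x. f x = c} x * \<eta> x"
      proof (intro AE_I2)
        fix x
        have "(\<lambda>n. deriv (A n) (f x)) \<longlonglongrightarrow> indicator {x. f x = c} x"
        proof (cases "f x = c")
          case True
          then show ?thesis using e by (simp add: dA dP0)
        next
          case False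
          have "\<forall>\<^sub>F n in sequentially. e n < \<bar>f x - c\<bar>"
            using order_tendstoD(2)[OF e0] False by simp
          then have "\<forall>\<^sub>F n in sequentially. deriv (A n) (f x) = 0"
          proof eventually_elim
            case (elim n)
            have "(1 / e n) * f x + (- c / e n) = (f x - c) / e n" by (simp add: diff_divide_distrib)
            moreover have "\<bar>(f x - c) / e n\<bar> > 1" using elim e(1)[of n] by simp
            ultimately show ?case unfolding dA by (simp add: dP1)
          qed
          then show ?thesis using False by (simp add: tendsto_eventually)
        qed
        from tendsto_mult[OF tendsto_mult[OF this tendsto_const[of "F x \<bullet> i"]] tendsto_const[of "\<eta> x"]]
        show "(\<lambda>n. (deriv (A n) (f x) *\<^sub>R F x) \<bullet> i * \<eta> x)
           \<longlonglongrightarrow> F x \<bullet> i * indicator {x. f x = c} x * \<eta> x" by (simp add: ac_simps)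
      qed
      show "AE x in M. norm ((deriv (A n) (f x) *\<^sub>R F x) \<bullet> i * \<eta> x) \<le> B * \<bar>F x \<bullet> i\<bar> * C" for n
      proof (intro AE_I2)
        fix x
        show "norm ((deriv (A n) (f x) *\<^sub>R F x) \<bullet> i * \<eta> x) \<le> B * \<bar>F x \<bullet> i\<bar> * C"
          unfolding dA inner_scaleR_left real_norm_def abs_mult
          by (intro mult_mono B C) (use B(1) in auto)
      qed
    qed (use Fi in \<open>auto simp: dA\<close>)
    have 2: "(\<lambda>n. \<integral>x. A n (f x) * pder \<eta> i x \<partial>M) \<longlonglongrightarrow> (\<integral>x. 0 \<partial>M)"
    proof (rule integral_dominated_convergence[where w = "\<lambda>x. \<bar>c\<bar> * B * D"])
      have b: "\<bar>A n t\<bar> \<le> e n * B" for n t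
        unfolding A_def abs_mult using e(1)[of n] B(2) by (auto intro!: mult_mono)
      show "AE x in M. (\<lambda>n. A n (f x) * pder \<eta> i x) \<longlonglongrightarrow> 0"
      proof (intro AE_I2 tendsto_mult_left_zero)
        fix x
        show "(\<lambda>n. A n (f x)) \<longlonglongrightarrow> 0"
          by (rule tendsto_0_le[OF e0, where K = B])
            (use b e in \<open>auto simp: abs_of_pos\<close>)
      qed
      show "AE x in M. norm (A n (f x) * pder \<eta> i x) \<le> \<bar>c\<bar> * B * D" for n
      proof (intro AE_I2)
        fix x
        have "\<bar>A n (f x)\<bar> \<le> \<bar>c\<bar> * B"
          using b[of n "f x"] mult_right_mono[OF e(2)[of n], of B] B(1) by linarith
        then show "norm (A n (f x) * pder \<eta> i x) \<le> \<bar>c\<bar> * B * D"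
          unfolding real_norm_def abs_mult using B(1) by (intro mult_mono D) auto
      qed
    qed (auto simp: A_def finite_measure.integrable_const[OF finite_M])
    have "(\<integral>x. (deriv (A n) (f x) *\<^sub>R F x) \<bullet> i * \<eta> x \<partial>M) = - (\<integral>x. A n (f x) * pder \<eta> i x \<partial>M)" for n
      by (rule W_integration_by_parts[OF W_compose[OF W bA A0] \<eta> i])
    then have "(\<lambda>n. \<integral>x. (deriv (A n) (f x) *\<^sub>R F x) \<bullet> i * \<eta> x \<partial>M) \<longlonglongrightarrow> - 0"
      using tendsto_minus[OF 2] by simp
    with 1 show "(\<integral>x. F x \<bullet> i * indicator {x. f x = c} x * \<eta> x \<partial>M) = 0"
      using LIMSEQ_unique by fastforce
  qed
  then have "AE x in M. \<forall>i\<in>Basis. (F x \<bullet> i) * indicator {x. f x = c} x = 0"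
    by (intro AE_finite_allI) auto
  then show ?thesis
    by eventually_elim (auto intro!: euclidean_eqI[where 'a = 'n])
qed

end

subsection \<open>Capacity and energy\<close>

lemma powr_midpoint_le:
  assumes p: "p > 1"
  shows "\<bar>(a + b) / 2\<bar> powr p \<le> (\<bar>a\<bar> powr p + \<bar>b\<bar> powr p) / (2::real)"
proof -
  have main: "\<bar>(a + b) / 2\<bar> powr p \<le> (\<bar>a\<bar> powr p + \<bar>b\<bar> powr p) / 2" if ab: "\<bar>b\<bar> \<le> \<bar>a\<bar>" for a b :: real
  proof (cases "a = 0")
    case False
    define t where "t = b / a"
    have b: "b = a * t" using False by (simp add: t_def)
    have "\<bar>t\<bar> \<le> 1" using ab False by (simp add: t_def)
    then have "- 1 \<le> t" "t \<le> 1" by auto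
    then have t: "\<bar>(1 + t) / 2\<bar> powr p \<le> (1 + \<bar>t\<bar> powr p) / 2"
      using powr_midpoint_strict[OF p, of t] by (cases "t = 1") auto
    have "\<bar>(a + b) / 2\<bar> = \<bar>a\<bar> * \<bar>(1 + t) / 2\<bar>"
      unfolding b abs_mult[symmetric] by (simp add: algebra_simps)
    then have "\<bar>(a + b) / 2\<bar> powr p = \<bar>a\<bar> powr p * \<bar>(1 + t) / 2\<bar> powr p"
      using powr_mult[of "\<bar>a\<bar>" "\<bar>(1 + t) / 2\<bar>" p] by simp
    also have "\<dots> \<le> \<bar>a\<bar> powr p * ((1 + \<bar>t\<bar> powr p) / 2)" by (intro mult_left_mono t) auto
    also have "\<dots> = (\<bar>a\<bar> powr p + \<bar>b\<bar> powr p) / 2"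
      unfolding b by (simp add: abs_mult powr_mult field_simps)
    finally show ?thesis .
  qed (use ab in simp)
  show ?thesis using main[of a b] main[of b a] by (cases "\<bar>b\<bar> \<le> \<bar>a\<bar>") (auto simp: add.commute)
qed

lemma pint_midpoint_le:
  assumes p: "p > 1" and f: "Lmem M p f" and g: "Lmem M p g"
  shows "pint M p (\<lambda>x. (1/2) * f x + (1/2) * g x) \<le> (pint M p f + pint M p g) / 2"
proof -
  have h: "Lmem M p (\<lambda>x. (1/2) * f x + (1/2) * g x)"
    using p by (intro Lmem_add Lmem_cmult f g) auto
  have "pint M p (\<lambda>x. (1/2) * f x + (1/2) * g x) \<le> (\<integral>x. (\<bar>f x\<bar> powr p + \<bar>g x\<bar> powr p) / 2 \<partial>M)"
  proof (rule integral_mono)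
    show "\<bar>1 / 2 * f x + 1 / 2 * g x\<bar> powr p \<le> (\<bar>f x\<bar> powr p + \<bar>g x\<bar> powr p) / 2" for x
      using powr_midpoint_le[OF p, of "f x" "g x"] by (simp add: add_divide_distrib)
  qed (use f g h in \<open>auto simp: Lmem_def\<close>)
  also have "\<dots> = (pint M p f + pint M p g) / 2" using f g by (simp add: Lmem_def)
  finally show ?thesis .
qed

lemma pint_uniformly_convex:
  assumes p: "p > 1" and e: "e > 0"
  shows "\<exists>C\<ge>0. \<forall>f g. Lmem M p f \<longrightarrow> Lmem M p g \<longrightarrow> pint M p (\<lambda>x. f x - g x) \<le> e * (pint M p f + pint M p g)
    + C * ((pint M p f + pint M p g) / 2 - pint M p (\<lambda>x. (1/2) * f x + (1/2) * g x))"
proof -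
  obtain C where C: "C \<ge> 0" "\<And>a b::real. \<bar>a - b\<bar> powr p \<le> e * (\<bar>a\<bar> powr p + \<bar>b\<bar> powr p)
           + C * ((\<bar>a\<bar> powr p + \<bar>b\<bar> powr p) / 2 - \<bar>(a + b) / 2\<bar> powr p)"
    using powr_uniformly_convex[OF p e] by blast
  have "pint M p (\<lambda>x. f x - g x) \<le> e * (pint M p f + pint M p g)
    + C * ((pint M p f + pint M p g) / 2 - pint M p (\<lambda>x. (1/2) * f x + (1/2) * g x))"
    if f: "Lmem M p f" and g: "Lmem M p g" for f g
  proof -
    have h: "Lmem M p (\<lambda>x. (1/2) * f x + (1/2) * g x)"
      using p by (intro Lmem_add Lmem_cmult f g) auto
    have d: "Lmem M p (\<lambda>x. f x - g x)" using p by (intro Lmem_diff f g) auto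
    have "pint M p (\<lambda>x. f x - g x) \<le> (\<integral>x. e * (\<bar>f x\<bar> powr p + \<bar>g x\<bar> powr p)
      + C * ((\<bar>f x\<bar> powr p + \<bar>g x\<bar> powr p) / 2 - \<bar>(1/2) * f x + (1/2) * g x\<bar> powr p) \<partial>M)"
    proof (rule integral_mono)
      show "\<bar>f x - g x\<bar> powr p \<le> e * (\<bar>f x\<bar> powr p + \<bar>g x\<bar> powr p)
        + C * ((\<bar>f x\<bar> powr p + \<bar>g x\<bar> powr p) / 2 - \<bar>1 / 2 * f x + 1 / 2 * g x\<bar> powr p)" for x
        using C(2)[of "f x" "g x"] by (simp add: add_divide_distrib)
    qed (use f g h d in \<open>auto simp: Lmem_def\<close>)
    also have "\<dots> = e * (pint M p f + pint M p g)
      + C * ((pint M p f + pint M p g) / 2 - pint M p (\<lambda>x. (1/2) * f x + (1/2) * g x))"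
      using f g h by (simp add: Lmem_def)
    finally show ?thesis .
  qed
  then show ?thesis using C(1) by blast
qed

text \<open>The midpoint defect is bounded by a null sequence in the smaller index; uniform
  convexity turns this into the Cauchy property.\<close>

lemma uniformly_convex_convergent:
  assumes fin: "finite_measure M" and p: "p > 1" and f: "\<And>n. Lmem M p (f n)"
    and R: "\<And>n. pint M p (f n) \<le> R"
    and d: "d \<longlonglongrightarrow> 0" "\<And>n m. n \<le> m \<Longrightarrow>
      (pint M p (f n) + pint M p (f m)) / 2 - pint M p (\<lambda>x. (1/2) * f n x + (1/2) * f m x) \<le> d n"
  shows "\<exists>g. Lmem M p g \<and> Lconv M p f g"
proof (rule Lp_complete[OF fin _ f])
  show "1 \<le> p" using p by simp
  fix e :: real assume e: "e > 0"
  have R0: "R \<ge> 0" by (rule order_trans[OF pint_nonneg R[of 0]])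
  \<comment> \<open>The coefficient in the uniform convexity estimate is chosen with
    \<open>a * (2 * R) < e / 2\<close>, since both powers are at most \<open>R\<close>;
    \<open>R + 1\<close> avoids division by 0.\<close>
  define a where "a = e / (4 * (R + 1))"
  have a: "a > 0" using e R0 by (simp add: a_def)
  have a2: "a * (2 * R) < e / 2"
  proof -
    have "a * (2 * R) < a * (2 * (R + 1))" using a by (intro mult_strict_left_mono) auto
    also have "\<dots> = e / 2" using R0 by (simp add: a_def field_simps)
    finally show ?thesis .
  qed
  obtain C where C: "C \<ge> 0" "\<And>f g. Lmem M p f \<Longrightarrow> Lmem M p g \<Longrightarrow> pint M p (\<lambda>x. f x - g x) \<le> a * (pint M p f + pint M p g)
    + C * ((pint M p f + pint M p g) / 2 - pint M p (\<lambda>x. (1/2) * f x + (1/2) * g x))"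
    using pint_uniformly_convex[OF p a, where M = M] by blast
  have "(\<lambda>n. C * d n) \<longlonglongrightarrow> 0" by (intro tendsto_mult_right_zero d)
  then have "\<forall>\<^sub>F n in sequentially. C * d n < e / 2" by (rule order_tendstoD) (use e in auto)
  then obtain N where N: "\<And>n. n \<ge> N \<Longrightarrow> C * d n < e / 2" by (auto simp: eventually_sequentially)
  have le: "pint M p (\<lambda>x. f n x - f m x) < e" if "N \<le> n" "n \<le> m" for n m
  proof -
    have "pint M p (\<lambda>x. f n x - f m x) \<le> a * (pint M p (f n) + pint M p (f m))
      + C * ((pint M p (f n) + pint M p (f m)) / 2 - pint M p (\<lambda>x. (1/2) * f n x + (1/2) * f m x))"
      by (rule C(2)[OF f f])
    also have "\<dots> \<le> a * (2 * R) + C * d n"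
      using R[of n] R[of m] a C(1) d(2)[OF that(2)] by (intro add_mono mult_left_mono) auto
    finally show ?thesis using a2 N[OF that(1)] by linarith
  qed
  have "pint M p (\<lambda>x. f m x - f n x) < e" if "N \<le> n" "N \<le> m" for n m
    using le[of n m] le[of m n] that pint_uminus[where M = M and p = p and f = "f m" and g = "f n"] by (cases "n \<le> m") auto
  then show "\<exists>N. \<forall>m\<ge>N. \<forall>n\<ge>N. pint M p (\<lambda>x. f m x - f n x) < e" by blast
qed

section \<open>Comparison of the capacity of open sets with energies\<close>

context anisotropic begin

definition energy :: "('n \<Rightarrow> 'n) \<Rightarrow> real" where
  "energy F = (\<Sum>i\<in>Basis. pint M (p i) (\<lambda>x. F x \<bullet> i))"

lemma energy_nonneg: "energy F \<ge> 0"
  by (simp add: energy_def sum_nonneg)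

text \<open>The a.e. counterpart of a competitor in the capacity. The set is arbitrary; below it can
  be \<open>V - U\<close> or \<open>{x. f x \<notin> S}\<close>, neither of which need be
  open.\<close>

definition potential :: "'n set \<Rightarrow> ('n \<Rightarrow> real) \<Rightarrow> ('n \<Rightarrow> 'n) \<Rightarrow> bool" where
  "potential V \<phi> \<Phi> \<longleftrightarrow> W \<phi> \<Phi> \<and> (AE x in M. 0 \<le> \<phi> x) \<and> (AE x in M. x \<in> V \<longrightarrow> 1 \<le> \<phi> x)"

lemma pint_le_energy: "i \<in> Basis \<Longrightarrow> pint M (p i) (\<lambda>x. F x \<bullet> i) \<le> energy F"
  unfolding energy_def by (rule member_le_sum) auto

text \<open>If \<open>\<phi>\<^sub>j\<close> are test functions tending to \<open>\<phi>\<close> and \<open>\<eta>\<close> is a bump, \<open>\<phi>\<^sub>j + S (\<eta> - \<phi>\<^sub>j)\<close> is almost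
  at least \<open>1\<close> on the compact set, and the correction disappears in the limit since \<open>\<eta> \<le> \<phi>\<close> a.e.\<close>

lemma cap_open_le_energy:
  "\<exists>C\<ge>0. \<forall>V \<phi> \<Phi>. open V \<longrightarrow> V \<subseteq> \<Omega> \<longrightarrow> potential V \<phi> \<Phi> \<longrightarrow>
     cap_open \<Omega> p0 p V \<le> ereal (C * energy \<Phi>)"
proof -
  obtain B where B: "B > 0" "\<And>t. \<bar>deriv step t\<bar> \<le> B" using deriv_step_bounded by blast
  \<comment> \<open>A smooth substitute for the positive part: it vanishes for t \<le> 0, has
    bounded derivative and loses at most 1/2. Thus \<open>f n + S (\<eta> - f n)\<close> is at least
    1/2 on \<open>K\<close>, and \<open>Q\<close> lifts 1/2 to 1 without becoming negative
    elsewhere.\<close>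
  define S where "S t = t * step (2 * t + 0)" for t
  define Q where "Q t = step (2 * t + 0)" for t
  have sQ: "smooth_fun Q" unfolding Q_def by (intro smooth_compose[OF smooth_step] smooth_affine)
  have sS: "smooth_fun S" unfolding S_def by (intro smooth_mult smooth_ident smooth_compose[OF smooth_step] smooth_affine)
  have dQ: "deriv Q t = 2 * deriv step (2 * t)" for t
    unfolding Q_def deriv_affine_smooth[OF smooth_step] by simp
  have dS: "deriv S t = step (2 * t) + (2 * t) * deriv step (2 * t)" for t
    unfolding S_def deriv_mult_smooth[OF smooth_ident smooth_compose[OF smooth_step smooth_affine]]
      deriv_affine_smooth[OF smooth_step] by simp
  have dS0: "deriv S t = 0" if "t \<le> 0" for t using that by (simp add: dS deriv_step_zero)
  have dSB: "\<bar>deriv S t\<bar> \<le> 1 + B" for t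
  proof -
    have "\<bar>(2 * t) * deriv step (2 * t)\<bar> \<le> B"
    proof (cases "0 \<le> 2 * t \<and> 2 * t \<le> 1")
      case True
      then have "\<bar>2 * t\<bar> * \<bar>deriv step (2 * t)\<bar> \<le> 1 * B" by (intro mult_mono B) (use B(1) in auto)
      then show ?thesis by (simp add: abs_mult)
    next
      case False
      then have "deriv step (2 * t) = 0" by (intro deriv_step_zero) auto
      then show ?thesis using B(1) by simp
    qed
    then show ?thesis unfolding dS using step_nonneg[of "2 * t"] step_le_1[of "2 * t"] by linarith
  qed
  have S_ge: "S t \<ge> t - 1/2" for t
  proof -
    consider "t \<le> 0" | "0 < t" "t < 1/2" | "t \<ge> 1/2" by linarith
    then show ?thesis by cases (auto simp: S_def intro: order_trans[where y = 0])
  qed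
  have S0: "S 0 = 0" by (simp add: S_def)
  \<comment> \<open>\<open>(2 * B) powr p i\<close> comes from the derivative of \<open>Q\<close>,
    and \<open>2 powr p i\<close> from splitting the gradient of \<open>g n\<close> into that of
    \<open>f n\<close> and the correction. The further \<open>2 powr p i\<close> in \<open>C\<close>
    pays for replacing the gradient of \<open>f n\<close> by its limit.\<close>
  define K1 where "K1 i = (2 * B) powr p i * 2 powr p i" for i
  define C where "C = (\<Sum>i\<in>Basis. K1 i * 2 powr p i)"
  have K1: "K1 i \<ge> 0" for i by (simp add: K1_def)
  have C0: "C \<ge> 0" by (simp add: C_def K1 sum_nonneg)
  have "cap_compact \<Omega> p0 p K \<le> ereal (C * energy \<Phi>)"
    if V: "open V" "V \<subseteq> \<Omega>" and W: "W \<phi> \<Phi>" and ae: "AE x in M. 0 \<le> \<phi> x" "AE x in M. x \<in> V \<longrightarrow> 1 \<le> \<phi> x"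
      and K: "compact K" "K \<subseteq> V" for V \<phi> \<Phi> K
  proof -
    obtain \<eta> where \<eta>: "test_fun V \<eta>" "\<And>x. 0 \<le> \<eta> x" "\<And>x. \<eta> x \<le> 1" "\<And>x. x \<in> K \<Longrightarrow> \<eta> x = 1"
      using test_fun_bump[OF K(1) V(1) K(2)] by blast
    have \<eta>\<Omega>: "test_fun \<Omega> \<eta>" using \<eta>(1) V(2) by (auto simp: test_fun_def supp_in_def)
    have \<eta>0: "\<eta> x = 0" if "x \<notin> V" for x
      using \<eta>(1) that by (meson subsetD supp_inE test_fun_def)
    obtain f where f: "approx f \<phi> \<Phi>" "AE x in M. (\<lambda>n. f n x) \<longlonglongrightarrow> \<phi> x" by (rule W_approx_AE[OF W])
    note t = approx_test_fun[OF f(1)]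
    define g where "g n x = f n x + S (\<eta> x - f n x)" for n x
    have td: "test_fun \<Omega> (\<lambda>x. \<eta> x - f n x)" for n
      using test_fun_add[OF \<eta>\<Omega> test_fun_cmult[OF t, of "-1"]] by simp
    have tg: "test_fun \<Omega> (g n)" for n
      unfolding g_def by (intro test_fun_add t test_fun_compose[OF td sS S0])
    define q where "q n x = Q (g n x)" for n x
    have tq: "test_fun \<Omega> (q n)" for n
      unfolding q_def by (intro test_fun_compose[OF tg sQ]) (simp add: Q_def)
    have q1: "indicator K x \<le> q n x" for n x
    proof (cases "x \<in> K")
      case True
      then have "g n x \<ge> 1/2" using S_ge[of "\<eta> x - f n x"] \<eta>(4) by (simp add: g_def)
      then show ?thesis using True by (simp add: q_def Q_def)
    qed (simp add: q_def Q_def)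
    have cap_le: "cap_compact \<Omega> p0 p K \<le> ereal (\<Sum>i\<in>Basis. pint M (p i) (pder (q n) i))" for n
    proof -
      have "cap_compact \<Omega> p0 p K \<le> ereal (\<Sum>i\<in>Basis. pint M (p i) (\<lambda>x. (\<Sum>i\<in>Basis. pder (q n) i x *\<^sub>R i) \<bullet> i))"
        unfolding cap_compact_def
        using W_test_fun[OF tq[of n]] q1 smooth_continuous[OF test_fun_smooth[OF tq[of n]]]
        by (intro Inf_lower CollectI exI[of _ "q n"] exI[of _ "\<lambda>x. (\<Sum>i\<in>Basis. pder (q n) i x *\<^sub>R i)"]) auto
      also have "(\<Sum>i\<in>Basis. pint M (p i) (\<lambda>x. (\<Sum>i\<in>Basis. pder (q n) i x *\<^sub>R i) \<bullet> i))
          = (\<Sum>i\<in>Basis. pint M (p i) (pder (q n) i))" by (intro sum.cong refl) simp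
      finally show ?thesis .
    qed
    let ?r = "\<lambda>n i x. deriv S (\<eta> x - f n x) * (pder \<eta> i x - pder (f n) i x)"
    have pd: "pder (q n) i x = deriv Q (g n x) * (pder (f n) i x + ?r n i x)" for n i x
    proof -
      note sf = t[THEN test_fun_smooth, of n] and s\<eta> = \<eta>\<Omega>[THEN test_fun_smooth]
      note sd = smooth_diff[OF s\<eta> sf]
      note sSd = smooth_compose[OF sS sd]
      show ?thesis
        unfolding q_def g_def pder_compose[OF sQ smooth_add[OF sf sSd]] pder_add[OF sf sSd]
          pder_compose[OF sS sd] pder_diff[OF s\<eta> sf] ..
    qed
    have m[measurable]: "f n \<in> borel_measurable M" "\<eta> \<in> borel_measurable M" "g n \<in> borel_measurable M"
      "\<phi> \<in> borel_measurable M" for n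
      using WD(1)[OF W] by (auto intro!: smooth_measurable test_fun_smooth[of \<Omega>] t \<eta>\<Omega> tg simp: Lmem_def)
    have md[measurable]: "deriv S \<in> borel_measurable borel" "deriv Q \<in> borel_measurable borel"
      by (intro borel_measurable_continuous_onI smooth_continuous smooth_deriv sS sQ)+
    have r0: "(\<lambda>n. pint M (p i) (?r n i)) \<longlonglongrightarrow> 0" if i: "i \<in> Basis" for i
    proof -
      have L: "Lconv M (p i) (\<lambda>n. ?r n i) (\<lambda>x. deriv S (\<eta> x - \<phi> x) * (pder \<eta> i x - \<Phi> x \<bullet> i))"
      proof (rule Lconv_mult_bounded[where B = "1 + B"])
        show "AE x in M. (\<lambda>n. deriv S (\<eta> x - f n x)) \<longlonglongrightarrow> deriv S (\<eta> x - \<phi> x)"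
          using f(2)
        proof eventually_elim
          case (elim x)
          have "isCont (deriv S) (\<eta> x - \<phi> x)"
            using smooth_continuous[OF smooth_deriv[OF sS], of UNIV] by (simp add: continuous_on_eq_continuous_at)
          then show ?case by (rule isCont_tendsto_compose) (intro tendsto_intros elim)
        qed
        have "Lconv M (p i) (\<lambda>n x. (\<lambda>_. pder \<eta> i) n x + (-1) * pder (f n) i x) (\<lambda>x. pder \<eta> i x + (-1) * (\<Phi> x \<bullet> i))"
          using f(1) i p_pos[OF i] WD(2)[OF W i]
          by (intro Lconv_add Lconv_const Lconv_cmult Lmem_cmult Lmem_test_fun[OF test_fun_pder] t \<eta>\<Omega>)
            (auto simp: approx_def)
        then show "Lconv M (p i) (\<lambda>n x. pder \<eta> i x - pder (f n) i x) (\<lambda>x. pder \<eta> i x - \<Phi> x \<bullet> i)" by simp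
        show "Lmem M (p i) (\<lambda>x. pder \<eta> i x - pder (f n) i x)" for n
          using p_pos[OF i] i by (intro Lmem_diff Lmem_test_fun test_fun_pder t \<eta>\<Omega>) auto
        show "Lmem M (p i) (\<lambda>x. pder \<eta> i x - \<Phi> x \<bullet> i)"
          using p_pos[OF i] i by (intro Lmem_diff Lmem_test_fun[OF test_fun_pder] WD(2)[OF W] \<eta>\<Omega>) auto
      qed (use dSB p_pos[OF i] in auto)
      have "pint M (p i) (\<lambda>x. ?r n i x - deriv S (\<eta> x - \<phi> x) * (pder \<eta> i x - \<Phi> x \<bullet> i)) = pint M (p i) (?r n i)" for n
      proof (rule integral_cong_AE)
        show "AE x in M. \<bar>?r n i x - deriv S (\<eta> x - \<phi> x) * (pder \<eta> i x - \<Phi> x \<bullet> i)\<bar> powr p i = \<bar>?r n i x\<bar> powr p i"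
          using ae
        proof eventually_elim
          case (elim x)
          have "\<eta> x - \<phi> x \<le> 0" using elim \<eta>0[of x] \<eta>(3)[of x] by (cases "x \<in> V") auto
          then show ?case by (simp add: dS0)
        qed
        have [measurable]: "pder \<eta> i \<in> borel_measurable M" "pder (f n) i \<in> borel_measurable M"
          "(\<lambda>x. \<Phi> x \<bullet> i) \<in> borel_measurable M"
          using WD(2)[OF W i] by (auto intro!: smooth_measurable test_fun_smooth[of \<Omega>] test_fun_pder t \<eta>\<Omega> i simp: Lmem_def)
        show "(\<lambda>x. \<bar>?r n i x - deriv S (\<eta> x - \<phi> x) * (pder \<eta> i x - \<Phi> x \<bullet> i)\<bar> powr p i) \<in> borel_measurable M"
          "(\<lambda>x. \<bar>?r n i x\<bar> powr p i) \<in> borel_measurable M" by measurable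
      qed
      then show ?thesis using L by (simp add: Lconv_def)
    qed
    have bound: "cap_compact \<Omega> p0 p K \<le> ereal (C * energy \<Phi> + e)" if e: "e > 0" for e
    proof -
      define e' where "e' = e / (2 * ((\<Sum>i\<in>Basis. K1 i) + 1))"
      have sK: "(\<Sum>i\<in>Basis. K1 i) \<ge> 0" by (simp add: K1 sum_nonneg)
      then have e': "e' > 0" using e by (simp add: e'_def)
      have e'e: "(\<Sum>i\<in>Basis. K1 i) * (2 * e') \<le> e"
      proof -
        have "(\<Sum>i\<in>Basis. K1 i) * (2 * e') \<le> ((\<Sum>i\<in>Basis. K1 i) + 1) * (2 * e')"
          using e' by (intro mult_right_mono) auto
        also have "\<dots> = e" using sK by (simp add: e'_def field_simps)
        finally show ?thesis .
      qed
      have "\<forall>\<^sub>F n in sequentially. \<forall>i\<in>Basis. pint M (p i) (pder (f n) i) \<le> 2 powr p i * pint M (p i) (\<lambda>x. \<Phi> x \<bullet> i) + e'"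
        using f(1) p_pos WD(2)[OF W] e' t
        by (intro eventually_ball_finite ballI Lconv_pint_le)
          (auto simp: approx_def intro!: Lmem_test_fun test_fun_pder less_imp_le)
      moreover have "\<forall>\<^sub>F n in sequentially. \<forall>i\<in>Basis. pint M (p i) (?r n i) < e'"
        using r0 e' by (intro eventually_ball_finite ballI order_tendstoD(2)[where y = 0]) auto
      ultimately have "\<forall>\<^sub>F n in sequentially. \<forall>i\<in>Basis. pint M (p i) (pder (f n) i) \<le> 2 powr p i * pint M (p i) (\<lambda>x. \<Phi> x \<bullet> i) + e'
          \<and> pint M (p i) (?r n i) < e'" by eventually_elim blast
      then obtain n where n: "\<And>i. i \<in> Basis \<Longrightarrow> pint M (p i) (pder (f n) i) \<le> 2 powr p i * pint M (p i) (\<lambda>x. \<Phi> x \<bullet> i) + e'"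
        "\<And>i. i \<in> Basis \<Longrightarrow> pint M (p i) (?r n i) < e'"
        using eventually_happens'[OF sequentially_bot] by blast
      have "(\<Sum>i\<in>Basis. pint M (p i) (pder (q n) i)) \<le> (\<Sum>i\<in>Basis. K1 i * (2 powr p i * energy \<Phi> + 2 * e'))"
      proof (rule sum_mono)
        fix i :: 'n assume i: "i \<in> Basis"
        have L1: "Lmem M (p i) (pder (f n) i)"
          using p_pos[OF i] i by (intro Lmem_test_fun test_fun_pder t) auto
        have L2: "Lmem M (p i) (?r n i)"
          using p_pos[OF i] i dSB
          by (intro Lmem_mult_bounded[where B = "1 + B"] Lmem_diff Lmem_test_fun test_fun_pder t \<eta>\<Omega>) auto
        have "pint M (p i) (pder (q n) i) \<le> (2 * B) powr p i * pint M (p i) (\<lambda>x. pder (f n) i x + ?r n i x)"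
          unfolding pd[abs_def]
        proof (intro pint_mult_bounded_le Lmem_add L1 L2)
          show "(\<lambda>x. deriv Q (g n x)) \<in> borel_measurable M" by measurable
          show "AE x in M. \<bar>deriv Q (g n x)\<bar> \<le> 2 * B" using B(2) by (auto simp: dQ abs_mult)
        qed (use p_pos[OF i] in auto)
        also have "\<dots> \<le> (2 * B) powr p i * (2 powr p i * (pint M (p i) (pder (f n) i) + pint M (p i) (?r n i)))"
          using p_pos[OF i] by (intro mult_left_mono pint_add_le L1 L2) auto
        also have "\<dots> = K1 i * (pint M (p i) (pder (f n) i) + pint M (p i) (?r n i))" by (simp add: K1_def)
        also have "\<dots> \<le> K1 i * (2 powr p i * energy \<Phi> + 2 * e')"
        proof (intro mult_left_mono K1)
          have "2 powr p i * pint M (p i) (\<lambda>x. \<Phi> x \<bullet> i) \<le> 2 powr p i * energy \<Phi>"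
            by (intro mult_left_mono pint_le_energy i) auto
          then show "pint M (p i) (pder (f n) i) + pint M (p i) (?r n i) \<le> 2 powr p i * energy \<Phi> + 2 * e'"
            using n[OF i] by linarith
        qed
        finally show "pint M (p i) (pder (q n) i) \<le> K1 i * (2 powr p i * energy \<Phi> + 2 * e')" .
      qed
      also have "\<dots> = C * energy \<Phi> + (\<Sum>i\<in>Basis. K1 i) * (2 * e')"
        by (simp add: C_def distrib_left sum.distrib sum_distrib_right mult.assoc)
      also have "\<dots> \<le> C * energy \<Phi> + e" using e'e by simp
      finally show ?thesis using cap_le[of n] by (meson ereal_less_eq(3) order_trans)
    qed
    show ?thesis
      by (rule ereal_le_epsilon2) (use bound in \<open>auto\<close>)
  qed
  then have "cap_open \<Omega> p0 p V \<le> ereal (C * energy \<Phi>)"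
    if "open V" "V \<subseteq> \<Omega>" "W \<phi> \<Phi>" "AE x in M. 0 \<le> \<phi> x" "AE x in M. x \<in> V \<longrightarrow> 1 \<le> \<phi> x" for V \<phi> \<Phi>
    unfolding cap_open_def using that by (intro Sup_least) auto
  then show ?thesis using C0 unfolding potential_def by blast
qed

text \<open>Near-minimisers of a strictly convex functional over the convex classes belonging to a compact
  exhaustion form a Cauchy sequence, by uniform convexity. The lower order term \<open>\<kappa> * \<integral> \<bar>f\<bar> powr p0\<close>
  is there because the \<open>p0\<close>-norm need not be controlled by the energy.\<close>

lemma cap_open_potential:
  "\<exists>C\<ge>0. \<forall>U e. open U \<longrightarrow> U \<subseteq> \<Omega> \<longrightarrow> e > 0 \<longrightarrow> cap_open \<Omega> p0 p U < ereal e \<longrightarrow>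
    (\<exists>\<phi> \<Phi>. potential U \<phi> \<Phi> \<and> energy \<Phi> \<le> C * e)"
proof -
  obtain B where B: "B > 0" "\<And>t. \<bar>deriv step t\<bar> \<le> B" using deriv_step_bounded by blast
  \<comment> \<open>The powers of \<open>B\<close> come from composing a capacity competitor with
    \<open>step\<close>; the summand 1 covers the lower order term, which the choice of \<kappa>
    keeps at most \<open>e\<close>. The extra sum in \<open>C\<close> pays for passing to the limit
    of the gradients.\<close>
  define C0 where "C0 = (\<Sum>i\<in>Basis. B powr p i) + 1"
  define C where "C = (\<Sum>i\<in>Basis. 2 powr p i) * C0"
  have C0: "C0 \<ge> 0" by (simp add: C0_def sum_nonneg add_nonneg_nonneg)
  have C: "C \<ge> 0" unfolding C_def by (intro mult_nonneg_nonneg C0 sum_nonneg) auto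
  have "\<exists>\<phi> \<Phi>. potential U \<phi> \<Phi> \<and> energy \<Phi> \<le> C * e"
    if U: "open U" "U \<subseteq> \<Omega>" and e: "e > 0" and cap: "cap_open \<Omega> p0 p U < ereal e" for U e
  proof -
    obtain K :: "nat \<Rightarrow> 'n set" where K: "\<And>n. compact (K n)" "\<And>n. K n \<subseteq> U" "incseq K" "\<Union>(range K) = U"
      using open_compact_exhaustion[OF U(1)] by blast
    define \<kappa> where "\<kappa> = e / (measure M (space M) + 1)"
    have mp: "measure M (space M) + 1 > 0" by (smt (verit) measure_nonneg)
    have \<kappa>: "\<kappa> > 0" using e mp by (simp add: \<kappa>_def)
    have \<kappa>m: "\<kappa> * measure M (space M) \<le> e"
    proof -
      have "\<kappa> * measure M (space M) \<le> \<kappa> * (measure M (space M) + 1)" using \<kappa> by (intro mult_left_mono) auto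
      also have "\<dots> = e" using mp by (simp add: \<kappa>_def)
      finally show ?thesis .
    qed
    define J where "J = (\<lambda>(f, F). energy F + \<kappa> * pint M p0 f)"
    have J_nonneg: "J z \<ge> 0" for z
      using \<kappa> by (auto simp: J_def energy_nonneg split: prod.splits)
    \<comment> \<open>These classes are convex and shrink as \<open>n\<close> grows. The upper bound
      1 keeps the lower order term of \<open>J\<close> below \<kappa> times the measure of
      \<Omega>.\<close>
    define A where "A n = {(f, F). W f F \<and> (AE x in M. 0 \<le> f x \<and> f x \<le> 1) \<and> (AE x in M. x \<in> K n \<longrightarrow> f x = 1)}" for n
    have A_mono: "A m \<subseteq> A n" if "n \<le> m" for n m
      using incseqD[OF K(3) that] by (auto simp: A_def elim!: AE_mp)
    have A_ex: "\<exists>z\<in>A n. J z \<le> C0 * e" for n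
    proof -
      have "cap_compact \<Omega> p0 p (K n) \<le> cap_open \<Omega> p0 p U"
        unfolding cap_open_def using K(1,2) by (intro Sup_upper) auto
      then have "cap_compact \<Omega> p0 p (K n) < ereal e" using cap by (rule le_less_trans)
      then obtain \<phi> G where \<phi>: "W \<phi> G" "\<And>x. x \<in> \<Omega> \<Longrightarrow> indicator (K n) x \<le> \<phi> x"
        "(\<Sum>i\<in>Basis. pint M (p i) (\<lambda>x. G x \<bullet> i)) < e"
        unfolding cap_compact_def Inf_less_iff by auto
      define f where "f x = step (\<phi> x)" for x
      define F where "F x = deriv step (\<phi> x) *\<^sub>R G x" for x
      have [measurable]: "\<phi> \<in> borel_measurable M" using WD(1)[OF \<phi>(1)] by (simp add: Lmem_def)
      have [measurable]: "step \<in> borel_measurable borel" "deriv step \<in> borel_measurable borel"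
        by (intro borel_measurable_continuous_onI smooth_continuous smooth_deriv smooth_step)+
      have "(f, F) \<in> A n"
        unfolding A_def
      proof (intro CollectI case_prodI conjI AE_I2 impI)
        show "W f F" using W_compose[OF \<phi>(1) bsmooth_step] by (simp add: f_def[abs_def] F_def[abs_def])
        fix x assume "x \<in> space M" "x \<in> K n"
        then show "f x = 1" using \<phi>(2)[of x] by (auto simp: f_def intro: step_high)
      qed (auto simp: f_def)
      moreover have "J (f, F) \<le> C0 * e"
      proof -
        have "energy F \<le> (\<Sum>i\<in>Basis. B powr p i * e)"
          unfolding energy_def
        proof (rule sum_mono)
          fix i :: 'n assume i: "i \<in> Basis"
          have "pint M (p i) (\<lambda>x. F x \<bullet> i) \<le> B powr p i * pint M (p i) (\<lambda>x. G x \<bullet> i)"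
            unfolding F_def inner_scaleR_left
            by (intro pint_mult_bounded_le WD(2)[OF \<phi>(1) i]) (use B p_pos[OF i] in auto)
          also have "\<dots> \<le> B powr p i * e"
            using \<phi>(3) pint_le_energy[OF i, of G] by (intro mult_left_mono) (auto simp: energy_def)
          finally show "pint M (p i) (\<lambda>x. F x \<bullet> i) \<le> B powr p i * e" .
        qed
        moreover have "pint M p0 f \<le> (\<integral>x. 1 \<partial>M)"
        proof (rule integral_mono)
          have "Lmem M p0 f" unfolding f_def
            by (rule Lmem_bounded[OF finite_M, where B = 1]) (use p0_pos in auto)
          then show "integrable M (\<lambda>x. \<bar>f x\<bar> powr p0)" by (simp add: Lmem_def)
          show "\<bar>f x\<bar> powr p0 \<le> 1" for x
            unfolding f_def using p0_pos by (intro powr_le1) auto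
        qed (simp add: finite_measure.integrable_const[OF finite_M])
        then have "\<kappa> * pint M p0 f \<le> \<kappa> * measure M (space M)" using \<kappa> by (intro mult_left_mono) auto
        ultimately show ?thesis
          using \<kappa>m unfolding J_def C0_def by (simp add: distrib_right sum_distrib_right)
      qed
      ultimately show ?thesis by blast
    qed
    \<comment> \<open>\<open>E\<close> increases because the classes shrink, and it is bounded by
      \<open>C0 * e\<close>. Its convergence is what makes the midpoint defects small.\<close>
    define E where "E n = Inf (J ` A n)" for n
    have bdd: "bdd_below (J ` A n)" for n using J_nonneg by (intro bdd_belowI[of _ 0]) auto
    have E_le: "E n \<le> J z" if "z \<in> A n" for n z unfolding E_def by (intro cInf_lower bdd imageI that)
    have EC: "E n \<le> C0 * e" for n using A_ex[of n] E_le by (meson order_trans)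
    have ne: "J ` A n \<noteq> {}" for n using A_ex[of n] by blast
    have E_mono: "E n \<le> E m" if "n \<le> m" for n m
      unfolding E_def by (intro cInf_superset_mono ne bdd image_mono A_mono that)
    then have "incseq E" by (simp add: incseq_def)
    then obtain L where L: "E \<longlonglongrightarrow> L" "\<And>n. E n \<le> L" using incseq_convergent[of E] EC by blast
    have "\<exists>z\<in>A n. J z < E n + 1 / Suc n" for n
    proof -
      have "\<exists>y\<in>J ` A n. y < E n + 1 / Suc n"
        using cInf_lessD[OF ne, of n "E n + 1 / Suc n"] by (simp add: E_def)
      then show ?thesis by blast
    qed
    then have "\<forall>n. \<exists>z. z \<in> A n \<and> J z < E n + 1 / Suc n" by blast
    from choice[OF this] obtain z where z: "\<And>n. z n \<in> A n" "\<And>n. J (z n) < E n + 1 / Suc n" by blast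
    define f where "f n = fst (z n)" for n
    define F where "F n = snd (z n)" for n
    have zf: "z n = (f n, F n)" for n by (simp add: f_def F_def)
    have fF: "W (f n) (F n)" "AE x in M. 0 \<le> f n x \<and> f n x \<le> 1" "AE x in M. x \<in> K n \<longrightarrow> f n x = 1" for n
      using z(1)[of n] by (auto simp: zf A_def)
    have Jf: "energy (F n) + \<kappa> * pint M p0 (f n) < E n + 1 / Suc n" for n
      using z(2)[of n] by (simp add: zf J_def)
    \<comment> \<open>For n \<le> m the mean of \<open>J (z n)\<close> and \<open>J (z m)\<close> is
      at most \<open>(E n + L) / 2 + 1 / Suc n\<close>, while the midpoint still belongs to
      \<open>A n\<close> and has \<open>J\<close> at least \<open>E n\<close>. The difference of the
      two bounds is \<open>d n\<close>.\<close>
    define d where "d n = (L - E n) / 2 + 1 / Suc n" for n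
    have d0: "d \<longlonglongrightarrow> 0"
    proof -
      have "(\<lambda>n. (L - E n) / 2 + 1 / Suc n) \<longlonglongrightarrow> (L - L) / 2 + 0"
        by (intro tendsto_intros L LIMSEQ_Suc[OF lim_1_over_n]) auto
      then show ?thesis by (simp add: d_def[abs_def])
    qed
    let ?avg = "\<lambda>(f :: 'n \<Rightarrow> real) g x. (1/2) * f x + (1/2) * g x"
    let ?D = "\<lambda>q f g. (pint M q f + pint M q g) / 2 - pint M q (?avg f g)"
    have defect: "?D p0 (f n) (f m) \<le> d n / \<kappa>" "\<And>i. i \<in> Basis \<Longrightarrow> ?D (p i) (\<lambda>x. F n x \<bullet> i) (\<lambda>x. F m x \<bullet> i) \<le> d n"
      if nm: "n \<le> m" for n m
    proof -
      define h where "h = ?avg (f n) (f m)"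
      define H where "H x = (1/2) *\<^sub>R F n x + (1/2) *\<^sub>R F m x" for x
      have "W h H" unfolding h_def H_def by (intro W_add W_cmult fF)
      moreover have "AE x in M. 0 \<le> h x \<and> h x \<le> 1"
        using fF(2)[of n] fF(2)[of m] by eventually_elim (auto simp: h_def)
      moreover have "AE x in M. x \<in> K n \<longrightarrow> h x = 1"
        using fF(3)[of n] fF(3)[of m]
        by eventually_elim (use incseqD[OF K(3) nm] in \<open>auto simp: h_def\<close>)
      ultimately have "(h, H) \<in> A n" by (simp add: A_def)
      from E_le[OF this] have EH: "E n \<le> energy H + \<kappa> * pint M p0 h" by (simp add: J_def)
      have H_i: "pint M (p i) (\<lambda>x. H x \<bullet> i) = pint M (p i) (?avg (\<lambda>x. F n x \<bullet> i) (\<lambda>x. F m x \<bullet> i))" for i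
        by (simp add: H_def inner_add_left)
      have Dn: "?D p0 (f n) (f m) \<ge> 0"
        using pint_midpoint_le[OF p0 WD(1)[OF fF(1)[of n]] WD(1)[OF fF(1)[of m]]] by simp
      have Di: "?D (p i) (\<lambda>x. F n x \<bullet> i) (\<lambda>x. F m x \<bullet> i) \<ge> 0" if "i \<in> Basis" for i
        using pint_midpoint_le[OF p[OF that] WD(2)[OF fF(1)[of n] that] WD(2)[OF fF(1)[of m] that]] by simp
      have Dh: "?D p0 (f n) (f m) = (pint M p0 (f n) + pint M p0 (f m)) / 2 - pint M p0 h"
        by (simp only: h_def)
      have sumD: "(\<Sum>i\<in>Basis. ?D (p i) (\<lambda>x. F n x \<bullet> i) (\<lambda>x. F m x \<bullet> i)) = (energy (F n) + energy (F m)) / 2 - energy H"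
        unfolding energy_def H_i by (simp add: sum.distrib sum_subtractf sum_divide_distrib[symmetric])
      have "(\<Sum>i\<in>Basis. ?D (p i) (\<lambda>x. F n x \<bullet> i) (\<lambda>x. F m x \<bullet> i)) + \<kappa> * ?D p0 (f n) (f m)
        = (J (z n) + J (z m)) / 2 - (energy H + \<kappa> * pint M p0 h)"
        unfolding sumD Dh by (simp add: zf J_def field_simps)
      also have "\<dots> \<le> ((E n + 1 / Suc n) + (L + 1 / Suc n)) / 2 - E n"
      proof -
        have arith: "(a + b) / 2 - c \<le> ((x + s) + (l + s)) / 2 - x"
          if "a < x + s" "b < y + t" "y \<le> l" "t \<le> s" "x \<le> c" for a b c x y l s t :: real
          using that by argo
        have "1 / real (Suc m) \<le> 1 / real (Suc n)" using nm by (simp add: frac_le)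
        then show ?thesis by (rule arith[OF z(2) z(2) L(2) _ EH])
      qed
      also have "\<dots> = d n"
      proof -
        have "((x + s) + (l + s)) / 2 - x = (l - x) / 2 + s" for x s l :: real by (simp add: field_simps)
        then show ?thesis unfolding d_def .
      qed
      finally have tot: "(\<Sum>i\<in>Basis. ?D (p i) (\<lambda>x. F n x \<bullet> i) (\<lambda>x. F m x \<bullet> i)) + \<kappa> * ?D p0 (f n) (f m) \<le> d n" .
      \<comment> \<open>All defects are nonnegative by midpoint convexity, so the bound on their
        weighted sum bounds each of them.\<close>
      have s0: "(\<Sum>i\<in>Basis. ?D (p i) (\<lambda>x. F n x \<bullet> i) (\<lambda>x. F m x \<bullet> i)) \<ge> 0" by (intro sum_nonneg Di)
      have k0: "\<kappa> * ?D p0 (f n) (f m) \<ge> 0" using \<kappa> Dn by (intro mult_nonneg_nonneg) auto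
      have "\<kappa> * ?D p0 (f n) (f m) \<le> d n" using tot s0 by linarith
      then show "?D p0 (f n) (f m) \<le> d n / \<kappa>" using \<kappa> by (simp only: pos_le_divide_eq mult.commute)
      fix i :: 'n assume i: "i \<in> Basis"
      have "?D (p i) (\<lambda>x. F n x \<bullet> i) (\<lambda>x. F m x \<bullet> i) \<le> (\<Sum>i\<in>Basis. ?D (p i) (\<lambda>x. F n x \<bullet> i) (\<lambda>x. F m x \<bullet> i))"
        by (rule member_le_sum[OF i]) (use Di in auto)
      then show "?D (p i) (\<lambda>x. F n x \<bullet> i) (\<lambda>x. F m x \<bullet> i) \<le> d n" using tot k0 by linarith
    qed
    have inv1: "1 / real (Suc n) \<le> 1" for n by simp
    have FR: "pint M (p i) (\<lambda>x. F n x \<bullet> i) \<le> C0 * e + 1 / Suc n" if "i \<in> Basis" for i n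
    proof -
      have "pint M (p i) (\<lambda>x. F n x \<bullet> i) \<le> energy (F n)" by (rule pint_le_energy[OF that])
      moreover have "\<kappa> * pint M p0 (f n) \<ge> 0" using \<kappa> by simp
      ultimately show ?thesis using Jf[of n] EC[of n] by linarith
    qed
    have "\<exists>\<phi>. Lmem M p0 \<phi> \<and> Lconv M p0 f \<phi>"
    proof (rule uniformly_convex_convergent[OF finite_M p0 WD(1)[OF fF(1)], where R = "(C0 * e + 1) / \<kappa>"])
      show "(\<lambda>n. d n / \<kappa>) \<longlonglongrightarrow> 0" using tendsto_divide_zero[OF d0] by simp
      show "pint M p0 (f n) \<le> (C0 * e + 1) / \<kappa>" for n
      proof -
        have "\<kappa> * pint M p0 (f n) \<le> C0 * e + 1"
          using Jf[of n] EC[of n] energy_nonneg[of "F n"] inv1[of n] by linarith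
        then show ?thesis using \<kappa> by (simp add: pos_le_divide_eq mult.commute)
      qed
    qed (rule defect(1))
    then obtain \<phi> where \<phi>: "Lmem M p0 \<phi>" "Lconv M p0 f \<phi>" by blast
    have "\<exists>g. Lmem M (p i) g \<and> Lconv M (p i) (\<lambda>n x. F n x \<bullet> i) g" if i: "i \<in> Basis" for i
    proof (rule uniformly_convex_convergent[OF finite_M p[OF i] WD(2)[OF fF(1) i], where R = "C0 * e + 1"])
      show "pint M (p i) (\<lambda>x. F n x \<bullet> i) \<le> C0 * e + 1" for n
        using FR[OF i, of n] inv1[of n] by linarith
      show "d \<longlonglongrightarrow> 0" by (rule d0)
    qed (rule defect(2)[OF _ i])
    then have "\<forall>i. \<exists>g. i \<in> Basis \<longrightarrow> Lmem M (p i) g \<and> Lconv M (p i) (\<lambda>n x. F n x \<bullet> i) g" by blast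
    from choice[OF this] obtain g where g: "\<And>i. i \<in> Basis \<Longrightarrow> Lmem M (p i) (g i)"
      "\<And>i. i \<in> Basis \<Longrightarrow> Lconv M (p i) (\<lambda>n x. F n x \<bullet> i) (g i)" by blast
    define \<Phi> where "\<Phi> x = (\<Sum>i\<in>Basis. g i x *\<^sub>R i)" for x
    have \<Phi>i: "\<Phi> x \<bullet> i = g i x" if "i \<in> Basis" for i x using that by (simp add: \<Phi>_def)
    have "W \<phi> \<Phi>"
      by (rule W_closed[OF fF(1) \<phi>]) (use g in \<open>simp_all add: \<Phi>i\<close>)
    moreover
    obtain r where r: "strict_mono r" "AE x in M. (\<lambda>n. f (r n) x) \<longlonglongrightarrow> \<phi> x"
      using Lconv_AE_subseq[OF WD(1)[OF fF(1)] \<phi>(1) p0_pos \<phi>(2)] by blast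
    have ae2: "AE x in M. \<forall>n. 0 \<le> f n x \<and> f n x \<le> 1" using fF(2) by (simp add: AE_all_countable)
    have ae3: "AE x in M. \<forall>n. x \<in> K n \<longrightarrow> f n x = 1" using fF(3) by (simp add: AE_all_countable)
    have "AE x in M. 0 \<le> \<phi> x"
      using r(2) ae2 by eventually_elim (auto intro: LIMSEQ_le_const)
    moreover have "AE x in M. x \<in> U \<longrightarrow> 1 \<le> \<phi> x"
      using r(2) ae3
    proof eventually_elim
      case (elim x)
      show ?case
      proof
        assume "x \<in> U"
        then obtain N where "x \<in> K N" using K(4) by auto
        then have "f (r n) x = 1" if "n \<ge> N" for n
          using elim(2) incseqD[OF K(3), of N "r n"] seq_suble[OF r(1), of n] that by fastforce
        then show "1 \<le> \<phi> x" by (intro LIMSEQ_le_const[OF elim(1)] exI[of _ N]) auto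
      qed
    qed
    moreover have "energy \<Phi> \<le> C * e"
    proof -
      have "pint M (p i) (\<lambda>x. \<Phi> x \<bullet> i) \<le> 2 powr p i * (C0 * e)" if i: "i \<in> Basis" for i
      proof (rule LIMSEQ_le_const)
        show "(\<lambda>n. 2 powr p i * (pint M (p i) (\<lambda>x. F n x \<bullet> i - g i x) + (C0 * e + 1 / Suc n))) \<longlonglongrightarrow> 2 powr p i * (C0 * e)"
        proof -
          have "(\<lambda>n. 2 powr p i * (pint M (p i) (\<lambda>x. F n x \<bullet> i - g i x) + (C0 * e + 1 / Suc n))) \<longlonglongrightarrow> 2 powr p i * (0 + (C0 * e + 0))"
            using g(2)[OF i] unfolding Lconv_def by (intro tendsto_intros LIMSEQ_Suc[OF lim_1_over_n])
          then show ?thesis by simp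
        qed
        have "pint M (p i) (\<lambda>x. \<Phi> x \<bullet> i) \<le> 2 powr p i * (pint M (p i) (\<lambda>x. F n x \<bullet> i - g i x) + (C0 * e + 1 / Suc n))" for n
        proof -
          have "pint M (p i) (\<lambda>x. (g i x - F n x \<bullet> i) + F n x \<bullet> i)
              \<le> 2 powr p i * (pint M (p i) (\<lambda>x. g i x - F n x \<bullet> i) + pint M (p i) (\<lambda>x. F n x \<bullet> i))"
            by (intro pint_add_le Lmem_diff g WD(2)[OF fF(1)] i) (use p_pos[OF i] in auto)
          also have "\<dots> \<le> 2 powr p i * (pint M (p i) (\<lambda>x. F n x \<bullet> i - g i x) + (C0 * e + 1 / Suc n))"
            unfolding pint_uminus[where f = "g i"] by (intro mult_left_mono add_left_mono FR i) auto
          finally show ?thesis by (simp add: \<Phi>i[OF i])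
        qed
        then show "\<exists>N. \<forall>n\<ge>N. pint M (p i) (\<lambda>x. \<Phi> x \<bullet> i) \<le> 2 powr p i * (pint M (p i) (\<lambda>x. F n x \<bullet> i - g i x) + (C0 * e + 1 / Suc n))"
          by blast
      qed
      then have "energy \<Phi> \<le> (\<Sum>i\<in>Basis. 2 powr p i * (C0 * e))" unfolding energy_def by (rule sum_mono)
      then show ?thesis by (simp add: C_def sum_distrib_right mult.assoc)
    qed
    ultimately show ?thesis unfolding potential_def by blast
  qed
  then show ?thesis using C by blast
qed

end

subsection \<open>Quasi-continuous functions\<close>

lemma (in complete_measure) borel_measurable_AE_eq:
  assumes "f \<in> borel_measurable M" "AE x in M. f x = g x"
  shows "g \<in> borel_measurable M"
proof (rule measurableI)
  fix A :: "'b set" assume "A \<in> sets borel"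
  then have "f -` A \<inter> space M \<in> sets M" using assms(1) by (rule measurable_sets[rotated])
  then show "g -` A \<inter> space M \<in> sets M"
    by (rule in_sets_AE[rotated]) (use assms(2) in \<open>auto elim!: AE_mp\<close>)
qed simp

lemma complete_measure_lebesgue_on:
  assumes "S \<in> sets lebesgue"
  shows "complete_measure (lebesgue_on S)"
proof
  fix A B :: "'a set" assume "B \<subseteq> A" "A \<in> null_sets (lebesgue_on S)"
  then have "B \<subseteq> S" "B \<in> null_sets lebesgue"
    using null_sets_restrict_space[OF assms] null_sets_completion_subset by blast+
  then show "B \<in> sets (lebesgue_on S)"
    using assms by (auto simp: sets_restrict_space_iff)
qed

definition clip :: "real \<Rightarrow> real \<Rightarrow> real" where
  "clip k t = max (- k) (min k t)"

lemma Tk_ereal [simp]: "Tk k (ereal t) = clip k t"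
  by (simp add: Tk_def clip_def ereal_max[symmetric] ereal_min[symmetric] del: ereal_max ereal_min)

lemma Tk_infty: "0 \<le> k \<Longrightarrow> Tk k \<infinity> = k" "0 \<le> k \<Longrightarrow> Tk k (- \<infinity>) = - k"
  by (auto simp: Tk_def max_def min_def)

lemma abs_clip_le: "0 \<le> k \<Longrightarrow> \<bar>clip k t\<bar> \<le> k"
  by (auto simp: clip_def)

lemma clip_id: "\<bar>t\<bar> \<le> k \<Longrightarrow> clip k t = t"
  by (auto simp: clip_def)

lemma abs_Tk_le: "0 \<le> k \<Longrightarrow> \<bar>Tk k r\<bar> \<le> k"
  by (cases r) (auto simp: Tk_infty abs_clip_le)

lemma continuous_clip: "continuous_on S f \<Longrightarrow> continuous_on S (\<lambda>x. clip k (f x))"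
  unfolding clip_def by (intro continuous_intros)

text \<open>For a bounded subtrahend, cutting \<open>r\<close> at a level \<open>L\<close> beyond
  \<open>k + C\<close> does not change the result, even for infinite \<open>r\<close>.
  Quasi-continuity of the truncations of \<open>u\<close> can thereby be carried over to
  \<psi>.\<close>

lemma Tk_diff_eq_clip:
  assumes "\<bar>s\<bar> \<le> C" "k + C \<le> L" "0 < k"
  shows "Tk k (r - ereal s) = clip k (Tk L r - s)"
proof (cases r)
  case (real t)
  then show ?thesis using assms by (auto simp: clip_def max_def min_def abs_le_iff)
next
  case PInf
  have "Tk L r = L" using assms by (simp add: PInf Tk_infty)
  then show ?thesis using assms by (simp add: PInf Tk_infty clip_def)
next
  case MInf
  have "Tk L r = - L" using assms by (simp add: MInf Tk_infty)
  then show ?thesis using assms by (simp add: MInf Tk_infty clip_def)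
qed

section \<open>Capacity calculus and quasi-everywhere statements\<close>

context anisotropic begin

abbreviation capac :: "'n set \<Rightarrow> ereal" where "capac \<equiv> cap \<Omega> p0 p"
abbreviation quasi :: "('n \<Rightarrow> real) \<Rightarrow> bool" where "quasi \<equiv> quasi_cont \<Omega> p0 p"

lemma cap_nonneg: "0 \<le> capac E"
proof -
  have "0 \<le> cap_compact \<Omega> p0 p {}"
    unfolding cap_compact_def by (intro Inf_greatest) (auto intro!: sum_nonneg)
  also have "\<dots> \<le> cap_open \<Omega> p0 p U" for U
    unfolding cap_open_def by (intro Sup_upper) auto
  finally show ?thesis unfolding cap_def by (intro Inf_greatest) auto
qed

lemma cap_mono: "E \<subseteq> F \<Longrightarrow> capac E \<le> capac F"
  unfolding cap_def by (intro Inf_superset_mono) auto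

lemma cap_le_cap_open: "open V \<Longrightarrow> V \<subseteq> \<Omega> \<Longrightarrow> capac V \<le> cap_open \<Omega> p0 p V"
  unfolding cap_def by (intro Inf_lower) auto

lemma W_zero: "W (\<lambda>x. 0) (\<lambda>x. 0)"
  using W_test_fun[OF test_fun_zero] by (simp add: pder_def)

lemma energy_zero: "energy (\<lambda>x. 0) = 0"
  by (simp add: energy_def)

lemma energy_add_le:
  assumes "W f F" "W g G"
  shows "energy (\<lambda>x. F x + G x) \<le> (\<Sum>i\<in>Basis. 2 powr p i) * (energy F + energy G)"
proof -
  have "energy (\<lambda>x. F x + G x) \<le> (\<Sum>i\<in>Basis. 2 powr p i * (energy F + energy G))"
    unfolding energy_def[of "\<lambda>x. F x + G x"]
  proof (rule sum_mono)
    fix i :: 'n assume i: "i \<in> Basis"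
    have "pint M (p i) (\<lambda>x. F x \<bullet> i + G x \<bullet> i)
        \<le> 2 powr p i * (pint M (p i) (\<lambda>x. F x \<bullet> i) + pint M (p i) (\<lambda>x. G x \<bullet> i))"
      by (intro pint_add_le WD(2)[OF assms(1) i] WD(2)[OF assms(2) i]) (use p_pos[OF i] in auto)
    also have "\<dots> \<le> 2 powr p i * (energy F + energy G)"
      by (intro mult_left_mono add_mono pint_le_energy i) auto
    finally show "pint M (p i) (\<lambda>x. (F x + G x) \<bullet> i) \<le> 2 powr p i * (energy F + energy G)"
      by (simp add: inner_add_left)
  qed
  then show ?thesis by (simp add: sum_distrib_right)
qed

text \<open>A potential of an open superset of \<open>U\<close> with capacity below \<open>e\<close>
  is added to \<phi>, and the sum is a potential of all of \<open>V\<close>. In \<open>C\<close>,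
  the factors \<open>A\<close> and \<open>B\<close> are those of the two capacity comparisons,
  \<open>P\<close> is the price of the energy of a sum, and 1 makes the inequality strict.\<close>

lemma cap_union_potential:
  "\<exists>C>0. \<forall>e U V \<phi> \<Phi>. e > 0 \<longrightarrow> capac U < ereal e \<longrightarrow> open V \<longrightarrow> V \<subseteq> \<Omega> \<longrightarrow> potential (V - U) \<phi> \<Phi> \<longrightarrow>
     energy \<Phi> \<le> e \<longrightarrow>
     capac V < ereal (C * e)"
proof -
  obtain A where A: "A \<ge> 0" "\<And>U e. open U \<Longrightarrow> U \<subseteq> \<Omega> \<Longrightarrow> e > 0 \<Longrightarrow> cap_open \<Omega> p0 p U < ereal e \<Longrightarrow>
    (\<exists>\<phi> \<Phi>. potential U \<phi> \<Phi> \<and> energy \<Phi> \<le> A * e)"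
    using cap_open_potential by blast
  obtain B where B: "B \<ge> 0" "\<And>V \<phi> \<Phi>. open V \<Longrightarrow> V \<subseteq> \<Omega> \<Longrightarrow> potential V \<phi> \<Phi> \<Longrightarrow>
     cap_open \<Omega> p0 p V \<le> ereal (B * energy \<Phi>)"
    using cap_open_le_energy by blast
  define P where "P = (\<Sum>i\<in>Basis. 2 powr p i)"
  have P: "P \<ge> 0" by (simp add: P_def sum_nonneg)
  define C where "C = B * (P * (1 + A)) + 1"
  have C: "C > 0" using A(1) B(1) P by (simp add: C_def add_nonneg_pos)
  have "capac V < ereal (C * e)"
    if e: "e > 0" and U: "capac U < ereal e" and V: "open V" "V \<subseteq> \<Omega>"
      and \<phi>: "potential (V - U) \<phi> \<Phi>" "energy \<Phi> \<le> e" for e U V \<phi> \<Phi>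
  proof -
    obtain U' where U': "open U'" "U \<subseteq> U'" "U' \<subseteq> \<Omega>" "cap_open \<Omega> p0 p U' < ereal e"
      using U unfolding cap_def Inf_less_iff by auto
    obtain \<psi> \<Psi> where \<psi>: "potential U' \<psi> \<Psi>" "energy \<Psi> \<le> A * e"
      using A(2)[OF U'(1,3) e U'(4)] by blast
    note pots = \<phi>(1)[unfolded potential_def] \<psi>(1)[unfolded potential_def]
    have "potential V (\<lambda>x. \<phi> x + \<psi> x) (\<lambda>x. \<Phi> x + \<Psi> x)"
      unfolding potential_def
    proof (intro conjI)
      show "W (\<lambda>x. \<phi> x + \<psi> x) (\<lambda>x. \<Phi> x + \<Psi> x)" using pots by (intro W_add) auto
      have ae: "AE x in M. 0 \<le> \<phi> x" "AE x in M. 0 \<le> \<psi> x" "AE x in M. x \<in> V - U \<longrightarrow> 1 \<le> \<phi> x"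
        "AE x in M. x \<in> U' \<longrightarrow> 1 \<le> \<psi> x" using pots by auto
      show "AE x in M. 0 \<le> \<phi> x + \<psi> x" using ae(1,2) by eventually_elim simp
      show "AE x in M. x \<in> V \<longrightarrow> 1 \<le> \<phi> x + \<psi> x"
        using ae by eventually_elim (use U'(2) in force)
    qed
    then have "cap_open \<Omega> p0 p V \<le> ereal (B * energy (\<lambda>x. \<Phi> x + \<Psi> x))" by (rule B(2)[OF V])
    moreover have "B * energy (\<lambda>x. \<Phi> x + \<Psi> x) < C * e"
    proof -
      have "energy (\<lambda>x. \<Phi> x + \<Psi> x) \<le> P * (energy \<Phi> + energy \<Psi>)"
        unfolding P_def using pots by (intro energy_add_le) auto
      also have "\<dots> \<le> P * (e + A * e)" by (intro mult_left_mono add_mono \<phi>(2) \<psi>(2) P)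
      finally have "B * energy (\<lambda>x. \<Phi> x + \<Psi> x) \<le> B * (P * (e + A * e))" by (intro mult_left_mono B(1))
      also have "\<dots> = B * (P * (1 + A)) * e" by (simp add: algebra_simps)
      also have "\<dots> < C * e" unfolding C_def using e by (intro mult_strict_right_mono) auto
      finally show ?thesis .
    qed
    ultimately show ?thesis
      using cap_le_cap_open[OF V] by (meson ereal_less(2) le_less_trans less_ereal.simps(1) order_trans)
  qed
  then show ?thesis using C by blast
qed

text \<open>Finite subadditivity up to a constant. The preceding bound is applied with
  \<open>(1 + A) * e\<close>, which is large enough for the energy \<open>A * e\<close> of a
  potential of \<open>V\<close>.\<close>

lemma cap_union: "\<exists>C>0. \<forall>e U V. e > 0 \<longrightarrow> open U \<longrightarrow> open V \<longrightarrow> U \<subseteq> \<Omega> \<longrightarrow> V \<subseteq> \<Omega> \<longrightarrow>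
  capac U < ereal e \<longrightarrow> capac V < ereal e \<longrightarrow> capac (U \<union> V) < ereal (C * e)"
proof -
  obtain A where A: "A \<ge> 0" "\<And>U e. open U \<Longrightarrow> U \<subseteq> \<Omega> \<Longrightarrow> e > 0 \<Longrightarrow> cap_open \<Omega> p0 p U < ereal e \<Longrightarrow>
    (\<exists>\<phi> \<Phi>. potential U \<phi> \<Phi> \<and> energy \<Phi> \<le> A * e)"
    using cap_open_potential by blast
  obtain C where C: "C > 0" "\<And>e U V \<phi> \<Phi>. e > 0 \<Longrightarrow> capac U < ereal e \<Longrightarrow> open V \<Longrightarrow> V \<subseteq> \<Omega> \<Longrightarrow> potential (V - U) \<phi> \<Phi> \<Longrightarrow>
     energy \<Phi> \<le> e \<Longrightarrow>
     capac V < ereal (C * e)"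
    using cap_union_potential by blast
  have "capac (U \<union> V) < ereal (C * (1 + A) * e)"
    if e: "e > 0" and o: "open U" "open V" "U \<subseteq> \<Omega>" "V \<subseteq> \<Omega>" and U: "capac U < ereal e" and V: "capac V < ereal e" for e U V
  proof -
    obtain V' where V': "open V'" "V \<subseteq> V'" "V' \<subseteq> \<Omega>" "cap_open \<Omega> p0 p V' < ereal e"
      using V unfolding cap_def Inf_less_iff by auto
    obtain \<psi> \<Psi> where \<psi>: "potential V' \<psi> \<Psi>" "energy \<Psi> \<le> A * e"
      using A(2)[OF V'(1,3) e V'(4)] by blast
    have "e \<le> (1 + A) * e" using A(1) e by simp
    then have "capac U < ereal ((1 + A) * e)" using U less_le_trans by fastforce
    moreover have "potential (U \<union> V - U) \<psi> \<Psi>"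
      using \<psi>(1) V'(2) by (auto simp: potential_def elim!: AE_mp)
    moreover have "energy \<Psi> \<le> (1 + A) * e" using \<psi>(2) e by (simp add: distrib_right)
    ultimately show ?thesis
      using C(2)[of "(1 + A) * e" U "U \<union> V" \<psi> \<Psi>] o A(1) e by (simp add: mult.assoc add_nonneg_pos open_Un)
  qed
  moreover have "C * (1 + A) > 0" using C(1) A(1) by simp
  ultimately show ?thesis by blast
qed

text \<open>The predicate applies to the remaining set and not to its points, so that continuity
  relative to that set and pointwise conditions are treated alike.\<close>

definition off_small :: "('n set \<Rightarrow> bool) \<Rightarrow> bool" where
  "off_small P \<longleftrightarrow> (\<forall>e>0. \<exists>V. open V \<and> V \<subseteq> \<Omega> \<and> capac V < ereal e \<and> P (\<Omega> - V))"

lemma quasi_iff: "quasi f \<longleftrightarrow> off_small (\<lambda>S. continuous_on S f)"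
  by (simp add: quasi_cont_def off_small_def)

lemma off_small_mono: "off_small P \<Longrightarrow> (\<And>S. S \<subseteq> \<Omega> \<Longrightarrow> P S \<Longrightarrow> Q S) \<Longrightarrow> off_small Q"
  unfolding off_small_def by (meson Diff_subset)

lemma off_small_conj:
  assumes "off_small P" "off_small Q" "\<And>S T. T \<subseteq> S \<Longrightarrow> P S \<Longrightarrow> P T" "\<And>S T. T \<subseteq> S \<Longrightarrow> Q S \<Longrightarrow> Q T"
  shows "off_small (\<lambda>S. P S \<and> Q S)"
  unfolding off_small_def
proof (intro allI impI)
  fix e :: real assume e: "e > 0"
  obtain C where C: "C > 0" "\<And>e U V. e > 0 \<Longrightarrow> open U \<Longrightarrow> open V \<Longrightarrow> U \<subseteq> \<Omega> \<Longrightarrow> V \<subseteq> \<Omega> \<Longrightarrow>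
    capac U < ereal e \<Longrightarrow> capac V < ereal e \<Longrightarrow> capac (U \<union> V) < ereal (C * e)"
    using cap_union by blast
  have eC: "e / C > 0" using e C(1) by simp
  obtain U where U: "open U" "U \<subseteq> \<Omega>" "capac U < ereal (e / C)" "P (\<Omega> - U)"
    using assms(1) eC unfolding off_small_def by blast
  obtain V where V: "open V" "V \<subseteq> \<Omega>" "capac V < ereal (e / C)" "Q (\<Omega> - V)"
    using assms(2) eC unfolding off_small_def by blast
  have "capac (U \<union> V) < ereal e" using C(2)[OF eC U(1) V(1) U(2) V(2) U(3) V(3)] C(1) by simp
  moreover have "P (\<Omega> - (U \<union> V))" "Q (\<Omega> - (U \<union> V))"
    by (rule assms(3)[OF _ U(4)] assms(4)[OF _ V(4)]; blast)+
  ultimately show "\<exists>V. open V \<and> V \<subseteq> \<Omega> \<and> capac V < ereal e \<and> P (\<Omega> - V) \<and> Q (\<Omega> - V)"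
    using U V by (intro exI[of _ "U \<union> V"]) auto
qed

text \<open>The set \<open>[f \<notin> S] - U\<close> is relatively open outside \<open>U\<close>, so that its union with \<open>U\<close> is open
  and its capacity is controlled by a potential that is a.e. at least \<open>1\<close> on \<open>[f \<notin> S]\<close>.\<close>

lemma quasi_potential:
  "\<exists>C>0. \<forall>e f S \<phi> \<Phi>. e > 0 \<longrightarrow> quasi f \<longrightarrow> closed S \<longrightarrow> potential {x. f x \<notin> S} \<phi> \<Phi> \<longrightarrow> energy \<Phi> \<le> e \<longrightarrow>
    (\<exists>V. open V \<and> V \<subseteq> \<Omega> \<and> capac V < ereal (C * e) \<and> continuous_on (\<Omega> - V) f \<and> (\<forall>x\<in>\<Omega> - V. f x \<in> S))"
proof -
  obtain C where C: "C > 0" "\<And>e U V \<phi> \<Phi>. e > 0 \<Longrightarrow> capac U < ereal e \<Longrightarrow> open V \<Longrightarrow> V \<subseteq> \<Omega> \<Longrightarrow> potential (V - U) \<phi> \<Phi> \<Longrightarrow>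
     energy \<Phi> \<le> e \<Longrightarrow>
     capac V < ereal (C * e)"
    using cap_union_potential by blast
  have "\<exists>V. open V \<and> V \<subseteq> \<Omega> \<and> capac V < ereal (C * e) \<and> continuous_on (\<Omega> - V) f \<and> (\<forall>x\<in>\<Omega> - V. f x \<in> S)"
    if e: "e > 0" and f: "quasi f" and S: "closed S"
      and \<phi>: "potential {x. f x \<notin> S} \<phi> \<Phi>" "energy \<Phi> \<le> e" for e f S \<phi> \<Phi>
  proof -
    obtain U where U: "open U" "U \<subseteq> \<Omega>" "capac U < ereal e" "continuous_on (\<Omega> - U) f"
      using f e unfolding quasi_cont_def by blast
    have "openin (top_of_set (\<Omega> - U)) ((\<Omega> - U) \<inter> f -` (- S))"
      by (rule continuous_openin_preimage_gen[OF U(4)]) (use S in auto)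
    then obtain O' where O': "open O'" "(\<Omega> - U) \<inter> f -` (- S) = (\<Omega> - U) \<inter> O'"
      by (auto simp: openin_open)
    define V where "V = U \<union> (O' \<inter> \<Omega>)"
    have V: "open V" "V \<subseteq> \<Omega>" using U O' open_\<Omega> by (auto simp: V_def)
    have "V - U \<subseteq> {x. f x \<notin> S}" using O'(2) by (auto simp: V_def)
    then have "potential (V - U) \<phi> \<Phi>"
      using \<phi>(1) by (auto simp: potential_def elim!: AE_mp)
    from C(2)[OF e U(3) V this \<phi>(2)] have "capac V < ereal (C * e)" .
    moreover have "continuous_on (\<Omega> - V) f"
      by (rule continuous_on_subset[OF U(4)]) (auto simp: V_def)
    moreover have "\<forall>x\<in>\<Omega> - V. f x \<in> S" using O'(2) by (auto simp: V_def)
    ultimately show ?thesis using V by blast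
  qed
  then show ?thesis using C(1) by blast
qed

text \<open>Under the a.e. condition the zero function is a potential of the exceptional set, so
  \<open>quasi_potential\<close> yields arbitrarily small capacity. This is the passage from almost
  everywhere to quasi-everywhere for closed conditions.\<close>

lemma quasi_AE_off_small:
  assumes "quasi f" "closed S" "AE x in M. f x \<in> S"
  shows "off_small (\<lambda>A. continuous_on A f \<and> (\<forall>x\<in>A. f x \<in> S))"
  unfolding off_small_def
proof (intro allI impI)
  fix e :: real assume e: "e > 0"
  obtain C where C: "C > 0" "\<And>e f S \<phi> \<Phi>. e > 0 \<Longrightarrow> quasi f \<Longrightarrow> closed S \<Longrightarrow> potential {x. f x \<notin> S} \<phi> \<Phi> \<Longrightarrow> energy \<Phi> \<le> e \<Longrightarrow>
    (\<exists>V. open V \<and> V \<subseteq> \<Omega> \<and> capac V < ereal (C * e) \<and> continuous_on (\<Omega> - V) f \<and> (\<forall>x\<in>\<Omega> - V. f x \<in> S))"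
    using quasi_potential by blast
  have "potential {x. f x \<notin> S} (\<lambda>x. 0) (\<lambda>x. 0)"
    using assms(3) W_zero by (auto simp: potential_def elim!: AE_mp)
  then show "\<exists>V. open V \<and> V \<subseteq> \<Omega> \<and> capac V < ereal e \<and> continuous_on (\<Omega> - V) f \<and> (\<forall>x\<in>\<Omega> - V. f x \<in> S)"
    using C(2)[of "e / C", OF _ assms(1,2)] C(1) e by (simp add: energy_zero)
qed

text \<open>Intersecting open exceptional sets of capacity below \<open>1 / Suc n\<close> gives a
  Borel set, which is the kind of set that \<open>Mb_p\<close> and \<open>dens_Mb_p\<close> speak
  about.\<close>

lemma off_small_imp_null:
  assumes "off_small (\<lambda>A. \<forall>x\<in>A. P x)"
  shows "\<exists>E. E \<in> sets (restrict_space borel \<Omega>) \<and> capac E = 0 \<and> (\<forall>x\<in>\<Omega> - E. P x)"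
proof -
  have "\<forall>n::nat. \<exists>V. open V \<and> V \<subseteq> \<Omega> \<and> capac V < ereal (1 / Suc n) \<and> (\<forall>x\<in>\<Omega> - V. P x)"
    using assms unfolding off_small_def by simp
  from choice[OF this] obtain V where V: "\<And>n::nat. open (V n)" "\<And>n. V n \<subseteq> \<Omega>"
    "\<And>n. capac (V n) < ereal (1 / Suc n)" "\<And>n x. x \<in> \<Omega> - V n \<Longrightarrow> P x" by blast
  define E where "E = (\<Inter>n. V n)"
  have "E \<subseteq> \<Omega>" using V(2) by (auto simp: E_def)
  moreover have "E \<in> sets borel" unfolding E_def using V(1) by auto
  ultimately have "E \<in> sets (restrict_space borel \<Omega>)"
    using open_\<Omega> by (simp add: sets_restrict_space_iff)
  moreover have "capac E = 0"
  proof (rule antisym[OF _ cap_nonneg])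
    have "capac E \<le> ereal (1 / Suc n)" for n
      using cap_mono[of E "V n"] V(3)[of n] unfolding E_def by (meson INF_lower UNIV_I less_imp_le order_trans)
    note le = this
    have "(\<lambda>n. ereal (1 / Suc n)) \<longlonglongrightarrow> ereal 0"
      using LIMSEQ_Suc[OF lim_1_over_n[where 'a = real]] by (simp only: tendsto_ereal)
    then have "capac E \<le> ereal 0" by (rule LIMSEQ_le_const) (intro exI[of _ 0] allI impI le)
    then show "capac E \<le> 0" by (simp add: zero_ereal_def)
  qed
  moreover have "\<forall>x\<in>\<Omega> - E. P x" using V(4) by (auto simp: E_def)
  ultimately show ?thesis by blast
qed

text \<open>Outside each of countably many small open sets \<open>f\<close> is continuous, hence
  Borel; the complements cover \<Omega> up to a Borel set of capacity 0, which is a null set of the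
  measure and is absorbed by its completion.\<close>

lemma quasi_measurable_completion:
  assumes f: "quasi f" and \<nu>: "sets \<nu> = sets (restrict_space borel \<Omega>)"
    and null: "\<And>E. E \<in> sets (restrict_space borel \<Omega>) \<Longrightarrow> capac E = 0 \<Longrightarrow> emeasure \<nu> E = 0"
  shows "f \<in> borel_measurable (completion \<nu>)"
proof -
  have sp: "space \<nu> = \<Omega>" using sets_eq_imp_space_eq[OF \<nu>] by (simp add: space_restrict_space)
  have "\<forall>n::nat. \<exists>V. open V \<and> V \<subseteq> \<Omega> \<and> capac V < ereal (1 / Suc n) \<and> continuous_on (\<Omega> - V) f"
    using f unfolding quasi_cont_def by simp
  from choice[OF this] obtain V where V: "\<And>n::nat. open (V n)" "\<And>n. V n \<subseteq> \<Omega>"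
    "\<And>n. capac (V n) < ereal (1 / Suc n)" "\<And>n. continuous_on (\<Omega> - V n) f" by blast
  have "off_small (\<lambda>A. \<forall>x\<in>A. x \<in> (\<Union>n. \<Omega> - V n))"
    unfolding off_small_def
  proof (intro allI impI)
    fix e :: real assume "e > 0"
    then obtain n where "1 / Suc n < e" using reals_Archimedean[of e] by (auto simp: inverse_eq_divide)
    then have "capac (V n) < ereal e" using V(3)[of n] less_trans by fastforce
    then show "\<exists>W. open W \<and> W \<subseteq> \<Omega> \<and> capac W < ereal e \<and> (\<forall>x\<in>\<Omega> - W. x \<in> (\<Union>n. \<Omega> - V n))"
      using V by (intro exI[of _ "V n"]) auto
  qed
  then obtain E where E: "E \<in> sets (restrict_space borel \<Omega>)" "capac E = 0" "\<forall>x\<in>\<Omega> - E. x \<in> (\<Union>n. \<Omega> - V n)"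
    using off_small_imp_null by blast
  \<comment> \<open>Index 0 holds the exceptional set, so that the pieces cover the whole
    space.\<close>
  define A where "A n = (case n of 0 \<Rightarrow> E | Suc k \<Rightarrow> \<Omega> - V k)" for n
  define g where "g x = (if x \<in> E then 0 else f x)" for x
  have E\<nu>: "E \<in> null_sets \<nu>" using E null \<nu> by (auto simp: null_sets_def)
  have bV: "\<Omega> - V k \<in> sets borel" for k using open_\<Omega> V(1) by auto
  have "g \<in> borel_measurable \<nu>"
  proof (rule measurable_piecewise_restrict2[of A])
    show "A n \<in> sets \<nu>" for n
      using E(1) bV open_\<Omega> unfolding \<nu> by (auto simp: A_def sets_restrict_space_iff split: nat.splits)
    have "E \<subseteq> \<Omega>" using sets.sets_into_space[OF E(1)] by (simp add: space_restrict_space)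
    show "space \<nu> = \<Union>(range A)"
    proof
      show "space \<nu> \<subseteq> \<Union>(range A)"
      proof
        fix x assume "x \<in> space \<nu>"
        then have "x \<in> A 0 \<or> (\<exists>k. x \<in> A (Suc k))" using E(3) by (auto simp: sp A_def)
        then show "x \<in> \<Union>(range A)" by blast
      qed
      show "\<Union>(range A) \<subseteq> space \<nu>"
        using \<open>E \<subseteq> \<Omega>\<close> by (auto simp: sp A_def split: nat.splits)
    qed
    have E_borel: "E \<in> sets borel" using E(1) open_\<Omega> by (auto simp: sets_restrict_space_iff)
    show "\<exists>h\<in>borel_measurable \<nu>. \<forall>x\<in>A n. g x = h x" for n
    proof (cases n)
      case 0
      then show ?thesis by (intro bexI[of _ "\<lambda>_. 0"]) (auto simp: g_def A_def)
    next
      case (Suc k)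
      have "(\<lambda>x. indicator (- E) x *\<^sub>R (indicator (\<Omega> - V k) x *\<^sub>R f x)) \<in> borel_measurable borel"
        by (intro borel_measurable_scaleR[OF borel_measurable_indicator
              borel_measurable_continuous_on_indicator[OF bV V(4)]] borel_comp E_borel)
      then have "(\<lambda>x. indicator (- E) x *\<^sub>R (indicator (\<Omega> - V k) x *\<^sub>R f x)) \<in> borel_measurable (restrict_space borel \<Omega>)"
        by (rule measurable_restrict_space1)
      then have "(\<lambda>x. indicator (- E) x *\<^sub>R (indicator (\<Omega> - V k) x *\<^sub>R f x)) \<in> borel_measurable \<nu>"
        using measurable_cong_sets[OF \<nu> refl] by blast
      then show ?thesis by (rule bexI[rotated]) (auto simp: Suc A_def g_def)
    qed
  qed
  then have "g \<in> borel_measurable (completion \<nu>)" by (rule measurable_completion)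
  moreover have "AE x in completion \<nu>. g x = f x"
    using AE_completion[OF AE_not_in[OF E\<nu>]] by eventually_elim (simp add: g_def)
  ultimately show ?thesis
    by (rule complete_measure.borel_measurable_AE_eq[OF completion.complete_measure_axioms])
qed

end

subsection \<open>Monotone graphs, superposition operators and truncations\<close>

text \<open>The supremum of all values to the left of \<open>r\<close> is compatible with the whole
  graph: it dominates the values on the left and stays below those on the right. Maximality then
  puts it into \<open>\<beta> r\<close>.\<close>

lemma max_monotone_dom_convex:
  assumes \<beta>: "max_monotone \<beta>" and r: "r1 \<in> dom_graph \<beta>" "r2 \<in> dom_graph \<beta>" "r1 < r" "r < r2"
  shows "r \<in> dom_graph \<beta>"
proof -
  have mono: "0 \<le> (s1 - s2) * (r1 - r2)" if "s1 \<in> \<beta> r1" "s2 \<in> \<beta> r2" for r1 r2 s1 s2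
    using \<beta> that unfolding max_monotone_def by blast
  have le: "s \<le> s'" if "s \<in> \<beta> q" "s' \<in> \<beta> q'" "q < q'" for s s' q q'
    using mono[OF that(1,2)] that(3) by (simp add: zero_le_mult_iff)
  define A where "A = {s. \<exists>q<r. s \<in> \<beta> q}"
  obtain s1 s2 where s: "s1 \<in> \<beta> r1" "s2 \<in> \<beta> r2" using r(1,2) by (auto simp: dom_graph_def)
  have ne: "A \<noteq> {}" using s(1) r(3) by (auto simp: A_def)
  have bdd: "bdd_above A"
    using le[OF _ s(2)] r(4) by (intro bdd_aboveI[of _ s2]) (auto simp: A_def)
  have "Sup A \<in> \<beta> r"
  proof -
    have "0 \<le> (Sup A - s') * (r - q)" if s': "s' \<in> \<beta> q" for q s'
    proof -
      consider "q < r" | "q = r" | "q > r" by linarith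
      then show ?thesis
      proof cases
        case 1
        then have "s' \<le> Sup A" using s' by (intro cSup_upper bdd) (auto simp: A_def)
        then show ?thesis using 1 by simp
      next
        case 3
        then have "Sup A \<le> s'" using le[OF _ s'] by (intro cSup_least ne) (auto simp: A_def)
        then show ?thesis using 3 by (simp add: mult_nonpos_nonpos)
      qed simp
    qed
    then show ?thesis using \<beta> unfolding max_monotone_def by blast
  qed
  then show ?thesis by (auto simp: dom_graph_def)
qed

text \<open>If \<open>r\<close> lay beyond \<open>M\<close>, convexity of the domain would place the
  open interval from 0 to \<open>r\<close> in its interior, against the description of the interior
  by \<open>m\<close> and \<open>M\<close>. The gain is a closed condition, as the passage to
  quasi-everywhere requires; the domain itself may fail to be closed.\<close>

lemma dom_graph_bounds:
  assumes \<beta>: "max_monotone \<beta>" "0 \<in> \<beta> 0" and i: "interior (dom_graph \<beta>) = {r. m < ereal r \<and> ereal r < M}"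
    and mM: "m \<le> 0" "0 \<le> M" and r: "r \<in> dom_graph \<beta>"
  shows "m \<le> ereal r \<and> ereal r \<le> M"
proof -
  have 0: "0 \<in> dom_graph \<beta>" using \<beta>(2) by (auto simp: dom_graph_def)
  have int: "m < ereal q \<and> ereal q < M" if "a \<in> dom_graph \<beta>" "b \<in> dom_graph \<beta>" "a < q" "q < b" for a b q
  proof -
    have "{a<..<b} \<subseteq> interior (dom_graph \<beta>)"
      using max_monotone_dom_convex[OF \<beta>(1) that(1,2)] by (intro interior_maximal) auto
    then show ?thesis using that(3,4) i by auto
  qed
  have "ereal r \<le> M"
  proof (rule ccontr)
    assume "\<not> ereal r \<le> M"
    then obtain M' where M': "M = ereal M'" "0 \<le> M'" "M' < r" using mM(2) by (cases M) auto
    then show False using int[OF 0 r, of "(M' + r) / 2"] by simp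
  qed
  moreover have "m \<le> ereal r"
  proof (rule ccontr)
    assume "\<not> m \<le> ereal r"
    then obtain m' where m': "m = ereal m'" "m' \<le> 0" "r < m'" using mM(1) by (cases m) auto
    then show False using int[OF r 0, of "(m' + r) / 2"] by simp
  qed
  ultimately show ?thesis by simp
qed

text \<open>For a simple function the composition is a finite sum of restrictions of the maps
  \<open>\<lambda>x. a x y\<close>. The general case is an a.e. limit, and completeness absorbs the
  null set on which \<open>a x\<close> may fail to be continuous.\<close>

lemma Caratheodory_measurable:
  fixes a :: "'a \<Rightarrow> 'b::euclidean_space \<Rightarrow> 'c::euclidean_space"
  assumes M: "complete_measure M" and a: "\<And>\<zeta>. (\<lambda>x. a x \<zeta>) \<in> borel_measurable M"
    and cont: "AE x in M. continuous_on UNIV (a x)" and D: "D \<in> borel_measurable M"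
  shows "(\<lambda>x. a x (D x)) \<in> borel_measurable M"
proof -
  obtain s where s: "\<And>i. simple_function M (s i)" "\<And>x. x \<in> space M \<Longrightarrow> (\<lambda>i. s i x) \<longlonglongrightarrow> D x"
    using borel_measurable_implies_sequence_metric[OF D, of 0] by blast
  have as: "(\<lambda>x. a x (s i x)) \<in> borel_measurable M" for i
  proof -
    have "(\<lambda>x. \<Sum>y\<in>s i ` space M. indicator (s i -` {y} \<inter> space M) x *\<^sub>R a x y) \<in> borel_measurable M"
      using a simple_functionD(2)[OF s(1)]
      by (intro borel_measurable_sum borel_measurable_scaleR borel_measurable_indicator) auto
    then show ?thesis
    proof (rule measurable_cong[THEN iffD1, rotated])
      fix x assume x: "x \<in> space M"
      have "(\<Sum>y\<in>s i ` space M. indicator (s i -` {y} \<inter> space M) x *\<^sub>R a x y)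
          = (\<Sum>y\<in>s i ` space M. if y = s i x then a x y else 0)"
        using x by (intro sum.cong) auto
      also have "\<dots> = a x (s i x)" using x simple_functionD(1)[OF s(1)] by (simp add: sum.delta)
      finally show "(\<Sum>y\<in>s i ` space M. indicator (s i -` {y} \<inter> space M) x *\<^sub>R a x y) = a x (s i x)" .
    qed
  qed
  have lim: "AE x in M. (\<lambda>i. a x (s i x)) \<longlonglongrightarrow> a x (D x)"
    using cont AE_space
  proof eventually_elim
    case (elim x)
    then have "isCont (a x) (D x)" by (simp add: continuous_on_eq_continuous_at)
    then show ?case using s(2)[OF elim(2)] by (rule isCont_tendsto_compose)
  qed
  have "(\<lambda>x. lim (\<lambda>i. a x (s i x))) \<in> borel_measurable M"
    by (rule borel_measurable_lim_metric[OF as])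
  moreover have "AE x in M. lim (\<lambda>i. a x (s i x)) = a x (D x)"
    using lim by eventually_elim (rule limI)
  ultimately show ?thesis by (rule complete_measure.borel_measurable_AE_eq[OF M])
qed

text \<open>Young's inequality with constants 1: either \<open>s \<le> t powr (p - 1)\<close>, and
  the product is at most \<open>t powr p\<close>, or \<open>t\<close> is at most
  \<open>s powr (1 / (p - 1))\<close>, and the product is at most the other power.\<close>

lemma Young_le:
  assumes "p > 1" "0 \<le> s" "0 \<le> (t::real)"
  shows "s * t \<le> s powr (p / (p - 1)) + t powr p"
proof (cases "s \<le> t powr (p - 1)")
  case True
  have "s * t \<le> t powr (p - 1) * t" using True assms by (intro mult_right_mono) auto
  also have "\<dots> = t powr p" using assms by (cases "t = 0") (auto simp: powr_diff)
  finally show ?thesis by (smt (verit) powr_ge_zero)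
next
  case False
  then have s: "s > 0" by (smt (verit) powr_ge_zero)
  have "t = (t powr (p - 1)) powr (1 / (p - 1))" using assms by (simp add: powr_powr)
  also have "\<dots> \<le> s powr (1 / (p - 1))" using False assms by (intro powr_mono2) auto
  finally have "s * t \<le> s powr 1 * s powr (1 / (p - 1))" using s assms(3) by (intro mult_mono) auto
  also have "\<dots> = s powr (1 + 1 / (p - 1))" by (rule powr_add[symmetric])
  also have "1 + 1 / (p - 1) = p / (p - 1)" using assms(1) by (simp add: field_simps)
  finally show ?thesis by (smt (verit) powr_ge_zero)
qed

lemma powr_mult_le:
  assumes "p > 1" "0 \<le> s" "0 \<le> (t::real)"
  shows "s powr (p - 1) * t \<le> s powr p + t powr p"
proof -
  have "s powr (p - 1) * t \<le> (s powr (p - 1)) powr (p / (p - 1)) + t powr p"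
    by (rule Young_le) (use assms in auto)
  also have "(s powr (p - 1)) powr (p / (p - 1)) = s powr p" using assms by (simp add: powr_powr)
  finally show ?thesis .
qed

section \<open>Cutoffs evaluated at the unknown\<close>

lemma smooth_cutoff: "smooth_fun (cutoff n)"
  by (rule bsmooth_smooth[OF bsmooth_cutoff])

lemma Cc1_cutoff: "Cc1 (cutoff n)" and Cc_cutoff: "Cc (cutoff n)"
proof -
  have "supp_in (cutoff n) UNIV"
    by (rule supp_inI[of "{-(n+1)..n+1}"]) (auto intro!: cutoff_eq_0)
  then show "Cc1 (cutoff n)" "Cc (cutoff n)"
    using smooth_cutoff[of n] smooth_continuous[OF smooth_cutoff] unfolding Cc1_def Cc_def smooth_fun_def by auto
qed

text \<open>Expresses \<open>h(u)\<close> through a real-valued truncation that belongs to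
  \<open>W\<close> and is quasi-continuous; the value 0 at infinity fits because the cutoff is 0 at
  n + 2. The level is n + 2 and not n + 1 so that the truncation still has gradient
  \<open>Du\<close> on the closed layer, including |u| = n + 1.\<close>

lemma eapp_cutoff_eq:
  assumes "0 \<le> n"
  shows "eapp (cutoff n) r = cutoff n (Tk (n + 2) r)"
proof (cases r)
  case (real t)
  have "cutoff n t = cutoff n (clip (n + 2) t)"
  proof (cases "\<bar>t\<bar> \<le> n + 2")
    case True
    then show ?thesis by (simp add: clip_id)
  next
    case False
    then have "\<bar>clip (n + 2) t\<bar> \<ge> n + 1" using assms by (auto simp: clip_def)
    then show ?thesis using False by (simp add: cutoff_eq_0)
  qed
  then show ?thesis using real by (simp add: eapp_def)
qed (use assms in \<open>auto simp: eapp_def Tk_infty cutoff_eq_0\<close>)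

lemma deriv_cutoff_Tk_eq_0:
  assumes "0 \<le> n" "\<not> (ereal n \<le> \<bar>r\<bar> \<and> \<bar>r\<bar> \<le> ereal (n + 1))"
  shows "deriv (cutoff n) (Tk (n + 2) r) = 0"
proof (rule deriv_cutoff_eq_0[OF _ assms(1)])
  show "\<bar>Tk (n + 2) r\<bar> \<le> n \<or> n + 1 \<le> \<bar>Tk (n + 2) r\<bar>"
    using assms by (cases r) (auto simp: Tk_infty clip_def)
qed

lemma Tk_nonneg: "0 \<le> k \<Longrightarrow> 0 \<le> r \<Longrightarrow> 0 \<le> Tk k r"
  by (cases r) (auto simp: Tk_infty clip_def)

lemma Tk_nonpos: "0 \<le> k \<Longrightarrow> r \<le> 0 \<Longrightarrow> Tk k r \<le> 0"
  by (cases r) (auto simp: Tk_infty clip_def)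

section \<open>Quasi-everywhere properties of the solution\<close>

context anisotropic begin

text \<open>Off small open sets \<xi> obeys its a.e. bound, so there the function is a clip of
  \<open>Tk L (u x) - \<xi> x\<close>, built from two functions that are continuous on the same
  set.\<close>

lemma quasi_Tk_diff:
  assumes u: "\<And>l. l > 0 \<Longrightarrow> quasi (\<lambda>x. Tk l (u x))" and \<xi>: "quasi \<xi>" "AE x in M. \<bar>\<xi> x\<bar> \<le> C" and k: "k > 0"
  shows "quasi (\<lambda>x. Tk k (u x - ereal (\<xi> x)))"
proof -
  define L where "L = k + \<bar>C\<bar>"
  have "AE x in M. \<xi> x \<in> {- \<bar>C\<bar>..\<bar>C\<bar>}" using \<xi>(2) by eventually_elim auto
  then have 1: "off_small (\<lambda>A. continuous_on A \<xi> \<and> (\<forall>x\<in>A. \<xi> x \<in> {- \<bar>C\<bar>..\<bar>C\<bar>}))"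
    by (intro quasi_AE_off_small \<xi>(1)) auto
  have 2: "off_small (\<lambda>A. continuous_on A (\<lambda>x. Tk L (u x)))"
    using u[of L] k by (simp add: quasi_iff L_def)
  have "off_small (\<lambda>A. (continuous_on A \<xi> \<and> (\<forall>x\<in>A. \<xi> x \<in> {- \<bar>C\<bar>..\<bar>C\<bar>})) \<and> continuous_on A (\<lambda>x. Tk L (u x)))"
    by (rule off_small_conj[OF 1 2]) (auto intro: continuous_on_subset)
  then show ?thesis
    unfolding quasi_iff
  proof (rule off_small_mono)
    fix A assume A: "(continuous_on A \<xi> \<and> (\<forall>x\<in>A. \<xi> x \<in> {- \<bar>C\<bar>..\<bar>C\<bar>})) \<and> continuous_on A (\<lambda>x. Tk L (u x))"
    then have "continuous_on A (\<lambda>x. clip k (Tk L (u x) - \<xi> x))"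
      by (intro continuous_clip continuous_on_diff) auto
    moreover have "clip k (Tk L (u x) - \<xi> x) = Tk k (u x - ereal (\<xi> x))" if "x \<in> A" for x
      using A that k by (intro Tk_diff_eq_clip[where C = "\<bar>C\<bar>", symmetric]) (auto simp: L_def)
    ultimately show "continuous_on A (\<lambda>x. Tk k (u x - ereal (\<xi> x)))" by (simp cong: continuous_on_cong)
  qed
qed

text \<open>\<open>1 - cutoff n (u)\<close> is a potential of \<open>[\<bar>u\<bar> > n + 1]\<close>, and its energy is controlled by the
  energy of \<open>u\<close> in the layer \<open>[n \<le> \<bar>u\<bar> \<le> n + 1]\<close>.\<close>

lemma finite_quasi_everywhere:
  fixes u :: "'n \<Rightarrow> ereal" and Du :: "'n \<Rightarrow> 'n"
  assumes quasi: "\<And>l. l > 0 \<Longrightarrow> quasi (\<lambda>x. Tk l (u x))"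
    and Du: "\<And>l. l > 0 \<Longrightarrow> W (\<lambda>x. Tk l (u x)) (\<lambda>x. if \<bar>u x\<bar> < ereal l then Du x else 0)"
    and layer: "(\<lambda>n::nat. \<Sum>i\<in>Basis. \<integral>x. indicator {x. ereal (real n) \<le> \<bar>u x\<bar> \<and> \<bar>u x\<bar> \<le> ereal (real n + 1)} x
                     * \<bar>Du x \<bullet> i\<bar> powr (p i) \<partial>M) \<longlonglongrightarrow> 0"
    and int: "\<And>n i. i \<in> Basis \<Longrightarrow> integrable M (\<lambda>x. indicator {x. ereal (real n) \<le> \<bar>u x\<bar> \<and> \<bar>u x\<bar> \<le> ereal (real n + 1)} x
                     * \<bar>Du x \<bullet> i\<bar> powr (p i))"
  shows "off_small (\<lambda>A. \<forall>x\<in>A. \<bar>u x\<bar> \<noteq> \<infinity>)"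
  unfolding off_small_def
proof (intro allI impI)
  fix e :: real assume e: "e > 0"
  obtain B where B: "B > 0" "\<And>n t. \<bar>deriv (cutoff n) t\<bar> \<le> B" using deriv_cutoff_bounded by blast
  obtain C where C: "C > 0" "\<And>e f S \<phi> \<Phi>. e > 0 \<Longrightarrow> quasi f \<Longrightarrow> closed S \<Longrightarrow> potential {x. f x \<notin> S} \<phi> \<Phi> \<Longrightarrow> energy \<Phi> \<le> e \<Longrightarrow>
    (\<exists>V. open V \<and> V \<subseteq> \<Omega> \<and> capac V < ereal (C * e) \<and> continuous_on (\<Omega> - V) f \<and> (\<forall>x\<in>\<Omega> - V. f x \<in> S))"
    using quasi_potential by blast
  let ?I = "\<lambda>n. {x. ereal (real n) \<le> \<bar>u x\<bar> \<and> \<bar>u x\<bar> \<le> ereal (real n + 1)}"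
  define R where "R = (\<Sum>i\<in>Basis. B powr p i)"
  have R: "R \<ge> 0" by (simp add: R_def sum_nonneg)
  have "(\<lambda>n. R * (\<Sum>i\<in>Basis. \<integral>x. indicator (?I n) x * \<bar>Du x \<bullet> i\<bar> powr (p i) \<partial>M)) \<longlonglongrightarrow> 0"
    by (intro tendsto_mult_right_zero layer)
  then have "\<forall>\<^sub>F n in sequentially. R * (\<Sum>i\<in>Basis. \<integral>x. indicator (?I n) x * \<bar>Du x \<bullet> i\<bar> powr (p i) \<partial>M) < e / C"
    by (rule order_tendstoD) (use e C(1) in auto)
  then obtain n where n: "R * (\<Sum>i\<in>Basis. \<integral>x. indicator (?I n) x * \<bar>Du x \<bullet> i\<bar> powr (p i) \<partial>M) < e / C"
    using eventually_happens'[OF sequentially_bot] by blast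
  define f where "f x = Tk (real n + 2) (u x)" for x
  define A where "A t = 1 - cutoff (real n) t" for t
  have bA: "bsmooth A" unfolding A_def by (intro bsmooth_diff bsmooth_const bsmooth_cutoff)
  have dA: "deriv A t = - deriv (cutoff (real n)) t" for t
    using DERIV_diff[OF DERIV_const smooth_has_real_derivative[OF smooth_cutoff], of 1 "real n" t]
    unfolding A_def[abs_def] by (intro DERIV_imp_deriv) simp
  define F where "F x = (if \<bar>u x\<bar> < ereal (real n + 2) then Du x else 0)" for x
  have W: "W (\<lambda>x. A (f x)) (\<lambda>x. deriv A (f x) *\<^sub>R F x)"
    unfolding f_def F_def by (rule W_compose[OF Du bA]) (auto simp: A_def cutoff_eq_1)
  have En: "energy (\<lambda>x. deriv A (f x) *\<^sub>R F x) \<le> e / C"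
  proof -
    let ?l = "\<lambda>i. \<integral>x. indicator (?I n) x * \<bar>Du x \<bullet> i\<bar> powr (p i) \<partial>M"
    have nn: "?l i \<ge> 0" for i by (intro integral_nonneg_AE) auto
    have "energy (\<lambda>x. deriv A (f x) *\<^sub>R F x) \<le> (\<Sum>i\<in>Basis. B powr p i * (\<Sum>i\<in>Basis. ?l i))"
      unfolding energy_def
    proof (rule sum_mono)
      fix i :: 'n assume i: "i \<in> Basis"
      have "pint M (p i) (\<lambda>x. (deriv A (f x) *\<^sub>R F x) \<bullet> i)
          \<le> (\<integral>x. B powr p i * (indicator (?I n) x * \<bar>Du x \<bullet> i\<bar> powr (p i)) \<partial>M)"
      proof (rule integral_mono)
        show "integrable M (\<lambda>x. \<bar>(deriv A (f x) *\<^sub>R F x) \<bullet> i\<bar> powr p i)"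
          using WD(2)[OF W i] by (simp add: Lmem_def)
        show "integrable M (\<lambda>x. B powr p i * (indicator (?I n) x * \<bar>Du x \<bullet> i\<bar> powr (p i)))"
          using int[OF i, of n] by simp
        fix x
        show "\<bar>(deriv A (f x) *\<^sub>R F x) \<bullet> i\<bar> powr p i \<le> B powr p i * (indicator (?I n) x * \<bar>Du x \<bullet> i\<bar> powr (p i))"
        proof (cases "x \<in> ?I n")
          case True
          have "\<bar>(deriv A (f x) *\<^sub>R F x) \<bullet> i\<bar> \<le> B * \<bar>Du x \<bullet> i\<bar>"
            unfolding inner_scaleR_left abs_mult dA using B by (intro mult_mono) (auto simp: F_def)
          then have "\<bar>(deriv A (f x) *\<^sub>R F x) \<bullet> i\<bar> powr p i \<le> (B * \<bar>Du x \<bullet> i\<bar>) powr p i"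
            using p_pos[OF i] by (intro powr_mono2) auto
          then show ?thesis using True B(1) by (simp add: powr_mult)
        next
          case False
          then have "deriv A (f x) = 0" unfolding dA f_def by (subst deriv_cutoff_Tk_eq_0) auto
          then show ?thesis using False by simp
        qed
      qed
      also have "\<dots> = B powr p i * ?l i" by simp
      also have "\<dots> \<le> B powr p i * (\<Sum>i\<in>Basis. ?l i)"
        by (intro mult_left_mono member_le_sum i nn) auto
      finally show "pint M (p i) (\<lambda>x. (deriv A (f x) *\<^sub>R F x) \<bullet> i) \<le> B powr p i * (\<Sum>i\<in>Basis. ?l i)" .
    qed
    then show ?thesis using n by (simp add: R_def sum_distrib_right)
  qed
  have "\<exists>V. open V \<and> V \<subseteq> \<Omega> \<and> capac V < ereal (C * (e / C)) \<and> continuous_on (\<Omega> - V) f \<and> (\<forall>x\<in>\<Omega> - V. f x \<in> {-(real n+1)..real n+1})"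
  proof (rule C(2)[OF _ _ _ _ En])
    show "e / C > 0" using e C(1) by simp
    show "quasi f" unfolding f_def by (rule quasi) simp
    show "potential {x. f x \<notin> {-(real n+1)..real n+1}} (\<lambda>x. A (f x)) (\<lambda>x. deriv A (f x) *\<^sub>R F x)"
      unfolding potential_def using W by (auto simp: A_def cutoff_eq_0 cutoff_le_1)
  qed auto
  then obtain V where V: "open V" "V \<subseteq> \<Omega>" "capac V < ereal e" "\<forall>x\<in>\<Omega> - V. f x \<in> {-(real n+1)..real n+1}"
    using C(1) by auto
  \<comment> \<open>At infinite \<open>u\<close> the truncation has the value n + 2 or -(n + 2),
    outside the closed interval, so such points all lie in \<open>V\<close>.\<close>
  have "\<bar>u x\<bar> \<noteq> \<infinity>" if "x \<in> \<Omega> - V" for x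
  proof
    assume "\<bar>u x\<bar> = \<infinity>"
    then have "u x = \<infinity> \<or> u x = - \<infinity>" by (cases "u x") auto
    then show False using bspec[OF V(4) that] by (auto simp: f_def Tk_infty)
  qed
  with V(1-3) show "\<exists>V. open V \<and> V \<subseteq> \<Omega> \<and> capac V < ereal e \<and> (\<forall>x\<in>\<Omega> - V. \<bar>u x\<bar> \<noteq> \<infinity>)"
    by (intro exI[of _ V] conjI ballI)
qed

lemma AE_of_off_small:
  assumes "off_small (\<lambda>A. \<forall>x\<in>A. P x)" and \<nu>: "sets \<nu> = sets (restrict_space borel \<Omega>)"
    and null: "\<And>E. E \<in> sets (restrict_space borel \<Omega>) \<Longrightarrow> capac E = 0 \<Longrightarrow> emeasure \<nu> E = 0"
  shows "AE x in completion \<nu>. P x"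
proof -
  have sp: "space \<nu> = \<Omega>" using sets_eq_imp_space_eq[OF \<nu>] by (simp add: space_restrict_space)
  obtain E where E: "E \<in> sets (restrict_space borel \<Omega>)" "capac E = 0" "\<forall>x\<in>\<Omega> - E. P x"
    using off_small_imp_null[OF assms(1)] by blast
  have "E \<in> null_sets \<nu>" using E null \<nu> by (auto simp: null_sets_def)
  then have "AE x in \<nu>. x \<notin> E" by (rule AE_not_in)
  then have "AE x in \<nu>. P x" using AE_space by eventually_elim (use E(3) sp in auto)
  then show ?thesis by (rule AE_completion)
qed

end

subsection \<open>The entropy inequality\<close>

theorem theorem3p4:
  fixes \<Omega> :: "'n::euclidean_space set"
    and p0 :: real and p :: "'n \<Rightarrow> real"
    and a :: "'n \<Rightarrow> 'n \<Rightarrow> 'n"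
    and lam \<gamma> :: real and d :: "'n \<Rightarrow> 'n \<Rightarrow> real"
    and \<beta> :: "real \<Rightarrow> real set" and m M :: ereal
    and mp mn :: "'n measure"
    and u :: "'n \<Rightarrow> ereal" and Du :: "'n \<Rightarrow> 'n" and w :: "'n \<Rightarrow> real"
    and vp vn :: "'n measure"
    and \<xi> :: "'n \<Rightarrow> real" and k :: real and G :: "'n \<Rightarrow> 'n"
  assumes dom: "open \<Omega>" "connected \<Omega>" "bounded \<Omega>" "\<Omega> \<noteq> {}"
    and lip: "DIM('n) \<ge> 2 \<Longrightarrow> lipschitz_boundary \<Omega>"
    and exps: "p0 > 1" "\<forall>i\<in>Basis. p i > 1"
    and cara: "\<forall>\<zeta>. (\<lambda>x. a x \<zeta>) \<in> borel_measurable (lebesgue_on \<Omega>)"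
              "AE x in lebesgue_on \<Omega>. continuous_on UNIV (a x)"
    and lamgam: "lam > 0" "\<gamma> > 0"
    and dpos: "\<forall>i\<in>Basis. \<forall>x\<in>\<Omega>. d i x \<ge> 0"
    and dLp: "\<forall>i\<in>Basis. Lp_mem \<Omega> (p i / (p i - 1)) (d i)"
    and H1: "AE x in lebesgue_on \<Omega>. \<forall>\<zeta>.
               (\<Sum>i\<in>Basis. (a x \<zeta> \<bullet> i) * (\<zeta> \<bullet> i)) \<ge> lam * (\<Sum>i\<in>Basis. \<bar>\<zeta> \<bullet> i\<bar> powr (p i))"
    and H2: "AE x in lebesgue_on \<Omega>. \<forall>\<zeta>. \<forall>i\<in>Basis.
               \<bar>a x \<zeta> \<bullet> i\<bar> \<le> \<gamma> * (d i x + \<bar>\<zeta> \<bullet> i\<bar> powr (p i - 1))"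
    and H3: "AE x in lebesgue_on \<Omega>. \<forall>\<zeta> \<eta>. (a x \<zeta> - a x \<eta>) \<bullet> (\<zeta> - \<eta>) \<ge> 0"
    and beta: "max_monotone \<beta>" "0 \<in> \<beta> 0"
      "interior (dom_graph \<beta>) = {r. m < ereal r \<and> ereal r < M}" "m \<le> 0" "0 \<le> M"
    and mu: "Mb_p \<Omega> p0 p mp mn"
    and wL1: "integrable (lebesgue_on \<Omega>) w"
    and umeas: "u \<in> borel_measurable (lebesgue_on \<Omega>)"
    and udom: "AE x in lebesgue_on \<Omega>. \<bar>u x\<bar> \<noteq> \<infinity> \<and> real_of_ereal (u x) \<in> dom_graph \<beta>"
    and uqc: "\<forall>k>0. quasi_cont \<Omega> p0 p (\<lambda>x. Tk k (u x))"
    and Du: "\<forall>k>0. W0_grad \<Omega> p0 p (\<lambda>x. Tk k (u x)) (\<lambda>x. if \<bar>u x\<bar> < ereal k then Du x else 0)"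
    and wbeta: "AE x in lebesgue_on \<Omega>. \<bar>u x\<bar> \<noteq> \<infinity> \<and> w x \<in> \<beta> (real_of_ereal (u x))"
    and v: "Mb \<Omega> vp vn" "sing_leb \<Omega> vp vn"
    and vh: "\<forall>h. Cc h \<longrightarrow> Linf_abs (\<lambda>x. eapp h (u x)) vp vn \<and> dens_Mb_p \<Omega> p0 p (\<lambda>x. eapp h (u x)) vp vn"
    and vpconc: "concentrated_on vp {x. u x = M \<and> u x \<noteq> \<infinity>}"
    and vnconc: "concentrated_on vn {x. u x = m \<and> u x \<noteq> - \<infinity>}"
    and weak: "\<forall>h \<psi> H. Cc1 h \<longrightarrow> W0 \<Omega> p0 p \<psi> \<longrightarrow> Linf_mem \<Omega> \<psi> \<longrightarrow> quasi_cont \<Omega> p0 p \<psi> \<longrightarrow>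
        W0_grad \<Omega> p0 p (\<lambda>x. eapp h (u x) * \<psi> x) H \<longrightarrow>
        (\<integral>x. a x (Du x) \<bullet> H x \<partial>lebesgue_on \<Omega>) + (\<integral>x. w x * eapp h (u x) * \<psi> x \<partial>lebesgue_on \<Omega>)
          + sint vp vn (\<lambda>x. eapp h (u x) * \<psi> x) = sint mp mn (\<lambda>x. eapp h (u x) * \<psi> x)"
    and energy: "(\<lambda>n::nat. \<Sum>i\<in>Basis. \<integral>x. indicator {x. ereal (real n) \<le> \<bar>u x\<bar> \<and> \<bar>u x\<bar> \<le> ereal (real n + 1)} x
                     * \<bar>Du x \<bullet> i\<bar> powr (p i) \<partial>lebesgue_on \<Omega>) \<longlonglongrightarrow> 0"
    and xi: "W0 \<Omega> p0 p \<xi>" "Linf_mem \<Omega> \<xi>" "quasi_cont \<Omega> p0 p \<xi>"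
            "AE x in lebesgue_on \<Omega>. \<xi> x \<in> dom_graph \<beta>"
    and kpos: "k > 0"
    and G: "W0_grad \<Omega> p0 p (\<lambda>x. Tk k (u x - ereal (\<xi> x))) G"
  shows "(\<integral>x. a x (Du x) \<bullet> G x \<partial>lebesgue_on \<Omega>) + (\<integral>x. w x * Tk k (u x - ereal (\<xi> x)) \<partial>lebesgue_on \<Omega>)
           \<le> sint mp mn (\<lambda>x. Tk k (u x - ereal (\<xi> x)))"
proof -
  interpret anisotropic \<Omega> p0 p
    using dom exps by unfold_locales auto
  let ?\<M> = "lebesgue_on \<Omega>"
  note Du = Du[rule_format] and uqc = uqc[rule_format]
  have \<Omega>_sets: "\<Omega> \<in> sets lebesgue" using dom(1) by auto
  have cM: "complete_measure (lebesgue_on \<Omega>)" by (rule complete_measure_lebesgue_on[OF \<Omega>_sets])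
  define \<psi> where "\<psi> x = Tk k (u x - ereal (\<xi> x))" for x
  have \<psi>_def': "(\<lambda>x. Tk k (u x - ereal (\<xi> x))) = \<psi>" by (simp add: \<psi>_def[abs_def])
  have G: "W \<psi> G" using G unfolding \<psi>_def' .
  have \<psi>_bd: "\<bar>\<psi> x\<bar> \<le> k" for x unfolding \<psi>_def using kpos by (intro abs_Tk_le) auto
  have fin: "AE x in ?\<M>. \<bar>u x\<bar> \<noteq> \<infinity>" using udom by eventually_elim simp
  obtain C where C: "AE x in ?\<M>. \<bar>\<xi> x\<bar> \<le> C" using xi(2) by (auto simp: Linf_mem_def)
  have [measurable]: "u \<in> borel_measurable ?\<M>" "\<psi> \<in> borel_measurable ?\<M>" "w \<in> borel_measurable ?\<M>"
    using umeas WD(1)[OF G] wL1 by (auto simp: Lmem_def)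
  have Gm: "(\<lambda>x. G x \<bullet> i) \<in> borel_measurable ?\<M>" if "i \<in> Basis" for i
    using WD(2)[OF G that] by (simp add: Lmem_def)
  have Gmeas[measurable]: "G \<in> borel_measurable ?\<M>"
    by (rule borel_measurable_euclidean_space[THEN iffD2]) (use Gm in blast)
  let ?T = "\<lambda>l x. if \<bar>u x\<bar> < ereal l then Du x else 0"
  have T_mem: "Lmem ?\<M> (p i) (\<lambda>x. ?T l x \<bullet> i)" if "i \<in> Basis" "l > 0" for i l
    by (rule WD(2)[OF Du[OF that(2)] that(1)])
  \<comment> \<open>\<open>Du\<close> is prescribed only through the gradients of truncations. Where
    \<open>u\<close> is finite these are eventually equal to \<open>Du\<close>, which is therefore
    measurable as an a.e. limit.\<close>
  have Dm: "(\<lambda>x. Du x \<bullet> i) \<in> borel_measurable ?\<M>" if i: "i \<in> Basis" for i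
  proof -
    have "(\<lambda>x. lim (\<lambda>n. ?T (real (Suc n)) x \<bullet> i)) \<in> borel_measurable ?\<M>"
      by (intro borel_measurable_lim_metric) (use T_mem[OF i] in \<open>auto simp: Lmem_def\<close>)
    moreover have "AE x in ?\<M>. lim (\<lambda>n. ?T (real (Suc n)) x \<bullet> i) = Du x \<bullet> i"
      using fin
    proof eventually_elim
      case (elim x)
      then obtain t where t: "\<bar>u x\<bar> = ereal t" by (cases "\<bar>u x\<bar>") auto
      obtain N where N: "t < real N" using reals_Archimedean2 by blast
      have "\<forall>\<^sub>F n in sequentially. ?T (real (Suc n)) x \<bullet> i = Du x \<bullet> i"
        using N by (intro eventually_sequentiallyI[of N]) (auto simp: t)
      then show ?case by (intro limI tendsto_eventually)
    qed
    ultimately show ?thesis by (rule complete_measure.borel_measurable_AE_eq[OF cM])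
  qed
  have Dmeas[measurable]: "Du \<in> borel_measurable ?\<M>"
    by (rule borel_measurable_euclidean_space[THEN iffD2]) (use Dm in blast)
  have ameas[measurable]: "(\<lambda>x. a x (Du x)) \<in> borel_measurable ?\<M>"
    by (rule Caratheodory_measurable[OF cM _ cara(2) Dmeas]) (use cara(1) in blast)
  let ?I = "\<lambda>n::nat. {x. ereal (real n) \<le> \<bar>u x\<bar> \<and> \<bar>u x\<bar> \<le> ereal (real n + 1)}"
  have Im[measurable]: "?I n \<inter> space ?\<M> \<in> sets ?\<M>" for n
  proof -
    have "{x \<in> space ?\<M>. ereal (real n) \<le> \<bar>u x\<bar> \<and> \<bar>u x\<bar> \<le> ereal (real n + 1)} \<in> sets ?\<M>" by measurable
    moreover have "{x \<in> space ?\<M>. ereal (real n) \<le> \<bar>u x\<bar> \<and> \<bar>u x\<bar> \<le> ereal (real n + 1)} = ?I n \<inter> space ?\<M>" by auto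
    ultimately show ?thesis by simp
  qed
  have indm[measurable]: "(\<lambda>x. indicator (?I n) x :: real) \<in> borel_measurable ?\<M>" for n
    using Im[of n] by (subst borel_measurable_indicator_iff)
  have int_layer: "integrable ?\<M> (\<lambda>x. indicator (?I n) x * \<bar>Du x \<bullet> i\<bar> powr (p i))" if i: "i \<in> Basis" for n i
  proof (rule Bochner_Integration.integrable_bound)
    show "integrable ?\<M> (\<lambda>x. \<bar>?T (real n + 2) x \<bullet> i\<bar> powr p i)"
      using T_mem[OF i, of "real n + 2"] by (simp add: Lmem_def)
    show "(\<lambda>x. indicator (?I n) x * \<bar>Du x \<bullet> i\<bar> powr (p i)) \<in> borel_measurable ?\<M>"
      using Dm[OF i] by measurable
    have "norm (indicator (?I n) x * \<bar>Du x \<bullet> i\<bar> powr (p i)) \<le> norm (\<bar>?T (real n + 2) x \<bullet> i\<bar> powr p i)" for x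
    proof (cases "x \<in> ?I n")
      case True
      then have "\<bar>u x\<bar> \<le> ereal (real n + 1)" by simp
      also have "\<dots> < ereal (real n + 2)" by simp
      finally show ?thesis by (simp add: indicator_def)
    qed simp
    then show "AE x in ?\<M>. norm (indicator (?I n) x * \<bar>Du x \<bullet> i\<bar> powr (p i)) \<le> norm (\<bar>?T (real n + 2) x \<bullet> i\<bar> powr p i)"
      by simp
  qed
  let ?l = "\<lambda>n i. \<integral>x. indicator (?I n) x * \<bar>Du x \<bullet> i\<bar> powr (p i) \<partial>?\<M>"
  have layer: "(\<lambda>n. ?l n i) \<longlonglongrightarrow> 0" if i: "i \<in> Basis" for i
  proof (rule tendsto_sandwich[OF _ _ tendsto_const energy])
    have nn: "?l n i \<ge> 0" for n i by (intro integral_nonneg_AE) auto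
    then show "\<forall>\<^sub>F n in sequentially. 0 \<le> ?l n i" by simp
    show "\<forall>\<^sub>F n in sequentially. ?l n i \<le> (\<Sum>i\<in>Basis. ?l n i)"
      by (intro always_eventually allI member_le_sum[OF i]) (use nn in auto)
  qed

  have \<psi>_quasi: "quasi \<psi>"
    using quasi_Tk_diff[of u \<xi> C k, OF uqc xi(3) C kpos] unfolding \<psi>_def' .
  have fin_q: "off_small (\<lambda>A. \<forall>x\<in>A. \<bar>u x\<bar> \<noteq> \<infinity>)"
    by (rule finite_quasi_everywhere[OF uqc Du energy int_layer])

  define e where "e n x = eapp (cutoff (real n)) (u x)" for n :: nat and x
  have e_eq: "e n x = cutoff (real n) (Tk (real n + 2) (u x))" for n x
    unfolding e_def by (rule eapp_cutoff_eq) simp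
  have e01: "0 \<le> e n x" "e n x \<le> 1" for n x by (simp_all add: e_eq cutoff_nonneg cutoff_le_1)
  have cut_m[measurable]: "cutoff (real n) \<in> borel_measurable borel" "deriv (cutoff (real n)) \<in> borel_measurable borel" for n
    by (intro borel_measurable_continuous_onI smooth_continuous smooth_deriv smooth_cutoff)+
  have Tk_m: "(\<lambda>x. Tk l (u x)) \<in> borel_measurable ?\<M>" if "l > 0" for l
    using WD(1)[OF Du[OF that]] by (simp add: Lmem_def)
  have e_m[measurable]: "e n \<in> borel_measurable ?\<M>" for n
    using Tk_m[of "real n + 2"] unfolding e_eq[abs_def] by measurable
  have e_1: "e n x = 1" if "\<bar>u x\<bar> \<le> ereal (real n)" for n x
    using that unfolding e_def eapp_def by (cases "u x") (auto simp: cutoff_eq_1)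
  have e_lim: "(\<lambda>n. e n x) \<longlonglongrightarrow> 1" if "\<bar>u x\<bar> \<noteq> \<infinity>" for x
  proof -
    obtain t where t: "\<bar>u x\<bar> = ereal t" using \<open>\<bar>u x\<bar> \<noteq> \<infinity>\<close> by (cases "\<bar>u x\<bar>") auto
    obtain N where N: "t < real N" using reals_Archimedean2 by blast
    have "\<forall>\<^sub>F n in sequentially. e n x = 1"
      using N by (intro eventually_sequentiallyI[of N] e_1) (auto simp: t)
    then show ?thesis by (rule tendsto_eventually)
  qed

  \<comment> \<open>The part of \<open>a x (Du x) \<bullet> H n x\<close> that contains the
    derivative of the cutoff; it has to vanish in the limit.\<close>
  define X where "X n x = deriv (cutoff (real n)) (Tk (real n + 2) (u x)) * \<psi> x * (a x (Du x) \<bullet> ?T (real n + 2) x)" for n x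
  define H where "H n x = e n x *\<^sub>R G x + (deriv (cutoff (real n)) (Tk (real n + 2) (u x)) * \<psi> x) *\<^sub>R ?T (real n + 2) x" for n x
  have WH: "W (\<lambda>x. e n x * \<psi> x) (H n)" for n
  proof -
    \<comment> \<open>A bounded smooth function equal to the identity on [-k,k], with derivative 1
      there, endpoints included. Since |\<psi>| \<le> k it changes neither \<psi> nor
      \<open>G\<close>, but it makes \<open>W_prod\<close> applicable.\<close>
    define S where "S t = t * cutoff k t" for t
    have sS: "smooth_fun S" unfolding S_def by (intro smooth_mult smooth_ident smooth_cutoff)
    have bS: "bsmooth S"
      by (rule bsmooth_compact_support[OF sS, of "-(k+1)" "k+1"]) (auto simp: S_def cutoff_eq_0)
    have S_id: "S t = t" if "\<bar>t\<bar> \<le> k" for t using that by (simp add: S_def cutoff_eq_1)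
    have dS: "deriv S t = 1" if "\<bar>t\<bar> \<le> k" for t
      unfolding S_def deriv_mult_smooth[OF smooth_ident smooth_cutoff]
      using that kpos by (simp add: cutoff_eq_1 deriv_cutoff_eq_0)
    have "W (\<lambda>x. cutoff (real n) (Tk (real n + 2) (u x)) * S (\<psi> x))
      (\<lambda>x. (cutoff (real n) (Tk (real n + 2) (u x)) * deriv S (\<psi> x)) *\<^sub>R G x
        + (deriv (cutoff (real n)) (Tk (real n + 2) (u x)) * S (\<psi> x)) *\<^sub>R ?T (real n + 2) x)"
      by (rule W_prod[OF Du G bsmooth_cutoff bS]) (use kpos in \<open>auto simp: S_id\<close>)
    then show ?thesis unfolding H_def[abs_def] e_eq by (simp add: S_id dS \<psi>_bd)
  qed
  define V where "V n = sint vp vn (\<lambda>x. e n x * \<psi> x)" for n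
  have eq: "(\<integral>x. a x (Du x) \<bullet> H n x \<partial>?\<M>) + (\<integral>x. w x * e n x * \<psi> x \<partial>?\<M>) + V n
      = sint mp mn (\<lambda>x. e n x * \<psi> x)" for n
  proof -
    have "Linf_mem \<Omega> \<psi>" unfolding Linf_mem_def using \<psi>_bd by (auto intro!: exI[of _ k])
    then show ?thesis
      using weak[rule_format, OF Cc1_cutoff _ _ \<psi>_quasi, of "real n" "H n"] G WH[of n]
      unfolding W0_def e_def V_def by blast
  qed

  have V_nonneg: "V n \<ge> 0" for n
  proof -
    have \<xi>_dom: "AE x in ?\<M>. \<xi> x \<in> {t. m \<le> ereal t \<and> ereal t \<le> M}"
      using xi(4) by eventually_elim (use dom_graph_bounds[OF beta] in auto)
    have "closed {t. m \<le> ereal t \<and> ereal t \<le> M}"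
      by (intro closed_Collect_conj closed_Collect_le continuous_intros)
    from quasi_AE_off_small[OF xi(3) this \<xi>_dom]
    have "off_small (\<lambda>A. \<forall>x\<in>A. m \<le> ereal (\<xi> x) \<and> ereal (\<xi> x) \<le> M)"
      by (rule off_small_mono) auto
    then obtain E where E: "E \<in> sets (restrict_space borel \<Omega>)" "capac E = 0"
      "\<And>x. x \<in> \<Omega> - E \<Longrightarrow> m \<le> ereal (\<xi> x) \<and> ereal (\<xi> x) \<le> M"
      using off_small_imp_null by blast
    \<comment> \<open>Vanishing on sets of capacity 0 is assumed for \<open>h(u) v\<close>, so on
      \<open>E\<close> it is the weight \<open>e n\<close> that is 0 a.e. for both parts of
      \<open>v\<close>. The integrand is then 0 there, whatever the sign of \<psi>.\<close>
    have vanish: "AE x in completion \<nu>. x \<in> E \<longrightarrow> e n x = 0"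
      if "sets \<nu> = sets (restrict_space borel \<Omega>)" "e n \<in> borel_measurable (completion \<nu>)"
        "(\<integral>\<^sup>+x\<in>E. ennreal \<bar>e n x\<bar> \<partial>completion \<nu>) = 0" for \<nu>
    proof -
      have [measurable]: "E \<in> sets (completion \<nu>)" "e n \<in> borel_measurable (completion \<nu>)"
        using that E(1) by auto
      have "AE x in completion \<nu>. ennreal \<bar>e n x\<bar> * indicator E x = 0"
        using that(3) by (subst (asm) nn_integral_0_iff_AE) auto
      then show ?thesis by eventually_elim (auto simp: indicator_def split: if_splits)
    qed
    have conc: "AE x in completion \<nu>. x \<in> S \<and> x \<in> \<Omega>"
      if \<nu>: "sets \<nu> = sets (restrict_space borel \<Omega>)" and con: "concentrated_on \<nu> S" for \<nu> S
    proof -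
      have sp: "space \<nu> = \<Omega>" using sets_eq_imp_space_eq[OF \<nu>] by (simp add: space_restrict_space)
      obtain B where B: "B \<in> sets \<nu>" "B \<subseteq> S" "emeasure \<nu> (space \<nu> - B) = 0"
        using con by (auto simp: concentrated_on_def)
      then have "AE x in \<nu>. x \<notin> space \<nu> - B" by (intro AE_not_in) (auto simp: null_sets_def)
      then have "AE x in \<nu>. x \<in> S \<and> x \<in> \<Omega>" using AE_space by eventually_elim (use B(2) sp in auto)
      then show ?thesis by (rule AE_completion)
    qed
    have vs: "sets vp = sets (restrict_space borel \<Omega>)" "sets vn = sets (restrict_space borel \<Omega>)"
      using v(1) by (auto simp: Mb_def)
    have vh': "Linf_abs (e n) vp vn" "dens_Mb_p \<Omega> p0 p (e n) vp vn"
      using vh[rule_format, OF Cc_cutoff[of "real n"]] by (simp_all add: e_def[abs_def])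
    then have em: "e n \<in> borel_measurable (completion vp)" "e n \<in> borel_measurable (completion vn)"
      and ez: "(\<integral>\<^sup>+x\<in>E. ennreal \<bar>e n x\<bar> \<partial>completion vp) = 0" "(\<integral>\<^sup>+x\<in>E. ennreal \<bar>e n x\<bar> \<partial>completion vn) = 0"
      using E(1,2) by (auto simp: Linf_abs_def dens_Mb_p_def)
    have "AE x in completion vp. 0 \<le> e n x * \<psi> x"
      using vanish[OF vs(1) em(1) ez(1)] conc[OF vs(1) vpconc]
    proof eventually_elim
      case (elim x)
      show ?case
      proof (cases "x \<in> E")
        case False
        then have "ereal (\<xi> x) \<le> u x" using elim E(3)[of x] by auto
        then have "0 \<le> u x - ereal (\<xi> x)" by (simp add: ereal_diff_positive)
        then have "0 \<le> \<psi> x" unfolding \<psi>_def using kpos by (intro Tk_nonneg) auto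
        then show ?thesis using e01(1) by simp
      qed (use elim in simp)
    qed
    then have "0 \<le> (\<integral>x. e n x * \<psi> x \<partial>completion vp)" by (rule integral_nonneg_AE)
    moreover have "AE x in completion vn. 0 \<le> - (e n x * \<psi> x)"
      using vanish[OF vs(2) em(2) ez(2)] conc[OF vs(2) vnconc]
    proof eventually_elim
      case (elim x)
      show ?case
      proof (cases "x \<in> E")
        case False
        then have "u x \<le> ereal (\<xi> x)" using elim E(3)[of x] by auto
        then have "u x - ereal (\<xi> x) \<le> 0" by (cases "u x") auto
        then have "\<psi> x \<le> 0" unfolding \<psi>_def using kpos by (intro Tk_nonpos) auto
        then show ?thesis using e01(1) by (simp add: mult_nonneg_nonpos)
      qed (use elim in simp)
    qed
    then have "0 \<le> (\<integral>x. - (e n x * \<psi> x) \<partial>completion vn)" by (rule integral_nonneg_AE)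
    ultimately show ?thesis by (simp add: V_def sint_def)
  qed

  have lim_mu: "(\<lambda>n. sint mp mn (\<lambda>x. e n x * \<psi> x)) \<longlonglongrightarrow> sint mp mn \<psi>"
  proof -
    have "(\<lambda>n. \<integral>x. e n x * \<psi> x \<partial>completion \<nu>) \<longlonglongrightarrow> (\<integral>x. \<psi> x \<partial>completion \<nu>)"
      if \<nu>: "sets \<nu> = sets (restrict_space borel \<Omega>)" "finite_measure \<nu>"
        and null: "\<And>E. E \<in> sets (restrict_space borel \<Omega>) \<Longrightarrow> capac E = 0 \<Longrightarrow> emeasure \<nu> E = 0" for \<nu>
    proof (rule integral_dominated_convergence[where w = "\<lambda>_. k"])
      show [measurable]: "\<psi> \<in> borel_measurable (completion \<nu>)"
        by (rule quasi_measurable_completion[OF \<psi>_quasi \<nu>(1) null])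
      \<comment> \<open>\<open>e n\<close> is a continuous function of a quasi-continuous
        truncation, and this gives measurability for the completed measure.\<close>
      have [measurable]: "(\<lambda>x. Tk (real n + 2) (u x)) \<in> borel_measurable (completion \<nu>)" for n
        by (rule quasi_measurable_completion[OF uqc \<nu>(1) null]) auto
      show "(\<lambda>x. e n x * \<psi> x) \<in> borel_measurable (completion \<nu>)" for n
        unfolding e_eq by measurable
      show "integrable (completion \<nu>) (\<lambda>_. k)"
        using finite_measure.emeasure_finite[OF \<nu>(2)] by (auto simp: integrable_iff_bounded ennreal_mult_less_top less_top)
      show "AE x in completion \<nu>. (\<lambda>n. e n x * \<psi> x) \<longlonglongrightarrow> \<psi> x"
      proof -
        \<comment> \<open>Finiteness must hold for this measure and not just for Lebesgue measure:
          where \<open>u\<close> is infinite, \<open>e n\<close> is 0 for all \<open>n\<close>, but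
          \<psi> is k or -k.\<close>
        have "AE x in completion \<nu>. \<bar>u x\<bar> \<noteq> \<infinity>" by (rule AE_of_off_small[OF fin_q \<nu>(1) null])
        then show ?thesis
        proof eventually_elim
          case (elim x)
          from tendsto_mult[OF e_lim[OF elim] tendsto_const] show ?case by simp
        qed
      qed
      show "AE x in completion \<nu>. norm (e n x * \<psi> x) \<le> k" for n
        using mult_mono[OF e01(2) \<psi>_bd] e01(1) by (auto simp: abs_mult)
    qed
    then show ?thesis
      unfolding sint_def using mu by (intro tendsto_diff) (auto simp: Mb_p_def Mb_def)
  qed

  have lim_w: "(\<lambda>n. \<integral>x. w x * e n x * \<psi> x \<partial>?\<M>) \<longlonglongrightarrow> (\<integral>x. w x * \<psi> x \<partial>?\<M>)"
  proof (rule integral_dominated_convergence[where w = "\<lambda>x. \<bar>w x\<bar> * k"])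
    show "AE x in ?\<M>. (\<lambda>n. w x * e n x * \<psi> x) \<longlonglongrightarrow> w x * \<psi> x"
      using fin
    proof eventually_elim
      case (elim x)
      from tendsto_mult[OF tendsto_mult[OF tendsto_const e_lim[OF elim]] tendsto_const]
      show ?case by simp
    qed
    show "AE x in ?\<M>. norm (w x * e n x * \<psi> x) \<le> \<bar>w x\<bar> * k" for n
    proof (intro AE_I2)
      fix x
      have "\<bar>e n x * \<psi> x\<bar> \<le> 1 * k"
        unfolding abs_mult using e01[of n x] \<psi>_bd[of x] by (intro mult_mono) auto
      then show "norm (w x * e n x * \<psi> x) \<le> \<bar>w x\<bar> * k"
        unfolding real_norm_def mult.assoc abs_mult[of "w x"] by (intro mult_left_mono) auto
    qed
  qed (use wL1 in auto)

  define q where "q i = p i / (p i - 1)" for i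
  have dq: "integrable ?\<M> (\<lambda>x. \<bar>d i x\<bar> powr q i)" and dm: "d i \<in> borel_measurable ?\<M>" if "i \<in> Basis" for i
    using dLp that by (auto simp: Lp_mem_def q_def)
  \<comment> \<open>Quantified over all \<zeta> inside the a.e. statement, to be used at
    \<open>G x\<close> and at \<open>Du x\<close>. Young's inequality is applied to two products,
    each contributing one \<open>\<bar>\<zeta> \<bullet> i\<bar> powr p i\<close>; hence the factor
    2.\<close>
  have growth: "AE x in ?\<M>. \<forall>\<zeta>. \<bar>a x (Du x) \<bullet> \<zeta>\<bar> \<le> \<gamma> * (\<Sum>i\<in>Basis. \<bar>d i x\<bar> powr q i + \<bar>Du x \<bullet> i\<bar> powr p i + 2 * \<bar>\<zeta> \<bullet> i\<bar> powr p i)"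
    using H2 AE_space
  proof eventually_elim
    case (elim x)
    have x: "x \<in> \<Omega>" using elim by simp
    show ?case
    proof
      fix \<zeta> :: 'n
      have "\<bar>a x (Du x) \<bullet> \<zeta>\<bar> \<le> (\<Sum>i\<in>Basis. \<bar>(a x (Du x) \<bullet> i) * (\<zeta> \<bullet> i)\<bar>)"
        by (subst euclidean_inner) (rule sum_abs)
      also have "\<dots> \<le> (\<Sum>i\<in>Basis. \<gamma> * (\<bar>d i x\<bar> powr q i + \<bar>Du x \<bullet> i\<bar> powr p i + 2 * \<bar>\<zeta> \<bullet> i\<bar> powr p i))"
      proof (rule sum_mono)
        fix i :: 'n assume i: "i \<in> Basis"
        have "\<bar>(a x (Du x) \<bullet> i) * (\<zeta> \<bullet> i)\<bar> \<le> (\<gamma> * (d i x + \<bar>Du x \<bullet> i\<bar> powr (p i - 1))) * \<bar>\<zeta> \<bullet> i\<bar>"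
          unfolding abs_mult using elim(1) i by (intro mult_right_mono) auto
        also have "\<dots> = \<gamma> * (\<bar>d i x\<bar> * \<bar>\<zeta> \<bullet> i\<bar> + \<bar>Du x \<bullet> i\<bar> powr (p i - 1) * \<bar>\<zeta> \<bullet> i\<bar>)"
          using dpos i x by (simp add: algebra_simps)
        also have "\<dots> \<le> \<gamma> * ((\<bar>d i x\<bar> powr q i + \<bar>\<zeta> \<bullet> i\<bar> powr p i) + (\<bar>Du x \<bullet> i\<bar> powr p i + \<bar>\<zeta> \<bullet> i\<bar> powr p i))"
          unfolding q_def using lamgam p[OF i]
          by (intro mult_left_mono add_mono Young_le powr_mult_le) auto
        finally show "\<bar>(a x (Du x) \<bullet> i) * (\<zeta> \<bullet> i)\<bar> \<le> \<gamma> * (\<bar>d i x\<bar> powr q i + \<bar>Du x \<bullet> i\<bar> powr p i + 2 * \<bar>\<zeta> \<bullet> i\<bar> powr p i)"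
          by (simp add: algebra_simps)
      qed
      finally show "\<bar>a x (Du x) \<bullet> \<zeta>\<bar> \<le> \<gamma> * (\<Sum>i\<in>Basis. \<bar>d i x\<bar> powr q i + \<bar>Du x \<bullet> i\<bar> powr p i + 2 * \<bar>\<zeta> \<bullet> i\<bar> powr p i)"
        by (simp add: sum_distrib_left)
    qed
  qed

  \<comment> \<open>If |u| is at least \<open>L\<close>, then |u - \<xi>| exceeds k wherever |\<xi>|
    \<le> C and \<open>u\<close> is finite, so that \<psi> is k or -k.\<close>
  define L where "L = k + \<bar>C\<bar> + 1"
  have L: "L > 0" using kpos by (simp add: L_def)
  \<comment> \<open>Both levels differ from 0, as \<open>W_gradient_zero_on_level\<close>
    demands.\<close>
  have "k \<noteq> 0" "- k \<noteq> 0" using kpos by auto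
  from this[THEN W_gradient_zero_on_level[OF G]] C fin
  have G0: "AE x in ?\<M>. \<bar>u x\<bar> < ereal L \<or> G x = 0"
  proof eventually_elim
    case (elim x)
    show ?case
    proof (cases "\<bar>u x\<bar> < ereal L")
      case False
      obtain t where t: "u x = ereal t" using elim(4) by (cases "u x") auto
      have "\<psi> x = k \<or> \<psi> x = - k"
        using False elim(3) kpos by (auto simp: \<psi>_def t L_def clip_def)
      then show ?thesis using elim(1,2) kpos by auto
    qed simp
  qed
  \<comment> \<open>Powers of \<open>Du\<close> are known to be integrable only below a truncation
    level. Since \<open>G\<close> vanishes for |u| \<ge> L, \<open>Du\<close> may be replaced by the
    gradient of the truncation at \<open>L\<close>.\<close>
  have aG_int: "integrable ?\<M> (\<lambda>x. a x (Du x) \<bullet> G x)"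
  proof (rule Bochner_Integration.integrable_bound)
    show "integrable ?\<M> (\<lambda>x. \<gamma> * (\<Sum>i\<in>Basis. \<bar>d i x\<bar> powr q i + \<bar>?T L x \<bullet> i\<bar> powr p i + 2 * \<bar>G x \<bullet> i\<bar> powr p i))"
    proof (intro integrable_mult_right Bochner_Integration.integrable_sum Bochner_Integration.integrable_add)
      fix i :: 'n assume i: "i \<in> Basis"
      show "integrable ?\<M> (\<lambda>x. \<bar>?T L x \<bullet> i\<bar> powr p i)" using T_mem[OF i L] by (simp add: Lmem_def)
      show "integrable ?\<M> (\<lambda>x. \<bar>G x \<bullet> i\<bar> powr p i)" using WD(2)[OF G i] by (simp add: Lmem_def)
      show "integrable ?\<M> (\<lambda>x. \<bar>d i x\<bar> powr q i)" by (rule dq[OF i])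
    qed
    show "AE x in ?\<M>. norm (a x (Du x) \<bullet> G x) \<le> norm (\<gamma> * (\<Sum>i\<in>Basis. \<bar>d i x\<bar> powr q i + \<bar>?T L x \<bullet> i\<bar> powr p i + 2 * \<bar>G x \<bullet> i\<bar> powr p i))"
      using growth G0
    proof eventually_elim
      case (elim x)
      show ?case
      proof (cases "\<bar>u x\<bar> < ereal L")
        case True
        then show ?thesis using spec[OF elim(1), of "G x"] by simp
      qed (use elim(2) in simp)
    qed
  qed measurable

  obtain B where B: "B > 0" "\<And>n t. \<bar>deriv (cutoff n) t\<bar> \<le> B" using deriv_cutoff_bounded by blast
  \<comment> \<open>The growth bound at \<zeta> = \<open>Du x\<close>, localised to the layer: 3 is
    1 + 2, and \<open>B * k\<close> bounds the derivative of the cutoff times \<psi>.\<close>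
  let ?Z = "\<lambda>n x. B * k * (\<gamma> * (\<Sum>i\<in>Basis. indicator (?I n) x * \<bar>d i x\<bar> powr q i + 3 * (indicator (?I n) x * \<bar>Du x \<bullet> i\<bar> powr p i)))"
  have int_d: "integrable ?\<M> (\<lambda>x. indicator (?I n) x * \<bar>d i x\<bar> powr q i)" if i: "i \<in> Basis" for i n
  proof (rule Bochner_Integration.integrable_bound[OF dq[OF i]])
    show "(\<lambda>x. indicator (?I n) x * \<bar>d i x\<bar> powr q i) \<in> borel_measurable ?\<M>"
      using dm[OF i] by measurable
    show "AE x in ?\<M>. norm (indicator (?I n) x * \<bar>d i x\<bar> powr q i) \<le> norm (\<bar>d i x\<bar> powr q i)"
      by (auto simp: indicator_def)
  qed
  have Z_int: "integrable ?\<M> (?Z n)" for n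
    by (intro integrable_mult_right Bochner_Integration.integrable_sum Bochner_Integration.integrable_add int_d int_layer)
  have X_le: "AE x in ?\<M>. \<bar>X n x\<bar> \<le> ?Z n x" for n
    using growth
  proof eventually_elim
    case (elim x)
    show ?case
    proof (cases "x \<in> ?I n")
      case True
      then have "\<bar>u x\<bar> \<le> ereal (real n + 1)" by simp
      also have "\<dots> < ereal (real n + 2)" by simp
      finally have T: "?T (real n + 2) x = Du x" by simp
      have "\<bar>X n x\<bar> \<le> B * k * \<bar>a x (Du x) \<bullet> Du x\<bar>"
        unfolding X_def abs_mult T using B \<psi>_bd[of x] kpos by (intro mult_mono) auto
      also have "\<dots> \<le> B * k * (\<gamma> * (\<Sum>i\<in>Basis. \<bar>d i x\<bar> powr q i + \<bar>Du x \<bullet> i\<bar> powr p i + 2 * \<bar>Du x \<bullet> i\<bar> powr p i))"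
        using spec[OF elim, of "Du x"] B(1) kpos by (intro mult_left_mono) auto
      also have "\<dots> = ?Z n x" using True by (simp add: add.commute)
      finally show ?thesis .
    next
      case False
      then have "X n x = 0" unfolding X_def by (subst deriv_cutoff_Tk_eq_0) auto
      then show ?thesis using False by simp
    qed
  qed
  have X_m: "X n \<in> borel_measurable ?\<M>" for n
  proof -
    have [measurable]: "(\<lambda>x. Tk (real n + 2) (u x)) \<in> borel_measurable ?\<M>" by (rule Tk_m) simp
    show ?thesis unfolding X_def by measurable
  qed
  have X_int: "integrable ?\<M> (X n)" for n
    by (rule Bochner_Integration.integrable_bound[OF Z_int[of n] X_m]) (use X_le[of n] in \<open>auto elim!: AE_mp\<close>)
  have lim_X: "(\<lambda>n. \<integral>x. X n x \<partial>?\<M>) \<longlonglongrightarrow> 0"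
  proof (rule tendsto_0_le[where K = 1])
    \<comment> \<open>The energy condition says nothing about \<open>d\<close>; here dominated
      convergence works, since every point with finite \<open>u\<close> eventually leaves the
      layers.\<close>
    have d_lim: "(\<lambda>n. \<integral>x. indicator (?I n) x * \<bar>d i x\<bar> powr q i \<partial>?\<M>) \<longlonglongrightarrow> 0" if i: "i \<in> Basis" for i
    proof -
      have "(\<lambda>n. \<integral>x. indicator (?I n) x * \<bar>d i x\<bar> powr q i \<partial>?\<M>) \<longlonglongrightarrow> (\<integral>x. 0 \<partial>?\<M>)"
      proof (rule integral_dominated_convergence[OF _ _ dq[OF i]])
        show "AE x in ?\<M>. (\<lambda>n. indicator (?I n) x * \<bar>d i x\<bar> powr q i) \<longlonglongrightarrow> 0"
          using fin
        proof eventually_elim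
          case (elim x)
          then obtain t where t: "\<bar>u x\<bar> = ereal t" by (cases "\<bar>u x\<bar>") auto
          obtain N where N: "t < real N" using reals_Archimedean2 by blast
          have "\<forall>\<^sub>F n in sequentially. indicator (?I n) x * \<bar>d i x\<bar> powr q i = 0"
            using N by (intro eventually_sequentiallyI[of N]) (auto simp: t)
          then show ?case by (rule tendsto_eventually)
        qed
      qed (use int_d[OF i] in \<open>auto simp: indicator_def\<close>)
      then show ?thesis by simp
    qed
    have Z: "(\<integral>x. ?Z n x \<partial>?\<M>) = B * k * (\<gamma> * (\<Sum>i\<in>Basis. (\<integral>x. indicator (?I n) x * \<bar>d i x\<bar> powr q i \<partial>?\<M>) + 3 * ?l n i))" for n
      using int_d int_layer by (simp add: Bochner_Integration.integral_sum)
    show "(\<lambda>n. \<integral>x. ?Z n x \<partial>?\<M>) \<longlonglongrightarrow> 0"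
      unfolding Z by (intro tendsto_mult_right_zero tendsto_null_sum tendsto_add_zero d_lim layer)
    show "\<forall>\<^sub>F n in sequentially. norm (\<integral>x. X n x \<partial>?\<M>) \<le> norm (\<integral>x. ?Z n x \<partial>?\<M>) * 1"
    proof (intro always_eventually allI)
      fix n
      have "norm (\<integral>x. X n x \<partial>?\<M>) \<le> (\<integral>x. norm (X n x) \<partial>?\<M>)" by (rule integral_norm_bound)
      also have "\<dots> \<le> (\<integral>x. ?Z n x \<partial>?\<M>)"
        using X_le[of n] by (intro integral_mono_AE integrable_norm X_int Z_int) auto
      finally show "norm (\<integral>x. X n x \<partial>?\<M>) \<le> norm (\<integral>x. ?Z n x \<partial>?\<M>) * 1" by simp
    qed
  qed

  \<comment> \<open>Where \<open>G\<close> does not vanish, |u| < L \<le> n for a.e. x and so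
    \<open>e n = 1\<close>: for large \<open>n\<close> the principal term is already equal to its
    limit.\<close>
  have aH: "(\<integral>x. a x (Du x) \<bullet> H n x \<partial>?\<M>) = (\<integral>x. a x (Du x) \<bullet> G x \<partial>?\<M>) + (\<integral>x. X n x \<partial>?\<M>)" if n: "L \<le> real n" for n
  proof -
    have "(\<integral>x. a x (Du x) \<bullet> H n x \<partial>?\<M>) = (\<integral>x. a x (Du x) \<bullet> G x + X n x \<partial>?\<M>)"
    proof (rule integral_cong_AE)
      have "H n \<in> borel_measurable ?\<M>"
        by (rule borel_measurable_euclidean_space[THEN iffD2])
          (use WD(2)[OF WH[of n]] in \<open>auto simp: Lmem_def\<close>)
      then show "(\<lambda>x. a x (Du x) \<bullet> H n x) \<in> borel_measurable ?\<M>" by measurable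
      show "(\<lambda>x. a x (Du x) \<bullet> G x + X n x) \<in> borel_measurable ?\<M>" using X_m[of n] by measurable
      show "AE x in ?\<M>. a x (Du x) \<bullet> H n x = a x (Du x) \<bullet> G x + X n x"
        using G0
      proof eventually_elim
        case (elim x)
        have "e n x *\<^sub>R G x = G x"
        proof (cases "\<bar>u x\<bar> < ereal L")
          case True
          then have "\<bar>u x\<bar> \<le> ereal (real n)" using n by (meson ereal_less_eq(3) less_imp_le order_trans)
          then show ?thesis by (simp add: e_1)
        qed (use elim in simp)
        then show ?case by (simp add: H_def X_def inner_add_right)
      qed
    qed
    then show ?thesis using aG_int X_int by simp
  qed

  have "(\<integral>x. a x (Du x) \<bullet> G x \<partial>?\<M>) + 0 + (\<integral>x. w x * \<psi> x \<partial>?\<M>) \<le> sint mp mn \<psi>"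
  proof (rule LIMSEQ_le)
    show "(\<lambda>n. (\<integral>x. a x (Du x) \<bullet> G x \<partial>?\<M>) + (\<integral>x. X n x \<partial>?\<M>) + (\<integral>x. w x * e n x * \<psi> x \<partial>?\<M>))
      \<longlonglongrightarrow> (\<integral>x. a x (Du x) \<bullet> G x \<partial>?\<M>) + 0 + (\<integral>x. w x * \<psi> x \<partial>?\<M>)"
      by (intro tendsto_add tendsto_const lim_X lim_w)
    show "(\<lambda>n. sint mp mn (\<lambda>x. e n x * \<psi> x)) \<longlonglongrightarrow> sint mp mn \<psi>" by (rule lim_mu)
    obtain N where N: "L < real N" using reals_Archimedean2 by blast
    have "(\<integral>x. a x (Du x) \<bullet> G x \<partial>?\<M>) + (\<integral>x. X n x \<partial>?\<M>) + (\<integral>x. w x * e n x * \<psi> x \<partial>?\<M>)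
      \<le> sint mp mn (\<lambda>x. e n x * \<psi> x)" if "n \<ge> N" for n
    proof -
      have "L \<le> real n" using N that by linarith
      then show ?thesis using eq[of n] aH[of n] V_nonneg[of n] by linarith
    qed
    then show "\<exists>N. \<forall>n\<ge>N. (\<integral>x. a x (Du x) \<bullet> G x \<partial>?\<M>) + (\<integral>x. X n x \<partial>?\<M>) + (\<integral>x. w x * e n x * \<psi> x \<partial>?\<M>)
      \<le> sint mp mn (\<lambda>x. e n x * \<psi> x)" by blast
  qed
  then show ?thesis by (simp add: \<psi>_def[abs_def])
qed

end
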